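(* Let $n\ge2$. Suppose that for every $p\in\mathbb{N}$, every $K\in\mathcal{K}(\mathbb{R}^n)$ with $\dim(K)=n$ and every $\bm t\in\Theta_p$ one has $$\frac{|D_p^{\bm t}K|}{|K|^p}\leq\frac{|D_p^{\bm t}S_n|}{|S_n|^p},$$ where $S_n\in\mathcal{K}(\mathbb{R}^n)$ is an $n$-simplex, and that if equality holds for some $\bm t\in\mathrm{relint}(\Theta_p)$, then $K$ is a simplex. Then for every $p\in\mathbb{N}$, $K\in\mathcal{K}(\mathbb{R}^n)$ and $\bm t=(t_0,\dots,t_p)\in\Theta_p$ one has $$\sum_{\bm j\in\mathcal{J}^n_p}q_{n,p,\bm j}(\bm t)\,W_{p,K}(\bm j)\leq\Big(\prod_{l=0}^pt_l^n\Big)|K|^p,$$ where, denoting $t_{\min}=\min\{t_0,\dots,t_p\}$, $$q_{n,p,\bm j}(\bm t)=n(t_{\min})^n\binom{np}{n-\bm j}\int_0^1(1-s)^{n-1}\prod_{l=0}^p\big(t_l-(1-s)t_{\min}\big)^{n-j_l}\,ds,$$ and if $\dim(K)=n$ and equality holds in the latter inequality for some $\bm t\in\mathrm{relint}(\Theta_p)$, then $K$ is a simplex.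
   Context: $\mathcal{K}(\mathbb{R}^n)$ denotes the set of convex bodies, i.e. nonempty compact convex subsets of $\mathbb{R}^n$; $|\cdot|$ is Lebesgue measure (in the dimension of the ambient space); $\dim K$ is the dimension of the affine span of $K$; a simplex is the convex hull of affinely independent points, an $n$-simplex that of $n+1$ such points. The mixed volume of $K_1,\dots,K_N\in\mathcal{K}(\mathbb{R}^N)$ is $V(K_1,\dots,K_N)=\frac1{N!}\frac{\partial^N}{\partial s_1\cdots\partial s_N}\big|_{s_1=\dots=s_N=0}|s_1K_1+\dots+s_NK_N|$ (Minkowski sums; the volume is a homogeneous polynomial of degree $N$ in $s_1,\dots,s_N\ge0$). $L[k]$ means that $L$ is repeated $k$ times. Identify $\mathbb{R}^{pn}=(\mathbb{R}^n)^p$; $\Delta_p(x)=(x,\dots,x)$ is the diagonal embedding $\mathbb{R}^n\to\mathbb{R}^{pn}$ and $\iota_i:\mathbb{R}^n\to\mathbb{R}^{pn}$, $1\le i\le p$, the inclusion into the $i$-th factor. $\mathcal{J}_p^n=\{\bm j=(j_0,\dots,j_p)\in\mathbb{N}_0^{p+1}:j_0+\dots+j_p=n\}$; $\binom{np}{n-\bm j}=\frac{(np)!}{(n-j_0)!\cdots(n-j_p)!}$; $W_{p,K}(\bm j)=V\big(-\Delta_pK[n-j_0],\iota_1K[n-j_1],\dots,\iota_pK[n-j_p]\big)$. $\Theta_p=\{\bm t=(t_0,\dots,t_p)\in\mathbb{R}^{p+1}:t_l\ge0,\ t_0+\dots+t_p=1\}$, with relative interior $\mathrm{relint}(\Theta_p)$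 (all $t_l>0$). Convention $0^0=1$. The higher-order unbalanced difference body is the Minkowski sum $D_p^{\bm t}K=-t_0\Delta_pK+\sum_{l=1}^pt_l\iota_lK\subset\mathbb{R}^{np}$. (The ratio $|D_p^{\bm t}S_n|/|S_n|^p$ does not depend on the choice of the $n$-simplex, by affine invariance.) *)

theory Defs
  imports "HOL-Analysis.Analysis"
begin

definition convex_body :: "'a::euclidean_space set \<Rightarrow> bool" where
  "convex_body K \<longleftrightarrow> K \<noteq> {} \<and> compact K \<and> convex K"

definition is_simplex :: "'a::euclidean_space set \<Rightarrow> bool" where
  "is_simplex K \<longleftrightarrow> (\<exists>m. m simplex K)"

text \<open>
  The number p of factors is quantified inside the main statement, so it cannot be a type index.
  A point of \<open>(\<real>\<^sup>n)\<^sup>p\<close> is a function \<open>nat \<Rightarrow> real ^ 'n\<close> that is extensional on \<open>{1..p}\<close>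
  (value \<open>undefined\<close> elsewhere), as in the product measures of the library. All sets measured
  below are compact, so the Borel version of Lebesgue measure is enough.
\<close>

definition pvol :: "nat \<Rightarrow> (nat \<Rightarrow> real ^ 'n) set \<Rightarrow> real" where
  "pvol p A = measure (\<Pi>\<^sub>M i\<in>{1..p}. lborel) A"

definition pscale :: "nat \<Rightarrow> real \<Rightarrow> (nat \<Rightarrow> real ^ 'n) set \<Rightarrow> (nat \<Rightarrow> real ^ 'n) set" where
  "pscale p c A = (\<lambda>x. \<lambda>i\<in>{1..p}. c *\<^sub>R x i) ` A"

text \<open>Minkowski sum, in \<open>(\<real>\<^sup>n)\<^sup>p\<close>, of a family of sets.\<close>

definition pminkowski ::
  "nat \<Rightarrow> 'k set \<Rightarrow> ('k \<Rightarrow> (nat \<Rightarrow> real ^ 'n) set) \<Rightarrow> (nat \<Rightarrow> real ^ 'n) set" where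
  "pminkowski p I A = {(\<lambda>i\<in>{1..p}. \<Sum>k\<in>I. x k i) | x. \<forall>k\<in>I. x k \<in> A k}"

definition diag_emb :: "nat \<Rightarrow> real ^ 'n \<Rightarrow> (nat \<Rightarrow> real ^ 'n)" where
  "diag_emb p x = (\<lambda>i\<in>{1..p}. x)"

definition factor_emb :: "nat \<Rightarrow> nat \<Rightarrow> real ^ 'n \<Rightarrow> (nat \<Rightarrow> real ^ 'n)" where
  "factor_emb p l x = (\<lambda>i\<in>{1..p}. if i = l then x else 0)"

text \<open>
  Partial derivative in the i-th coordinate of a function on the orthant of nonnegative
  coordinates. It is one-sided at the boundary: the volume of \<open>s\<^sub>1 K\<^sub>1 + \<dots> + s\<^sub>N K\<^sub>N\<close> is
  polynomial in the \<open>s\<^sub>i\<close> only where they are nonnegative.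
\<close>

definition orthant_partial :: "nat \<Rightarrow> ((nat \<Rightarrow> real) \<Rightarrow> real) \<Rightarrow> (nat \<Rightarrow> real) \<Rightarrow> real" where
  "orthant_partial i f s = vector_derivative (\<lambda>u. f (s(i := u))) (at (s i) within {0..})"

text \<open>
  Mixed volume of the list \<open>Ks\<close> of convex bodies in \<open>(\<real>\<^sup>n)\<^sup>p\<close>; it is only meant for lists of
  length \<open>N = p * CARD('n)\<close>, the dimension of that space.
\<close>

definition mixed_volume :: "nat \<Rightarrow> (nat \<Rightarrow> real ^ 'n) set list \<Rightarrow> real" where
  "mixed_volume p Ks = (let N = p * CARD('n) in
     1 / fact N *
     foldr orthant_partial [0..<N]
       (\<lambda>s. pvol p (pminkowski p {..<N} (\<lambda>k. pscale p (s k) (Ks ! k)))) (\<lambda>_. 0))"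

definition multi_indices :: "nat \<Rightarrow> nat \<Rightarrow> (nat \<Rightarrow> nat) set" where
  "multi_indices n p = {j \<in> {..p} \<rightarrow>\<^sub>E UNIV. (\<Sum>l\<le>p. j l) = n}"

text \<open>Sums over \<open>multi_indices n p\<close> are not degenerate.\<close>

lemma finite_multi_indices: "finite (multi_indices n p)"
proof (rule finite_subset)
  show "multi_indices n p \<subseteq> {..p} \<rightarrow>\<^sub>E {..n}"
  proof
    fix j assume "j \<in> multi_indices n p"
    then have j: "j \<in> extensional {..p}" and n: "(\<Sum>l\<le>p. j l) = n"
      by (auto simp: multi_indices_def PiE_def)
    have "j l \<le> n" if "l \<in> {..p}" for l
      unfolding n[symmetric] using that by (intro member_le_sum) auto
    with j show "j \<in> {..p} \<rightarrow>\<^sub>E {..n}"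
      by (simp add: PiE_def Pi_def)
  qed
  show "finite ({..p} \<rightarrow>\<^sub>E {..n})"
    by (rule finite_PiE) auto
qed

definition W_mixed :: "nat \<Rightarrow> (real ^ 'n) set \<Rightarrow> (nat \<Rightarrow> nat) \<Rightarrow> real" where
  "W_mixed p K j = mixed_volume p
     (replicate (CARD('n) - j 0) (pscale p (-1) (diag_emb p ` K)) @
      concat (map (\<lambda>l. replicate (CARD('n) - j l) (factor_emb p l ` K)) [1..<Suc p]))"

definition Theta :: "nat \<Rightarrow> (nat \<Rightarrow> real) set" where
  "Theta p = {t \<in> {..p} \<rightarrow>\<^sub>E UNIV. (\<forall>l\<le>p. t l \<ge> 0) \<and> (\<Sum>l\<le>p. t l) = 1}"

definition relint_Theta :: "nat \<Rightarrow> (nat \<Rightarrow> real) set" where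
  "relint_Theta p = {t \<in> Theta p. \<forall>l\<le>p. t l > 0}"

text \<open>Higher-order unbalanced difference body.\<close>

definition diff_body :: "nat \<Rightarrow> (nat \<Rightarrow> real) \<Rightarrow> (real ^ 'n) set \<Rightarrow> (nat \<Rightarrow> real ^ 'n) set" where
  "diff_body p t K = pminkowski p {..p}
     (\<lambda>l. if l = 0 then pscale p (- t 0) (diag_emb p ` K) else pscale p (t l) (factor_emb p l ` K))"

definition t_min :: "nat \<Rightarrow> (nat \<Rightarrow> real) \<Rightarrow> real" where
  "t_min p t = Min (t ` {..p})"

definition multinom :: "nat \<Rightarrow> nat \<Rightarrow> (nat \<Rightarrow> nat) \<Rightarrow> real" where
  "multinom n p j = fact (n * p) / (\<Prod>l\<le>p. fact (n - j l))"

definition q_coef :: "nat \<Rightarrow> nat \<Rightarrow> (nat \<Rightarrow> nat) \<Rightarrow> (nat \<Rightarrow> real) \<Rightarrow> real" where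
  "q_coef n p j t = real n * t_min p t ^ n * multinom n p j *
     integral {0..1} (\<lambda>s. (1 - s) ^ (n - 1) * (\<Prod>l\<le>p. (t l - (1 - s) * t_min p t) ^ (n - j l)))"

end

theory Submission
  imports Defs "HOL-Computational_Algebra.Polynomial"
begin

text \<open>
  Let \<open>F\<^sub>K(t)\<close> be the volume of \<open>D\<^sub>p\<^sup>t K\<close>, for arbitrary \<open>t \<ge> 0\<close>. Its slices in the direction of one
  factor are Minkowski sums \<open>A + t\<^sub>l K\<close> with \<open>A\<close> independent of \<open>t\<^sub>l\<close>, and \<open>|A + t L|\<close> is polynomial
  in \<open>t\<close>: for polytopes, \<open>A + t L\<close> is up to a null set the range of the gradient of a log-sum-exp
  function, so that \<open>|A + t L| = \<integral> det (H\<^sub>A + t H\<^sub>L)\<close> with positive semidefinite Hessians. Hence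
  \<open>F\<^sub>K\<close> is a homogeneous polynomial of degree at most n in each variable. Its coefficients are the
  numbers \<open>W\<close> up to the multinomial factors, and the left-hand side of the claim is
  \<open>n t\<^sub>m\<^sub>i\<^sub>n\<^sup>n \<integral>\<^sub>0\<^sup>1 (1 - s)\<^sup>n\<^sup>-\<^sup>1 F\<^sub>K(t - (1 - s) t\<^sub>m\<^sub>i\<^sub>n) ds\<close>.
  The hypothesis compares this with the same integral for \<open>S\<close>, which is computed exactly: the
  intersection of \<open>t\<^sub>0 S\<close> with the bodies \<open>t\<^sub>i S - x\<^sub>i\<close> is a homothet of \<open>S\<close> whose ratio is at least
  \<open>v\<close> iff \<open>x\<close> lies in the difference body with parameters \<open>t - v\<close>. Integrating its volume over \<open>x\<close>,
  once by Fubini and once by layers, gives the value.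
\<close>

section \<open>Lagrange interpolation and an ordered copy of a finite type\<close>

text \<open>\<open>mixed_volume\<close> is an iterated one-sided derivative, so nothing is known
  about \<open>W_mixed\<close> before the volume is known to be polynomial. Geometry gives this in
  one parameter at a time; interpolation then gives joint polynomiality. Homogeneity of degree
  \<open>n * p\<close> leaves exponents \<open>n - j l\<close> with the \<open>j l\<close> summing
  to \<open>n\<close>: this is where \<open>multi_indices\<close> comes from. The parameter
  \<open>t 0\<close> acts on all coordinates at once and is reached by exchanging it with
  \<open>t 1\<close>.

  The weight is the derivative of a power: if 0 <= d <= m, then d^n is m^n times the integral of n
  (1 - s)^(n - 1) over those s in [0, 1] with (1 - s) m <= d. Here d is the homothety ratio. It is
  at most every \<open>t l\<close>, so the layers (1 - s) m need only run up to m =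
  \<open>t_min\<close>, and shifted parameters stay nonnegative. They no longer sum to 1, so the
  hypothesis is first extended to all nonnegative parameters by homogeneity.

  For equality, a continuous nonnegative integrand with integral 0 vanishes, and at s = 1/2 all
  shifted parameters are positive.\<close>

text \<open>The change of variables theorem of the library requires a wellordered index type.\<close>

typedef (overloaded) 'a ordered_copy = "UNIV :: 'a set" by simp

instance ordered_copy :: (finite) finite
proof
  have "UNIV = (Abs_ordered_copy ` UNIV :: 'a ordered_copy set)"
    by (simp add: type_definition.univ[OF type_definition_ordered_copy])
  then show "finite (UNIV :: 'a ordered_copy set)"
    by (metis finite finite_imageI)
qed

text \<open>Any injection into the naturals serves: its only purpose is to pull back a
  wellorder.\<close>

definition rank :: "'a::finite ordered_copy \<Rightarrow> nat" where
  "rank = (SOME f. inj f)"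

lemma inj_rank: "inj (rank :: 'a::finite ordered_copy \<Rightarrow> nat)"
proof -
  obtain f :: "'a ordered_copy \<Rightarrow> nat" where "inj f"
    using finite_imp_inj_to_nat_seg[OF finite] by metis
  then show ?thesis
    unfolding rank_def by (rule someI[where P = inj])
qed

instantiation ordered_copy :: (finite) wellorder
begin

definition less_eq_ordered_copy :: "'a ordered_copy \<Rightarrow> 'a ordered_copy \<Rightarrow> bool" where
  "x \<le> y \<longleftrightarrow> rank x \<le> rank y"

definition less_ordered_copy :: "'a ordered_copy \<Rightarrow> 'a ordered_copy \<Rightarrow> bool" where
  "x < y \<longleftrightarrow> rank x < rank y"

instance
proof
  fix x y z :: "'a ordered_copy" and P :: "'a ordered_copy \<Rightarrow> bool"
  show "x \<le> y \<Longrightarrow> y \<le> x \<Longrightarrow> x = y"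
    by (rule injD[OF inj_rank]) (simp add: less_eq_ordered_copy_def)
  show "P z" if step: "\<And>x. (\<And>y. y < x \<Longrightarrow> P y) \<Longrightarrow> P x"
    by (induction z rule: measure_induct_rule[of rank]) (rule step, simp add: less_ordered_copy_def)
  show "(x < y) = (x \<le> y \<and> \<not> y \<le> x)" "x \<le> x" "x \<le> y \<or> y \<le> x"
    by (auto simp: less_ordered_copy_def less_eq_ordered_copy_def)
  show "x \<le> y \<Longrightarrow> y \<le> z \<Longrightarrow> x \<le> z"
    by (simp add: less_eq_ordered_copy_def)
qed

end

text \<open>The nodes are 0, ..., n, all inside the half-line t >= 0 on which the volumes are
  considered.\<close>

definition lagrange :: "nat \<Rightarrow> nat \<Rightarrow> real poly" where
  "lagrange n a = (\<Prod>b\<in>{..n} - {a}. smult (1 / (real a - real b)) [:- real b, 1:])"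

text \<open>Being a polynomial of degree at most \<open>n\<close> on \<open>t \<ge> 0\<close>, expressed through values instead of
  coefficients so that the property passes to limits and integrals.\<close>

definition interpolates :: "nat \<Rightarrow> (real \<Rightarrow> real) \<Rightarrow> bool" where
  "interpolates n f \<longleftrightarrow> (\<forall>t\<ge>0. f t = (\<Sum>a\<le>n. f (real a) * poly (lagrange n a) t))"

lemma poly_lagrange: "a \<le> n \<Longrightarrow> c \<le> n \<Longrightarrow> poly (lagrange n a) (real c) = (if c = a then 1 else 0)"
proof (cases "c = a")
  case False
  assume "c \<le> n"
  have "poly (lagrange n a) (real c) = 0"
    unfolding lagrange_def poly_prod
    by (rule prod_zero) (use False \<open>c \<le> n\<close> in \<open>auto intro: bexI[of _ c]\<close>)
  with False show ?thesis by simp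
qed (auto simp: lagrange_def poly_prod diff_divide_distrib[symmetric] intro!: prod.neutral)

lemma degree_lagrange: "a \<le> n \<Longrightarrow> degree (lagrange n a) \<le> n"
proof -
  assume a: "a \<le> n"
  have "degree (lagrange n a) \<le> (\<Sum>b\<in>{..n} - {a}. degree (smult (1 / (real a - real b)) [:- real b, 1:]))"
    unfolding lagrange_def by (rule degree_prod_sum_le[unfolded o_def]) simp
  also have "\<dots> \<le> (\<Sum>b\<in>{..n} - {a}. 1)"
    by (intro sum_mono order.trans[OF degree_smult_le]) simp
  also have "\<dots> = n" using a by simp
  finally show ?thesis .
qed

text \<open>Both sides have degree at most n and agree at the n + 1 nodes.\<close>

lemma lagrange_interpolation:
  assumes "degree p \<le> n"
  shows "p = (\<Sum>a\<le>n. smult (poly p (real a)) (lagrange n a))"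
proof (rule poly_eqI_degree)
  show "poly p x = poly (\<Sum>a\<le>n. smult (poly p (real a)) (lagrange n a)) x"
    if "x \<in> real ` {..n}" for x
  proof -
    obtain c where c: "x = real c" "c \<le> n" using \<open>x \<in> real ` {..n}\<close> by auto
    have "poly (\<Sum>a\<le>n. smult (poly p (real a)) (lagrange n a)) x = (\<Sum>a\<le>n. if c = a then poly p (real a) else 0)"
      unfolding poly_sum c using c(2) by (intro sum.cong) (auto simp: poly_lagrange)
    also have "\<dots> = poly p x" using c by simp
    finally show ?thesis by simp
  qed
  have card: "card (real ` {..n}) = Suc n"
    by (simp add: card_image)
  show "card (real ` {..n}) > degree p"
    using assms card by simp
  have "degree (\<Sum>a\<le>n. smult (poly p (real a)) (lagrange n a)) \<le> n"
    by (intro degree_sum_le order.trans[OF degree_smult_le] degree_lagrange) auto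
  then show "card (real ` {..n}) > degree (\<Sum>a\<le>n. smult (poly p (real a)) (lagrange n a))"
    using card by simp
qed

lemma interpolates_poly:
  assumes "degree p \<le> n" "\<And>t. t \<ge> 0 \<Longrightarrow> f t = poly p t"
  shows "interpolates n f"
proof -
  have "poly p t = (\<Sum>a\<le>n. poly p (real a) * poly (lagrange n a) t)" for t
    by (rule trans[OF arg_cong[OF lagrange_interpolation[OF assms(1)], of "\<lambda>q. poly q t"]]) (simp add: poly_sum)
  note eq = this
  show ?thesis
    unfolding interpolates_def
  proof (intro allI impI)
    fix t :: real assume "t \<ge> 0"
    then show "f t = (\<Sum>a\<le>n. f (real a) * poly (lagrange n a) t)"
      using eq[of t] by (simp only: assms(2) of_nat_0_le_iff)
  qed
qed

text \<open>The defining identity involves finitely many values, all at nonnegative arguments, so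
  pointwise convergence there is enough.\<close>

lemma interpolates_limit:
  assumes "\<And>m. interpolates n (f m)" "\<And>t. t \<ge> 0 \<Longrightarrow> (\<lambda>m. f m t) \<longlonglongrightarrow> g t"
  shows "interpolates n g"
  unfolding interpolates_def
proof (intro allI impI)
  fix t :: real assume t: "t \<ge> 0"
  have "(\<lambda>m. \<Sum>a\<le>n. f m (real a) * poly (lagrange n a) t) \<longlonglongrightarrow> (\<Sum>a\<le>n. g (real a) * poly (lagrange n a) t)"
    by (intro tendsto_intros assms) simp
  also have "(\<lambda>m. \<Sum>a\<le>n. f m (real a) * poly (lagrange n a) t) = (\<lambda>m. f m t)"
    using assms(1)[unfolded interpolates_def, rule_format, OF t] by (intro ext) (rule sym)
  finally show "g t = (\<Sum>a\<le>n. g (real a) * poly (lagrange n a) t)"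
    by (rule LIMSEQ_unique[OF assms(2)[OF t]])
qed

section \<open>The volume of A + t L is a polynomial in t\<close>

text \<open>Partition function of a Gibbs distribution on V; its logarithm is a smooth substitute
  for the support function of V.\<close>

definition exp_sum :: "'a::real_inner set \<Rightarrow> 'a \<Rightarrow> real" where
  "exp_sum V x = (\<Sum>v\<in>V. exp (x \<bullet> v))"

definition gibbs_weight :: "'a::real_inner set \<Rightarrow> 'a \<Rightarrow> 'a \<Rightarrow> real" where
  "gibbs_weight V x v = exp (x \<bullet> v) / exp_sum V x"

text \<open>This is the gradient of \<open>ln (exp_sum V x)\<close>, see
  \<open>ln_exp_sum_has_derivative\<close>.\<close>

definition gibbs_mean :: "'a::real_inner set \<Rightarrow> 'a \<Rightarrow> 'a" where
  "gibbs_mean V x = (\<Sum>v\<in>V. gibbs_weight V x v *\<^sub>R v)"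

text \<open>The covariance matrix of the Gibbs distribution applied to h, which is the Hessian of
  \<open>ln (exp_sum V x)\<close>. Centring one factor of a covariance already centres the
  other.\<close>

definition gibbs_cov :: "'a::real_inner set \<Rightarrow> 'a \<Rightarrow> 'a \<Rightarrow> 'a" where
  "gibbs_cov V x h = (\<Sum>v\<in>V. (gibbs_weight V x v * (h \<bullet> (v - gibbs_mean V x))) *\<^sub>R v)"

lemma exp_sum_pos: "finite V \<Longrightarrow> V \<noteq> {} \<Longrightarrow> exp_sum V x > 0"
  unfolding exp_sum_def by (intro sum_pos) auto

lemma gibbs_weight_pos: "finite V \<Longrightarrow> v \<in> V \<Longrightarrow> gibbs_weight V x v > 0"
  unfolding gibbs_weight_def by (intro divide_pos_pos exp_sum_pos) auto

lemma sum_gibbs_weight: "finite V \<Longrightarrow> V \<noteq> {} \<Longrightarrow> (\<Sum>v\<in>V. gibbs_weight V x v) = 1"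
  using exp_sum_pos[of V x] unfolding gibbs_weight_def
  by (simp add: sum_divide_distrib[symmetric] exp_sum_def)

lemma exp_sum_has_derivative:
  assumes "finite V" "V \<noteq> {}"
  shows "(exp_sum V has_derivative (\<lambda>h. exp_sum V x * (h \<bullet> gibbs_mean V x))) (at x)"
proof -
  have "((\<lambda>x. \<Sum>v\<in>V. exp (x \<bullet> v)) has_derivative (\<lambda>h. \<Sum>v\<in>V. exp (x \<bullet> v) * (h \<bullet> v))) (at x)"
    by (auto intro!: derivative_eq_intros simp: mult.commute)
  moreover have "(\<Sum>v\<in>V. exp (x \<bullet> v) * (h \<bullet> v)) = exp_sum V x * (h \<bullet> gibbs_mean V x)" for h
    using exp_sum_pos[OF assms, of x]
    by (simp add: gibbs_mean_def inner_sum_right sum_distrib_left gibbs_weight_def)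
  ultimately show ?thesis
    by (simp add: exp_sum_def[abs_def])
qed

lemma gibbs_weight_has_derivative:
  assumes "finite V" "V \<noteq> {}"
  shows "((\<lambda>x. gibbs_weight V x v) has_derivative
    (\<lambda>h. gibbs_weight V x v * (h \<bullet> (v - gibbs_mean V x)))) (at x)"
proof -
  have pos: "exp_sum V x > 0" using exp_sum_pos[OF assms] .
  have "((\<lambda>x. exp (x \<bullet> v)) has_derivative (\<lambda>h. exp (x \<bullet> v) * (h \<bullet> v))) (at x)"
    by (auto intro!: derivative_eq_intros)
  from has_derivative_divide'[OF this exp_sum_has_derivative[OF assms]]
  have "((\<lambda>x. gibbs_weight V x v) has_derivative
    (\<lambda>h. (exp (x \<bullet> v) * (h \<bullet> v) * exp_sum V x - exp (x \<bullet> v) * (exp_sum V x * (h \<bullet> gibbs_mean V x))) /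
      (exp_sum V x * exp_sum V x))) (at x)"
    using pos by (simp add: gibbs_weight_def)
  moreover have "(exp (x \<bullet> v) * (h \<bullet> v) * exp_sum V x - exp (x \<bullet> v) * (exp_sum V x * (h \<bullet> gibbs_mean V x))) /
      (exp_sum V x * exp_sum V x) = gibbs_weight V x v * (h \<bullet> (v - gibbs_mean V x))" for h
    using pos by (simp add: gibbs_weight_def inner_diff_right field_simps)
  ultimately show ?thesis by simp
qed

lemma gibbs_mean_has_derivative:
  assumes "finite V" "V \<noteq> {}"
  shows "(gibbs_mean V has_derivative gibbs_cov V x) (at x)"
  unfolding gibbs_mean_def[abs_def] gibbs_cov_def[abs_def]
  by (intro has_derivative_sum has_derivative_scaleR_left
      gibbs_weight_has_derivative[OF assms, unfolded gibbs_mean_def])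

lemma ln_exp_sum_has_derivative:
  assumes "finite V" "V \<noteq> {}"
  shows "((\<lambda>x. ln (exp_sum V x)) has_derivative (\<lambda>h. h \<bullet> gibbs_mean V x)) (at x)"
proof -
  have pos: "exp_sum V x > 0" using exp_sum_pos[OF assms] .
  show ?thesis
    by (rule has_derivative_eq_rhs[OF DERIV_compose_FDERIV[OF DERIV_ln[OF pos] exp_sum_has_derivative[OF assms]]])
      (use pos in \<open>auto simp: fun_eq_iff\<close>)
qed

text \<open>The quadratic form of the Hessian is the variance of \<open>h \<bullet> v\<close>: the
  centred values average to 0, so the second factor may be centred as well.\<close>

lemma inner_gibbs_cov:
  assumes "finite V" "V \<noteq> {}"
  shows "gibbs_cov V x h \<bullet> h = (\<Sum>v\<in>V. gibbs_weight V x v * (h \<bullet> (v - gibbs_mean V x))\<^sup>2)"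
proof -
  let ?m = "gibbs_mean V x" and ?w = "gibbs_weight V x"
  have "(\<Sum>v\<in>V. ?w v * (h \<bullet> (v - ?m))) = h \<bullet> (\<Sum>v\<in>V. ?w v *\<^sub>R v) - (\<Sum>v\<in>V. ?w v) * (h \<bullet> ?m)"
    by (simp add: inner_sum_right inner_diff_right right_diff_distrib sum_subtractf sum_distrib_right)
  then have zero: "(\<Sum>v\<in>V. ?w v * (h \<bullet> (v - ?m))) = 0"
    by (simp add: sum_gibbs_weight[OF assms] gibbs_mean_def[symmetric])
  have "gibbs_cov V x h \<bullet> h = (\<Sum>v\<in>V. ?w v * (h \<bullet> (v - ?m)) * (h \<bullet> v))"
    unfolding gibbs_cov_def inner_sum_left inner_scaleR_left by (simp add: inner_commute)
  also have "\<dots> = (\<Sum>v\<in>V. ?w v * (h \<bullet> (v - ?m))\<^sup>2 + ?w v * (h \<bullet> (v - ?m)) * (h \<bullet> ?m))"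
    by (intro sum.cong) (auto simp: inner_diff_right power2_eq_square algebra_simps)
  also have "\<dots> = (\<Sum>v\<in>V. ?w v * (h \<bullet> (v - ?m))\<^sup>2)"
    unfolding sum.distrib sum_distrib_right[symmetric] zero by simp
  finally show ?thesis .
qed

lemma inner_gibbs_cov_nonneg:
  assumes "finite V" "V \<noteq> {}"
  shows "gibbs_cov V x h \<bullet> h \<ge> 0"
  unfolding inner_gibbs_cov[OF assms]
  by (intro sum_nonneg mult_nonneg_nonneg less_imp_le[OF gibbs_weight_pos] assms) auto

text \<open>All weights are positive, and two different values of \<open>h \<bullet> v\<close>
  cannot both equal the mean, so the variance has a positive term.\<close>

lemma inner_gibbs_cov_pos:
  assumes "finite V" "v \<in> V" "w \<in> V" "h \<bullet> v \<noteq> h \<bullet> w"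
  shows "gibbs_cov V x h \<bullet> h > 0"
proof -
  have V: "V \<noteq> {}" using assms by auto
  obtain u where u: "u \<in> V" "h \<bullet> (u - gibbs_mean V x) \<noteq> 0"
    using assms by (metis eq_iff_diff_eq_0 inner_diff_right)
  show ?thesis
    unfolding inner_gibbs_cov[OF assms(1) V]
    by (rule sum_pos2[OF assms(1) u(1)])
      (auto simp: u gibbs_weight_pos assms intro!: mult_nonneg_nonneg less_imp_le[OF gibbs_weight_pos])
qed

lemma gibbs_mean_in_hull:
  assumes "finite V" "V \<noteq> {}"
  shows "gibbs_mean V x \<in> convex hull V"
  unfolding gibbs_mean_def
  by (rule convex_sum[OF assms(1) convex_convex_hull sum_gibbs_weight[OF assms]])
    (use gibbs_weight_pos[OF assms(1)] in \<open>auto intro: less_imp_le hull_inc\<close>)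

text \<open>For v in V, \<open>exp (x \<bullet> v)\<close> is one of the summands; the bound is a
  half-space condition on v and so extends to the hull.\<close>

lemma ln_exp_sum_ge:
  assumes "finite V" "v \<in> convex hull V"
  shows "x \<bullet> v \<le> ln (exp_sum V x)"
proof -
  have V: "V \<noteq> {}" using assms by auto
  have "V \<subseteq> {v. x \<bullet> v \<le> ln (exp_sum V x)}"
  proof
    fix v assume v: "v \<in> V"
    have "exp (x \<bullet> v) \<le> exp_sum V x"
      unfolding exp_sum_def by (rule member_le_sum[OF v]) (auto simp: assms)
    then show "v \<in> {v. x \<bullet> v \<le> ln (exp_sum V x)}"
      using exp_sum_pos[OF assms(1) V, of x] by (simp add: ln_ge_iff)
  qed
  then have "convex hull V \<subseteq> {v. x \<bullet> v \<le> ln (exp_sum V x)}"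
    by (rule hull_minimal) (rule convex_halfspace_le)
  with assms show ?thesis by auto
qed

section \<open>Gradient maps onto sums of polytopes\<close>

definition msum :: "'a::real_vector set \<Rightarrow> real \<Rightarrow> 'a set \<Rightarrow> 'a set" where
  "msum A t L = {x + t *\<^sub>R y | x y. x \<in> A \<and> y \<in> L}"

lemma msum_eq_image: "msum A t L = (\<lambda>(x, y). x + t *\<^sub>R y) ` (A \<times> L)"
  unfolding msum_def by auto

lemma compact_msum: "compact A \<Longrightarrow> compact L \<Longrightarrow> compact (msum A t L :: 'a::real_normed_vector set)"
  unfolding msum_eq_image
  by (intro compact_continuous_image compact_Times) (auto intro!: continuous_intros simp: split_beta)

lemma convex_msum: "convex A \<Longrightarrow> convex L \<Longrightarrow> convex (msum A t L)"
proof -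
  assume "convex A" "convex L"
  then have "convex (\<Union>x\<in>A. \<Union>y\<in>(*\<^sub>R) t ` L. {x + y})"
    by (intro convex_sums convex_scaling)
  also have "(\<Union>x\<in>A. \<Union>y\<in>(*\<^sub>R) t ` L. {x + y}) = msum A t L"
    unfolding msum_def by auto
  finally show ?thesis .
qed

lemma linear_image_msum: "linear f \<Longrightarrow> f ` msum A t L = msum (f ` A) t (f ` L)"
  unfolding msum_eq_image image_image
  by (force simp: linear_add linear_scale image_iff split_beta)

text \<open>Gradient of \<open>ln (exp_sum A x) + t * ln (exp_sum L x)\<close>;
  \<open>cov_sum\<close> is the Hessian, which is affine in t.\<close>

definition mean_sum :: "'a::real_inner set \<Rightarrow> 'a set \<Rightarrow> real \<Rightarrow> 'a \<Rightarrow> 'a" where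
  "mean_sum A L t x = gibbs_mean A x + t *\<^sub>R gibbs_mean L x"

definition cov_sum :: "'a::real_inner set \<Rightarrow> 'a set \<Rightarrow> real \<Rightarrow> 'a \<Rightarrow> 'a \<Rightarrow> 'a" where
  "cov_sum A L t x h = gibbs_cov A x h + t *\<^sub>R gibbs_cov L x h"

text \<open>The assumption \<open>spread\<close> says that A lies in no hyperplane. It makes the
  Hessian belonging to A positive definite, so that the sum is definite even at t = 0 or for a
  degenerate L.\<close>

context
  fixes A L :: "'a::euclidean_space set"
  assumes A: "finite A" and L: "finite L" "L \<noteq> {}"
    and spread: "\<And>h. h \<noteq> 0 \<Longrightarrow> \<exists>v\<in>A. \<exists>w\<in>A. h \<bullet> v \<noteq> h \<bullet> w"
begin

lemma A_nonempty: "A \<noteq> {}"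
  using spread[of "SOME b. b \<in> Basis"] SOME_Basis nonzero_Basis by blast

lemma mean_sum_has_derivative: "(mean_sum A L t has_derivative cov_sum A L t x) (at x within S)"
  unfolding mean_sum_def[abs_def] cov_sum_def[abs_def]
  by (intro has_derivative_add has_derivative_scaleR_right
      has_derivative_at_withinI[OF gibbs_mean_has_derivative] A A_nonempty L)

lemma inner_cov_sum_pos:
  assumes "t \<ge> 0" "h \<noteq> 0"
  shows "cov_sum A L t x h \<bullet> h > 0"
proof -
  obtain v w where "v \<in> A" "w \<in> A" "h \<bullet> v \<noteq> h \<bullet> w" using spread[OF assms(2)] by blast
  from inner_gibbs_cov_pos[OF A this]
  show ?thesis
    unfolding cov_sum_def inner_add_left inner_scaleR_left
    by (intro add_pos_nonneg mult_nonneg_nonneg inner_gibbs_cov_nonneg L assms)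
qed

text \<open>The gradient of a strictly convex function is injective: its inner product with h = x -
  y increases strictly along the segment from y to x.\<close>

lemma inj_mean_sum:
  assumes "t \<ge> 0"
  shows "inj (mean_sum A L t)"
proof (rule injI, rule ccontr)
  fix x y assume eq: "mean_sum A L t x = mean_sum A L t y" and "x \<noteq> y"
  define h where "h = x - y"
  let ?f = "\<lambda>s. mean_sum A L t (y + s *\<^sub>R h) \<bullet> h"
  have D: "(?f has_real_derivative cov_sum A L t (y + s *\<^sub>R h) h \<bullet> h) (at s)" for s
  proof -
    have "((\<lambda>s. y + s *\<^sub>R h) has_derivative (\<lambda>u. u *\<^sub>R h)) (at s)"
      by (auto intro!: derivative_eq_intros)
    from has_derivative_compose[OF this mean_sum_has_derivative]
    have "((\<lambda>s. mean_sum A L t (y + s *\<^sub>R h)) has_derivative (\<lambda>u. cov_sum A L t (y + s *\<^sub>R h) (u *\<^sub>R h))) (at s)" .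
    then have "(?f has_derivative (\<lambda>u. cov_sum A L t (y + s *\<^sub>R h) (u *\<^sub>R h) \<bullet> h)) (at s)"
      by (rule has_derivative_inner_left)
    moreover have "cov_sum A L t (y + s *\<^sub>R h) (u *\<^sub>R h) \<bullet> h = (cov_sum A L t (y + s *\<^sub>R h) h \<bullet> h) * u" for u
      using linear_scale[OF has_derivative_linear[OF mean_sum_has_derivative[of t "y + s *\<^sub>R h" UNIV]]]
      by simp
    ultimately show ?thesis by (simp add: has_field_derivative_def)
  qed
  have "h \<noteq> 0" using \<open>x \<noteq> y\<close> by (simp add: h_def)
  have "?f 0 < ?f 1"
  proof (rule DERIV_pos_imp_increasing[of 0 1 ?f])
    fix s :: real
    show "\<exists>d. (?f has_real_derivative d) (at s) \<and> d > 0"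
      using D[of s] inner_cov_sum_pos[OF assms \<open>h \<noteq> 0\<close>] by blast
  qed simp
  with eq show False by (simp add: h_def)
qed

lemma range_mean_sum_subset: "range (mean_sum A L t) \<subseteq> msum (convex hull A) t (convex hull L)"
  unfolding msum_def mean_sum_def
  using gibbs_mean_in_hull[OF A A_nonempty] gibbs_mean_in_hull[OF L] by blast

text \<open>A point \<open>z\<close> of the interior is the gradient at the minimum of a convex function, which is
  coercive because the logarithm of \<open>exp_sum V\<close> dominates the support function of \<open>V\<close>.\<close>

lemma interior_subset_range_mean_sum:
  assumes "t \<ge> 0"
  shows "interior (msum (convex hull A) t (convex hull L)) \<subseteq> range (mean_sum A L t)"
proof
  let ?C = "msum (convex hull A) t (convex hull L)"
  fix z assume "z \<in> interior ?C"
  then obtain r where r: "r > 0" "cball z r \<subseteq> ?C"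
    by (metis mem_interior_cball)
  define f where "f x = ln (exp_sum A x) + t * ln (exp_sum L x) - x \<bullet> z" for x
  have D: "(f has_derivative (\<lambda>h. h \<bullet> (mean_sum A L t x - z))) (at x)" for x
    unfolding f_def mean_sum_def
    by (rule has_derivative_eq_rhs, (rule has_derivative_diff has_derivative_add has_derivative_mult_right
      ln_exp_sum_has_derivative A A_nonempty L has_derivative_inner_left has_derivative_ident)+)
      (auto simp: inner_add_right inner_diff_right)
  have cont: "continuous_on S f" for S
    using D by (meson has_derivative_continuous continuous_at_imp_continuous_on)
  have lower: "x \<bullet> c - x \<bullet> z \<le> f x" if c_in: "c \<in> ?C" for x c
  proof -
    obtain a l where c: "c = a + t *\<^sub>R l" "a \<in> convex hull A" "l \<in> convex hull L"
      using c_in unfolding msum_def by auto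
    show ?thesis
      using ln_exp_sum_ge[OF A c(2), of x] mult_left_mono[OF ln_exp_sum_ge[OF L(1) c(3), of x] assms]
      unfolding f_def c inner_add_right inner_scaleR_right by linarith
  qed
  have coercive: "r * norm x \<le> f x" for x
  proof (cases "x = 0")
    case True
    have "z \<in> ?C" using r by auto
    from lower[OF this, of 0] True show ?thesis by simp
  next
    case False
    \<comment> \<open>The boundary point of the ball in direction x is the choice for which the
      bound \<open>lower\<close> becomes r times the norm of x.\<close>
    have "z + (r / norm x) *\<^sub>R x \<in> cball z r"
      using r False by (simp add: dist_norm)
    with r have "z + (r / norm x) *\<^sub>R x \<in> ?C" by auto
    from lower[OF this, of x] show ?thesis
      using False by (simp add: inner_add_right power2_norm_eq_inner[symmetric] power2_eq_square)
  qed
  \<comment> \<open>Outside the ball of this radius f exceeds f 0, so a minimum over the ball is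
    global.\<close>
  define R where "R = (f 0 + 1) / r"
  have "f 0 \<ge> 0" using coercive[of 0] by simp
  then have R: "R \<ge> 0" using r by (simp add: R_def)
  obtain x0 where x0: "x0 \<in> cball 0 R" "\<And>y. y \<in> cball 0 R \<Longrightarrow> f x0 \<le> f y"
    using continuous_attains_inf[OF compact_cball _ cont, of 0 R] R by auto
  have "f x0 \<le> f y" for y
  proof (cases "y \<in> cball 0 R")
    case False
    then have "R * r \<le> r * norm y" using r by (simp add: mult.commute)
    moreover have "R * r = f 0 + 1" using r by (simp add: R_def)
    ultimately have "f 0 \<le> f y" using coercive[of y] by linarith
    with x0(2)[of 0] R show ?thesis by simp
  qed (use x0 in auto)
  then have "(\<lambda>h. h \<bullet> (mean_sum A L t x0 - z)) = (\<lambda>h. 0)"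
    by (intro has_derivative_local_min[OF D]) auto
  then have "(mean_sum A L t x0 - z) \<bullet> (mean_sum A L t x0 - z) = 0" by metis
  then have "z = mean_sum A L t x0" by simp
  then show "z \<in> range (mean_sum A L t)" by auto
qed

text \<open>The range lies between the interior of a compact convex set and the set itself, and the
  frontier of a convex set is null.\<close>

lemma range_mean_sum_lmeasurable:
  assumes "t \<ge> 0"
  shows "range (mean_sum A L t) \<in> lmeasurable"
    and "measure lebesgue (range (mean_sum A L t)) = measure lebesgue (msum (convex hull A) t (convex hull L))"
proof -
  let ?C = "msum (convex hull A) t (convex hull L)"
  have C: "compact ?C" "convex ?C"
    using A L by (auto intro!: compact_msum convex_msum finite_imp_compact_convex_hull)
  have "?C - range (mean_sum A L t) \<union> (range (mean_sum A L t) - ?C) \<subseteq> frontier ?C"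
    using range_mean_sum_subset[of t] interior_subset_range_mean_sum[OF assms] closure_subset[of ?C]
    unfolding frontier_def by blast
  then have neg: "negligible (?C - range (mean_sum A L t) \<union> (range (mean_sum A L t) - ?C))"
    by (rule negligible_subset[OF negligible_convex_frontier[OF C(2)]])
  show "range (mean_sum A L t) \<in> lmeasurable"
    by (rule lmeasurable_negligible_symdiff[OF lmeasurable_compact[OF C(1)] neg])
  show "measure lebesgue (range (mean_sum A L t)) = measure lebesgue ?C"
    by (rule measure_negligible_symdiff[OF lmeasurable_compact[OF C(1)] neg])
qed

end

text \<open>Leibniz formula with linear polynomials as entries; every product has one factor per
  row, hence the degree bound.\<close>

definition det_poly :: "real ^ 'm ^ 'm \<Rightarrow> real ^ 'm ^ 'm \<Rightarrow> real poly" where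
  "det_poly M N = (\<Sum>\<pi> | \<pi> permutes (UNIV :: 'm set).
     smult (of_int (sign \<pi>)) (\<Prod>i\<in>UNIV. [:M $ i $ \<pi> i, N $ i $ \<pi> i:]))"

lemma poly_det_poly: "poly (det_poly M N) t = det (M + t *\<^sub>R N)"
  by (simp add: det_poly_def det_def poly_sum poly_prod)

lemma degree_det_poly: "degree (det_poly M (N :: real ^ 'm ^ 'm)) \<le> CARD('m)"
  unfolding det_poly_def
proof (rule degree_sum_le)
  fix \<pi>
  have "degree (\<Prod>i\<in>UNIV. [:M $ i $ \<pi> i, N $ i $ \<pi> i:]) \<le> (\<Sum>i\<in>(UNIV :: 'm set). 1)"
    by (rule order.trans[OF degree_prod_sum_le sum_mono]) auto
  then show "degree (smult (of_int (sign \<pi>)) (\<Prod>i\<in>UNIV. [:M $ i $ \<pi> i, N $ i $ \<pi> i:])) \<le> CARD('m)"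
    by (intro order.trans[OF degree_smult_le]) simp
qed (simp add: finite_permutations)

text \<open>The change of variables produces the modulus of a determinant. Without zeros on the
  half-line the polynomial keeps its sign there, so its modulus is again a polynomial.\<close>

lemma interpolates_abs_poly:
  assumes deg: "degree p \<le> n" and nz: "\<And>t. t \<ge> 0 \<Longrightarrow> poly p t \<noteq> 0"
  shows "interpolates n (\<lambda>t. \<bar>poly p t\<bar>)"
proof (rule interpolates_poly)
  show "degree (smult (sgn (poly p 0)) p) \<le> n"
    using degree_smult_le deg by (rule order.trans)
  fix t :: real assume t: "t \<ge> 0"
  have "\<not> poly p 0 * poly p t < 0"
  proof
    assume neg: "poly p 0 * poly p t < 0"
    with t have "0 < t" by (cases "t = 0") (auto simp: mult_less_0_iff)
    from poly_IVT[OF this neg] nz show False by force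
  qed
  with nz[of 0] nz[OF t] have "sgn (poly p 0) = sgn (poly p t)"
    by (auto simp: sgn_if mult_less_0_iff)
  then show "\<bar>poly p t\<bar> = poly (smult (sgn (poly p 0)) p) t"
    by (simp add: abs_sgn mult.commute)
qed

text \<open>For each t the volume is the integral of the Jacobian of \<open>mean_sum\<close>, and
  the Jacobian is interpolated pointwise in x. The interpolation formula contains only Jacobians at
  the nodes, whose integrals are already known, so it can be integrated term by term.\<close>

lemma interpolates_measure_polytopes:
  fixes A L :: "(real ^ 'm::{finite,wellorder}) set"
  assumes A: "finite A" and L: "finite L" "L \<noteq> {}"
    and spread: "\<And>h. h \<noteq> 0 \<Longrightarrow> \<exists>v\<in>A. \<exists>w\<in>A. h \<bullet> v \<noteq> h \<bullet> w"
  shows "interpolates CARD('m) (\<lambda>t. measure lebesgue (msum (convex hull A) t (convex hull L)))"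
proof -
  define M where "M = (\<lambda>x. matrix (gibbs_cov A x))"
  define N where "N = (\<lambda>x. matrix (gibbs_cov L x))"
  define J where "J = (\<lambda>t x. \<bar>det (matrix (cov_sum A L t x))\<bar>)"
  let ?m = "\<lambda>t. measure lebesgue (msum (convex hull A) t (convex hull L))"
  have mat: "matrix (cov_sum A L t x) = M x + t *\<^sub>R N x" for t x
    by (simp add: M_def N_def matrix_def cov_sum_def vec_eq_iff)
  have J_poly: "J t x = \<bar>poly (det_poly (M x) (N x)) t\<bar>" for t x
    by (simp add: J_def mat poly_det_poly)
  have int: "(J t has_integral ?m t) UNIV" if t: "t \<ge> 0" for t
    unfolding J_def
    using has_measure_differentiable_image[of UNIV "mean_sum A L t" "cov_sum A L t" "?m t"]
      mean_sum_has_derivative[OF assms] inj_mean_sum[OF assms t] range_mean_sum_lmeasurable[OF assms t]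
    by auto
  have "det (matrix (cov_sum A L t x)) \<noteq> 0" if t: "t \<ge> 0" for t x
  proof -
    have lin: "linear (cov_sum A L t x)"
      by (rule has_derivative_linear[OF mean_sum_has_derivative[OF assms]])
    have "inj (cov_sum A L t x)"
      unfolding linear_injective_0[OF lin]
      using inner_cov_sum_pos[OF assms t] by (metis inner_zero_left less_irrefl)
    then show ?thesis using det_nz_iff_inj[OF lin] by blast
  qed
  then have interp: "interpolates CARD('m) (\<lambda>t. J t x)" for x
    unfolding J_poly by (intro interpolates_abs_poly degree_det_poly) (simp add: poly_det_poly mat)
  show ?thesis
    unfolding interpolates_def
  proof (intro allI impI)
    fix t :: real assume t: "t \<ge> 0"
    let ?l = "\<lambda>a. poly (lagrange CARD('m) a) t"
    have lin: "((\<lambda>x. \<Sum>a\<le>CARD('m). J (real a) x * ?l a) has_integral (\<Sum>a\<le>CARD('m). ?m (real a) * ?l a)) UNIV"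
      by (intro has_integral_sum has_integral_mult_left int) auto
    have eq: "J t x = (\<Sum>a\<le>CARD('m). J (real a) x * ?l a)" for x
      by (rule interp[unfolded interpolates_def, rule_format, OF t])
    have "(J t has_integral (\<Sum>a\<le>CARD('m). ?m (real a) * ?l a)) UNIV"
      by (rule has_integral_eq[OF sym[OF eq] lin])
    then show "?m t = (\<Sum>a\<le>CARD('m). ?m (real a) * ?l a)"
      by (rule has_integral_unique[OF int[OF t]])
  qed
qed

section \<open>Outer approximation of compact convex sets by polytopes\<close>

lemma polytope_between:
  fixes C U :: "'a::euclidean_space set"
  assumes C: "compact C" and U: "open U" "C \<subseteq> U"
  obtains V where "finite V" "V \<subseteq> U" "C \<subseteq> convex hull V"
proof -
  \<comment> \<open>Boxes inside U are polytopes, and finitely many of their interiors cover C. The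
    hull of the collected vertices stays in U when U is convex, which is the case in the
    application.\<close>
  have "\<exists>V. finite V \<and> V \<subseteq> U \<and> x \<in> interior (convex hull V)" if x: "x \<in> C" for x
  proof -
    obtain a b where ab: "cbox a b \<subseteq> U" "x \<in> box a b"
      using open_contains_cbox[OF U(1) subsetD[OF U(2) x]] by metis
    obtain V where V: "finite V" "cbox a b = convex hull V"
      using polytope_interval[of a b] unfolding polytope_def by blast
    have "x \<in> interior (convex hull V)"
      using ab(2) V(2) by (metis interior_cbox)
    moreover have "V \<subseteq> U" using hull_subset[of V convex] ab(1) V(2) by blast
    ultimately show ?thesis using V(1) by blast
  qed
  then obtain V where V: "\<And>x. x \<in> C \<Longrightarrow> finite (V x)" "\<And>x. x \<in> C \<Longrightarrow> V x \<subseteq> U"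
      "\<And>x. x \<in> C \<Longrightarrow> x \<in> interior (convex hull V x)"
    by metis
  have cover: "C \<subseteq> (\<Union>x\<in>C. interior (convex hull V x))"
    using V(3) by blast
  obtain D where D: "D \<subseteq> C" "finite D" "C \<subseteq> (\<Union>x\<in>D. interior (convex hull V x))"
    using compactE_image[OF C open_interior cover] by metis
  have "C \<subseteq> (\<Union>x\<in>D. convex hull V x)" using D(3) interior_subset by blast
  also have "\<dots> \<subseteq> convex hull (\<Union>x\<in>D. V x)" by (intro UN_least hull_mono) auto
  finally have "C \<subseteq> convex hull (\<Union>x\<in>D. V x)" .
  moreover have "finite (\<Union>x\<in>D. V x)" using D V(1) by auto
  moreover have "(\<Union>x\<in>D. V x) \<subseteq> U" using D(1) V(2) by blast
  ultimately show ?thesis using that by blast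
qed

text \<open>The closed r-neighbourhood of A, written as a sum with the unit ball so that compactness
  comes from \<open>compact_msum\<close>.\<close>

definition nbhd :: "'a::real_normed_vector set \<Rightarrow> real \<Rightarrow> 'a set" where
  "nbhd A r = msum A r (cball 0 1)"

lemma mem_nbhd: "r \<ge> 0 \<Longrightarrow> x \<in> nbhd A r \<longleftrightarrow> (\<exists>a\<in>A. dist a x \<le> r)"
proof
  assume r: "r \<ge> 0" and "x \<in> nbhd A r"
  then obtain a y where "a \<in> A" "norm y \<le> 1" "x = a + r *\<^sub>R y"
    by (auto simp: nbhd_def msum_def)
  then show "\<exists>a\<in>A. dist a x \<le> r"
    using r by (intro bexI[of _ a]) (auto simp: dist_norm mult_left_le)
next
  assume r: "r \<ge> 0" and "\<exists>a\<in>A. dist a x \<le> r"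
  then obtain a where a: "a \<in> A" "dist a x \<le> r" by blast
  show "x \<in> nbhd A r"
  proof (cases "r = 0")
    case True
    with a show ?thesis by (force simp: nbhd_def msum_def intro!: exI[of _ 0])
  next
    case False
    have "norm ((x - a) /\<^sub>R r) = dist a x / r"
      using r by (simp add: dist_norm norm_minus_commute divide_inverse)
    then have "norm ((x - a) /\<^sub>R r) \<le> 1"
      using a r False by simp
    moreover have "x = a + r *\<^sub>R ((x - a) /\<^sub>R r)" using False by simp
    ultimately show ?thesis
      using a(1) unfolding nbhd_def msum_def by (metis (mono_tags, lifting) dist_0_norm mem_Collect_eq mem_cball)
  qed
qed

lemma subset_nbhd: "r \<ge> 0 \<Longrightarrow> A \<subseteq> nbhd A r"
  by (metis mem_nbhd dist_self subsetI)

lemma compact_nbhd: "compact A \<Longrightarrow> compact (nbhd (A :: 'a::euclidean_space set) r)"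
  unfolding nbhd_def by (intro compact_msum compact_cball)

text \<open>Continuity of the measure from above: a compact set is the intersection of its closed
  neighbourhoods.\<close>

lemma measure_nbhd_tendsto:
  fixes C :: "'a::euclidean_space set"
  assumes C: "compact C" and \<rho>: "decseq \<rho>" "\<rho> \<longlonglongrightarrow> 0" "\<And>k. \<rho> k \<ge> 0"
  shows "(\<lambda>k. measure lebesgue (nbhd C (\<rho> k))) \<longlonglongrightarrow> measure lebesgue C"
proof -
  have "(\<Inter>k. nbhd C (\<rho> k)) = C"
  proof
    show "C \<subseteq> (\<Inter>k. nbhd C (\<rho> k))"
      using subset_nbhd[OF \<rho>(3)] by blast
    show "(\<Inter>k. nbhd C (\<rho> k)) \<subseteq> C"
    proof
      fix x assume "x \<in> (\<Inter>k. nbhd C (\<rho> k))"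
      then have "\<forall>k. \<exists>a\<in>C. dist a x \<le> \<rho> k" using \<rho>(3) by (auto simp: mem_nbhd)
      then obtain a where a: "\<And>k. a k \<in> C" "\<And>k. dist (a k) x \<le> \<rho> k" by metis
      have "(\<lambda>k. dist (a k) x) \<longlonglongrightarrow> 0"
        by (rule tendsto_sandwich[OF _ _ tendsto_const \<rho>(2)]) (auto simp: a)
      then have "a \<longlonglongrightarrow> x" by (rule tendsto_dist_iff[THEN iffD2])
      with a(1) show "x \<in> C" using compact_imp_closed[OF C] closed_sequentially by blast
    qed
  qed
  moreover have dec: "decseq (\<lambda>k. nbhd C (\<rho> k))"
    using \<rho>(1,3) unfolding decseq_def by (force simp: mem_nbhd)
  moreover have "(\<lambda>k. measure lebesgue (nbhd C (\<rho> k))) \<longlonglongrightarrow> measure lebesgue (\<Inter>k. nbhd C (\<rho> k))"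
  proof (rule Lim_measure_decseq[OF _ dec])
    have mb: "nbhd C (\<rho> k) \<in> lmeasurable" for k
      by (intro lmeasurable_compact compact_nbhd C)
    show "range (\<lambda>k. nbhd C (\<rho> k)) \<subseteq> sets lebesgue"
      using fmeasurableD[OF mb] by blast
    show "emeasure lebesgue (nbhd C (\<rho> k)) \<noteq> \<infinity>" for k
      unfolding infinity_ennreal_def by (rule fmeasurableD2[OF mb])
  qed
  ultimately show ?thesis by simp
qed

text \<open>For polytopes slightly larger than A and L the volume lies between that of A + t L and
  that of a shrinking neighbourhood of A + t L, so \<open>interpolates_limit\<close>
  applies.\<close>

lemma interpolates_measure_msum_wellorder:
  fixes A L :: "(real ^ 'm::{finite,wellorder}) set"
  assumes A: "compact A" "convex A" "A \<noteq> {}" and L: "compact L" "convex L" "L \<noteq> {}"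
  shows "interpolates CARD('m) (\<lambda>t. measure lebesgue (msum A t L))"
proof -
  define r where "r k = 1 / real (Suc k)" for k
  have r: "r k > 0" "r k \<ge> 0" for k by (simp_all add: r_def)
  let ?U = "\<lambda>B r. \<Union>x\<in>B. \<Union>y\<in>ball 0 r. {x + y}"
  \<comment> \<open>A whole neighbourhood of A is enclosed, not just A: this yields
    \<open>spread\<close> for P k even when A lies in a hyperplane.\<close>
  have "\<exists>V. finite V \<and> V \<subseteq> ?U A (2 * r k) \<and> nbhd A (r k) \<subseteq> convex hull V" for k
  proof -
    have sub: "nbhd A (r k) \<subseteq> ?U A (2 * r k)"
    proof
      fix x assume "x \<in> nbhd A (r k)"
      then obtain a where a: "a \<in> A" "dist a x \<le> r k" using r(2) by (auto simp: mem_nbhd)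
      have "x - a \<in> ball 0 (2 * r k)"
        using a(2) r(1)[of k] by (simp add: dist_norm norm_minus_commute)
      moreover have "x = a + (x - a)" by simp
      ultimately show "x \<in> ?U A (2 * r k)" using a(1) by blast
    qed
    obtain V where "finite V" "V \<subseteq> ?U A (2 * r k)" "nbhd A (r k) \<subseteq> convex hull V"
      using polytope_between[OF compact_nbhd[OF A(1)] open_sums[OF disjI2[OF open_ball]] sub] .
    then show ?thesis by blast
  qed
  then obtain P where P: "\<And>k. finite (P k)" "\<And>k. P k \<subseteq> ?U A (2 * r k)" "\<And>k. nbhd A (r k) \<subseteq> convex hull P k"
    by metis
  have "\<exists>V. finite V \<and> V \<subseteq> ?U L (r k) \<and> L \<subseteq> convex hull V" for k
  proof -
    have sub: "L \<subseteq> ?U L (r k)"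
    proof
      fix x assume "x \<in> L"
      moreover have "(0 :: (real, 'm) vec) \<in> ball 0 (r k)" using r by simp
      moreover have "x = x + 0" by simp
      ultimately show "x \<in> ?U L (r k)" by blast
    qed
    obtain V where "finite V" "V \<subseteq> ?U L (r k)" "L \<subseteq> convex hull V"
      using polytope_between[OF L(1) open_sums[OF disjI2[OF open_ball]] sub] .
    then show ?thesis by blast
  qed
  then obtain Q where Q: "\<And>k. finite (Q k)" "\<And>k. Q k \<subseteq> ?U L (r k)" "\<And>k. L \<subseteq> convex hull Q k"
    by metis
  have convU: "convex (?U B r)" if "convex B" for B :: "(real, 'm) vec set" and r
    by (intro convex_sums that convex_ball)
  have hullP: "convex hull P k \<subseteq> ?U A (2 * r k)" for k
    by (rule hull_minimal[where S = convex, OF P(2)[of k] convU[OF A(2), of "2 * r k"]])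
  have hullQ: "convex hull Q k \<subseteq> ?U L (r k)" for k
    by (rule hull_minimal[where S = convex, OF Q(2)[of k] convU[OF L(2), of "r k"]])
  have spread: "\<exists>v\<in>P k. \<exists>w\<in>P k. h \<bullet> v \<noteq> h \<bullet> w" if h: "h \<noteq> 0" for h k
  proof (rule ccontr)
    assume "\<not> ?thesis"
    then obtain c where c: "P k \<subseteq> {x. h \<bullet> x = c}" by blast
    have "convex hull P k \<subseteq> {x. h \<bullet> x = c}"
      by (rule hull_minimal[OF c]) (rule convex_hyperplane)
    then have nb: "nbhd A (r k) \<subseteq> {x. h \<bullet> x = c}" using P(3) by blast
    obtain a where a: "a \<in> A" using A by blast
    have "a \<in> nbhd A (r k)" using a subset_nbhd[OF r(2)] by blast
    moreover have "a + (r k / norm h) *\<^sub>R h \<in> nbhd A (r k)"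
      using a h r[of k] by (auto simp: mem_nbhd dist_norm intro!: bexI[of _ a])
    ultimately have "h \<bullet> a = c" "h \<bullet> (a + (r k / norm h) *\<^sub>R h) = c"
      using nb by blast+
    then have "h \<bullet> ((r k / norm h) *\<^sub>R h) = 0"
      unfolding inner_add_right by linarith
    with h r(1)[of k] show False by simp
  qed
  define m where "m k t = measure lebesgue (msum (convex hull P k) t (convex hull Q k))" for k t
  have "interpolates CARD('m) (m k)" for k
    unfolding m_def
  proof (rule interpolates_measure_polytopes[OF P(1) Q(1) _ spread])
    show "Q k \<noteq> {}" using Q(3)[of k] L by auto
  qed
  then show ?thesis
  proof (rule interpolates_limit)
    fix t :: real assume t: "t \<ge> 0"
    \<comment> \<open>The error is below 2 * r k from A, plus t times an error below r k from
      L.\<close>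
    let ?\<rho> = "\<lambda>k. (2 + t) * r k"
    have comp: "compact (msum A t L)" by (intro compact_msum A L)
    have \<rho>0: "?\<rho> \<longlonglongrightarrow> 0"
      using tendsto_mult_right[OF LIMSEQ_Suc[OF lim_1_over_n], of "2 + t"] by (simp add: r_def)
    have dec: "decseq ?\<rho>"
      unfolding decseq_def r_def using t by (auto intro!: mult_left_mono divide_left_mono)
    have lim: "(\<lambda>k. measure lebesgue (nbhd (msum A t L) (?\<rho> k))) \<longlonglongrightarrow> measure lebesgue (msum A t L)"
      by (rule measure_nbhd_tendsto[OF comp dec \<rho>0]) (use t r in auto)
    have low: "msum A t L \<subseteq> msum (convex hull P k) t (convex hull Q k)" for k
    proof -
      have "A \<subseteq> nbhd A (r k)" by (rule subset_nbhd[OF r(2)])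
      with P(3)[of k] Q(3)[of k] show ?thesis unfolding msum_def by blast
    qed
    have up: "msum (convex hull P k) t (convex hull Q k) \<subseteq> nbhd (msum A t L) (?\<rho> k)" for k
    proof
      fix x assume "x \<in> msum (convex hull P k) t (convex hull Q k)"
      then obtain p q where x: "x = p + t *\<^sub>R q" "p \<in> convex hull P k" "q \<in> convex hull Q k"
        unfolding msum_def by blast
      then obtain a a' l l' where pq: "p = a + a'" "a \<in> A" "norm a' < 2 * r k"
          "q = l + l'" "l \<in> L" "norm l' < r k"
        using hullP[of k] hullQ[of k] by (fastforce simp: dist_norm)
      have "x - (a + t *\<^sub>R l) = a' + t *\<^sub>R l'"
        unfolding x pq by (simp add: algebra_simps)
      moreover have "dist (a + t *\<^sub>R l) x = norm (x - (a + t *\<^sub>R l))"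
        unfolding dist_norm by (rule norm_minus_commute)
      ultimately have "dist (a + t *\<^sub>R l) x = norm (a' + t *\<^sub>R l')" by simp
      also have "\<dots> \<le> norm a' + t * norm l'"
        using norm_triangle_ineq[of a' "t *\<^sub>R l'"] t by simp
      also have "\<dots> \<le> 2 * r k + t * r k"
        by (intro add_mono mult_left_mono) (use pq t in auto)
      also have "\<dots> = ?\<rho> k" by (simp add: distrib_right)
      finally have "dist (a + t *\<^sub>R l) x \<le> ?\<rho> k" .
      moreover have "a + t *\<^sub>R l \<in> msum A t L" using pq unfolding msum_def by blast
      moreover have "?\<rho> k \<ge> 0" using t r[of k] by simp
      ultimately show "x \<in> nbhd (msum A t L) (?\<rho> k)" by (metis mem_nbhd)
    qed
    have meas: "msum (convex hull P k) t (convex hull Q k) \<in> lmeasurable" for k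
      by (intro lmeasurable_compact compact_msum finite_imp_compact_convex_hull P Q)
    show "(\<lambda>k. m k t) \<longlonglongrightarrow> measure lebesgue (msum A t L)"
      unfolding m_def
    proof (rule tendsto_sandwich[OF _ _ tendsto_const lim])
      show "\<forall>\<^sub>F k in sequentially. measure lebesgue (msum A t L) \<le> measure lebesgue (msum (convex hull P k) t (convex hull Q k))"
        using low meas lmeasurable_compact[OF comp] by (intro always_eventually allI measure_mono_fmeasurable) auto
      show "\<forall>\<^sub>F k in sequentially. measure lebesgue (msum (convex hull P k) t (convex hull Q k)) \<le> measure lebesgue (nbhd (msum A t L) (?\<rho> k))"
        using up meas lmeasurable_compact[OF compact_nbhd[OF comp]] by (intro always_eventually allI measure_mono_fmeasurable) auto
    qed
  qed
qed

section \<open>Transfer to an arbitrary finite index type\<close>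

definition reindex_copy :: "real ^ 'n \<Rightarrow> real ^ 'n ordered_copy" where
  "reindex_copy x = (\<chi> i. x $ Rep_ordered_copy i)"

definition unreindex_copy :: "real ^ 'n ordered_copy \<Rightarrow> real ^ 'n" where
  "unreindex_copy y = (\<chi> i. y $ Abs_ordered_copy i)"

lemma reindex_copy_inverse [simp]:
  "unreindex_copy (reindex_copy x) = x" "reindex_copy (unreindex_copy y) = y"
  by (simp_all add: reindex_copy_def unreindex_copy_def vec_eq_iff Abs_ordered_copy_inverse Rep_ordered_copy_inverse)

lemma linear_reindex_copy: "linear reindex_copy"
  by (rule linearI) (simp_all add: reindex_copy_def vec_eq_iff)

lemma prod_Basis_cart: "(\<Prod>b\<in>Basis. x \<bullet> b) = (\<Prod>i\<in>UNIV. x $ i)" for x :: "real ^ 'n"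
proof -
  have "(Basis :: (real ^ 'n) set) = range (\<lambda>i. axis i 1)"
    by (auto simp: Basis_vec_def)
  then have "(\<Prod>b\<in>Basis. x \<bullet> b) = (\<Prod>b\<in>range (\<lambda>i. axis i 1). x \<bullet> b)"
    by (simp only:)
  also have "\<dots> = (\<Prod>i\<in>UNIV. x \<bullet> axis i 1)"
    by (subst prod.reindex) (auto simp: inj_def axis_eq_axis)
  finally show ?thesis by (simp add: inner_axis)
qed

lemma bij_Abs_ordered_copy: "bij Abs_ordered_copy"
  by (rule bij_betw_byWitness[where f' = Rep_ordered_copy])
    (auto simp: Abs_ordered_copy_inverse Rep_ordered_copy_inverse)

text \<open>Renaming coordinates maps boxes to boxes with the same side lengths, and Lebesgue
  measure is determined by its values on boxes.\<close>

lemma distr_reindex_copy: "distr lborel borel reindex_copy = (lborel :: (real ^ ('n::finite) ordered_copy) measure)"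
proof (rule lborel_eqI[symmetric])
  fix l u :: "real ^ 'n ordered_copy"
  assume le: "\<And>b. b \<in> Basis \<Longrightarrow> l \<bullet> b \<le> u \<bullet> b"
  then have le': "l $ i \<le> u $ i" for i
  proof -
    have "(axis i 1 :: real ^ 'n ordered_copy) \<in> Basis" by (auto simp: Basis_vec_def)
    from le[OF this] show ?thesis by (simp add: inner_axis)
  qed
  have meas: "reindex_copy \<in> borel_measurable (borel :: (real ^ 'n) measure)"
    using linear_continuous_on[OF linear_conv_bounded_linear[THEN iffD1, OF linear_reindex_copy]]
    by (rule borel_measurable_continuous_onI)
  have pre: "reindex_copy -` box l u = box (unreindex_copy l) (unreindex_copy u)"
  proof (intro set_eqI)
    fix x :: "real ^ 'n"
    have "(\<forall>i. P (Rep_ordered_copy i)) \<longleftrightarrow> (\<forall>i. P i)" for P :: "'n \<Rightarrow> bool"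
      using bij_Abs_ordered_copy Abs_ordered_copy_inverse by (metis UNIV_I)
    from this[of "\<lambda>i. l $ Abs_ordered_copy i < x $ i \<and> x $ i < u $ Abs_ordered_copy i"]
    show "x \<in> reindex_copy -` box l u \<longleftrightarrow> x \<in> box (unreindex_copy l) (unreindex_copy u)"
      by (simp add: mem_box_cart reindex_copy_def unreindex_copy_def Rep_ordered_copy_inverse)
  qed
  have "emeasure (distr lborel borel reindex_copy) (box l u) = emeasure lborel (box (unreindex_copy l) (unreindex_copy u))"
    using meas by (subst emeasure_distr) (auto simp: pre)
  also have "\<dots> = (\<Prod>b\<in>Basis. (unreindex_copy u - unreindex_copy l) \<bullet> b)"
    by (rule emeasure_lborel_box) (use le' in \<open>auto simp: Basis_vec_def inner_axis unreindex_copy_def\<close>)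
  also have "\<dots> = (\<Prod>b\<in>Basis. (u - l) \<bullet> b)"
    unfolding prod_Basis_cart
    by (simp add: unreindex_copy_def prod.reindex_bij_betw[OF bij_Abs_ordered_copy, of "\<lambda>i. u $ i - l $ i"])
  finally show "emeasure (distr lborel borel reindex_copy) (box l u) = ennreal (\<Prod>b\<in>Basis. (u - l) \<bullet> b)" .
qed simp

lemma measure_reindex_copy:
  fixes A :: "(real ^ 'n) set"
  assumes "compact A"
  shows "compact (reindex_copy ` A)" "measure lborel (reindex_copy ` A) = measure lborel A"
proof -
  have cont: "continuous_on S reindex_copy" for S :: "(real ^ 'n) set"
    by (rule linear_continuous_on[OF linear_conv_bounded_linear[THEN iffD1, OF linear_reindex_copy]])
  show comp: "compact (reindex_copy ` A)"
    by (rule compact_continuous_image[OF cont assms])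
  have "reindex_copy -` reindex_copy ` A = A"
    by (rule inj_vimage_image_eq, rule inj_on_inverseI) (rule reindex_copy_inverse(1))
  then show "measure lborel (reindex_copy ` A) = measure lborel A"
    using borel_compact[OF comp] borel_measurable_continuous_onI[OF cont]
    by (subst distr_reindex_copy[symmetric], subst measure_distr) auto
qed

theorem interpolates_measure_msum:
  fixes A L :: "(real ^ 'n) set"
  assumes A: "compact A" "convex A" and L: "compact L" "convex L"
  shows "interpolates CARD('n) (\<lambda>t. measure lborel (msum A t L))"
proof (cases "A = {} \<or> L = {}")
  case True
  then have "msum A t L = {}" for t by (auto simp: msum_def)
  then show ?thesis by (simp add: interpolates_def)
next
  case False
  let ?\<rho> = "reindex_copy :: real ^ 'n \<Rightarrow> _"
  have "interpolates CARD('n ordered_copy) (\<lambda>t. measure lebesgue (msum (?\<rho> ` A) t (?\<rho> ` L)))"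
    using False by (intro interpolates_measure_msum_wellorder convex_linear_image linear_reindex_copy assms measure_reindex_copy(1)) auto
  also have "(\<lambda>t. measure lebesgue (msum (?\<rho> ` A) t (?\<rho> ` L))) = (\<lambda>t. measure lborel (msum A t L))"
  proof
    fix t
    have comp: "compact (msum A t L)" by (intro compact_msum A L)
    have "measure lebesgue (msum (?\<rho> ` A) t (?\<rho> ` L)) = measure lebesgue (?\<rho> ` msum A t L)"
      by (simp add: linear_image_msum[OF linear_reindex_copy])
    also have "\<dots> = measure lborel (?\<rho> ` msum A t L)"
      using borel_compact[OF measure_reindex_copy(1)[OF comp]] by (simp add: measure_completion)
    also have "\<dots> = measure lborel (msum A t L)" by (rule measure_reindex_copy(2)[OF comp])
    finally show "measure lebesgue (msum (?\<rho> ` A) t (?\<rho> ` L)) = measure lborel (msum A t L)" .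
  qed
  also have "CARD('n ordered_copy) = CARD('n)"
    by (rule bij_betw_same_card[OF bij_Abs_ordered_copy, symmetric])
  finally show ?thesis .
qed

section \<open>Difference bodies in a product of Euclidean spaces\<close>

lemma emeasure_lborel_affine_vimage:
  fixes A :: "'a::euclidean_space set"
  assumes "c \<noteq> 0" "A \<in> sets borel"
  shows "emeasure lborel A = ennreal (\<bar>c\<bar> ^ DIM('a)) * emeasure lborel ((\<lambda>x. t + c *\<^sub>R x) -` A)"
proof -
  have meas: "(\<lambda>x. t + c *\<^sub>R x) \<in> borel_measurable lborel" by simp
  have "emeasure lborel A = emeasure (density (distr lborel borel (\<lambda>x. t + c *\<^sub>R x)) (\<lambda>_. ennreal (\<bar>c\<bar> ^ DIM('a)))) A"
    using lborel_affine[OF assms(1), of t] by simp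
  also have "\<dots> = ennreal (\<bar>c\<bar> ^ DIM('a)) * emeasure (distr lborel borel (\<lambda>x. t + c *\<^sub>R x)) A"
    using assms(2) by (subst emeasure_density) (auto simp: nn_integral_cmult)
  also have "emeasure (distr lborel borel (\<lambda>x. t + c *\<^sub>R x)) A = emeasure lborel ((\<lambda>x. t + c *\<^sub>R x) -` A)"
    using assms(2) meas by (subst emeasure_distr) auto
  finally show ?thesis .
qed

interpretation lborel_product: product_sigma_finite "\<lambda>_::nat. lborel :: 'a::euclidean_space measure"
  by standard

abbreviation plborel :: "nat set \<Rightarrow> (nat \<Rightarrow> 'a::euclidean_space) measure" where
  "plborel I \<equiv> (\<Pi>\<^sub>M i\<in>I. lborel)"

lemma space_plborel [simp]: "space (plborel I) = extensional I"
  by (simp add: space_PiM PiE_def)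

text \<open>Index 0 stands for the negative diagonal embedding.\<close>

definition emb :: "nat \<Rightarrow> nat \<Rightarrow> real ^ 'n \<Rightarrow> (nat \<Rightarrow> real ^ 'n)" where
  "emb p l z = (\<lambda>i\<in>{1..p}. if l = 0 then - z else if l = i then z else 0)"

text \<open>An explicit parametrisation by one point of K per index, with \<open>y 0\<close> shared
  by all coordinates. It is the working form of \<open>diff_body\<close>, also for parameters that
  do not sum to 1.\<close>

definition dbody :: "nat \<Rightarrow> (nat \<Rightarrow> real) \<Rightarrow> (real ^ 'n) set \<Rightarrow> (nat \<Rightarrow> real ^ 'n) set" where
  "dbody p t K = {(\<lambda>i\<in>{1..p}. t i *\<^sub>R y i - t 0 *\<^sub>R y 0) | y. \<forall>l\<le>p. y l \<in> K}"

lemma emb_zero: "emb p 0 ` K = pscale p (-1) (diag_emb p ` K)"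
  unfolding emb_def pscale_def diag_emb_def image_image by (intro image_cong) auto

lemma emb_pos: "l > 0 \<Longrightarrow> emb p l ` K = factor_emb p l ` K"
  unfolding emb_def factor_emb_def by (intro image_cong) auto

lemma pscale_emb: "pscale p c (emb p l ` K) = (\<lambda>z. \<lambda>i\<in>{1..p}. c *\<^sub>R emb p l z i) ` K"
  by (simp add: pscale_def image_image)

text \<open>Nonnegative multiples of a convex set add up like numbers: divide by the total weight to
  get a convex combination. If the total is 0, any point of K serves.\<close>

lemma convex_weighted_sum:
  assumes "finite J" "convex K" "K \<noteq> {}" "\<And>k. k \<in> J \<Longrightarrow> s k \<ge> 0" "\<And>k. k \<in> J \<Longrightarrow> z k \<in> K"
  shows "\<exists>y\<in>K. (\<Sum>k\<in>J. s k *\<^sub>R z k) = sum s J *\<^sub>R y"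
proof (cases "sum s J = 0")
  case True
  then have "\<forall>k\<in>J. s k = 0" using assms by (simp add: sum_nonneg_eq_0_iff)
  with True assms(3) show ?thesis by auto
next
  case False
  have "(\<Sum>k\<in>J. (s k / sum s J) *\<^sub>R z k) \<in> K"
    using assms False by (intro convex_sum) (auto simp: sum_divide_distrib[symmetric] intro!: divide_nonneg_nonneg sum_nonneg)
  moreover have "(\<Sum>k\<in>J. s k *\<^sub>R z k) = sum s J *\<^sub>R (\<Sum>k\<in>J. (s k / sum s J) *\<^sub>R z k)"
    using False by (simp add: scaleR_sum_right)
  ultimately show ?thesis by blast
qed

text \<open>Summands with the same embedded body merge, their coefficients adding up. Applied both
  to the sum in \<open>mixed_volume\<close>, where bodies are repeated, and to
  \<open>diff_body\<close>.\<close>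

lemma pminkowski_emb:
  assumes I: "finite I" and K: "convex K" "K \<noteq> {}"
    and s: "\<And>k. k \<in> I \<Longrightarrow> s k \<ge> 0" and lab: "\<And>k. k \<in> I \<Longrightarrow> lab k \<le> p"
  shows "pminkowski p I (\<lambda>k. pscale p (s k) (emb p (lab k) ` K)) = dbody p (\<lambda>l. \<Sum>k | k \<in> I \<and> lab k = l. s k) K"
    (is "?L = dbody p ?T K")
proof -
  have coord: "(\<Sum>k\<in>I. s k *\<^sub>R emb p (lab k) (z k) i)
    = (\<Sum>k | k \<in> I \<and> lab k = i. s k *\<^sub>R z k) - (\<Sum>k | k \<in> I \<and> lab k = 0. s k *\<^sub>R z k)"
    if i: "i \<in> {1..p}" for i and z :: "_ \<Rightarrow> real ^ 'n"
  proof -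
    have "(\<Sum>k\<in>I. s k *\<^sub>R emb p (lab k) (z k) i)
      = (\<Sum>k\<in>I. (if lab k = i then s k *\<^sub>R z k else 0) - (if lab k = 0 then s k *\<^sub>R z k else 0))"
      using i by (intro sum.cong) (auto simp: emb_def)
    then show ?thesis
      using I by (simp add: sum_subtractf sum.inter_filter)
  qed
  show ?thesis
  proof (intro set_eqI iffI)
    fix x assume "x \<in> ?L"
    then obtain w where x: "x = (\<lambda>i\<in>{1..p}. \<Sum>k\<in>I. w k i)"
        and w: "\<forall>k\<in>I. w k \<in> pscale p (s k) (emb p (lab k) ` K)"
      unfolding pminkowski_def by blast
    have "\<forall>k\<in>I. \<exists>z\<in>K. w k = (\<lambda>i\<in>{1..p}. s k *\<^sub>R emb p (lab k) z i)"
      using w unfolding pscale_emb by blast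
    then obtain z where z: "\<And>k. k \<in> I \<Longrightarrow> z k \<in> K"
        "\<And>k. k \<in> I \<Longrightarrow> w k = (\<lambda>i\<in>{1..p}. s k *\<^sub>R emb p (lab k) (z k) i)"
      by metis
    have "\<forall>l. \<exists>y\<in>K. (\<Sum>k | k \<in> I \<and> lab k = l. s k *\<^sub>R z k) = ?T l *\<^sub>R y"
      using I K s z(1) by (intro allI convex_weighted_sum) auto
    from choice[OF this[unfolded Bex_def]]
    obtain y where "\<forall>l. y l \<in> K \<and> (\<Sum>k | k \<in> I \<and> lab k = l. s k *\<^sub>R z k) = ?T l *\<^sub>R y l"
      by (rule exE)
    then have y: "y l \<in> K" "(\<Sum>k | k \<in> I \<and> lab k = l. s k *\<^sub>R z k) = ?T l *\<^sub>R y l" for l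
      by blast+
    have "x = (\<lambda>i\<in>{1..p}. \<Sum>k\<in>I. s k *\<^sub>R emb p (lab k) (z k) i)"
      unfolding x using z(2) by (intro restrict_ext sum.cong) auto
    also have "\<dots> = (\<lambda>i\<in>{1..p}. ?T i *\<^sub>R y i - ?T 0 *\<^sub>R y 0)"
      by (intro restrict_ext) (simp add: coord y(2))
    finally show "x \<in> dbody p ?T K" unfolding dbody_def using y(1) by blast
  next
    fix x assume "x \<in> dbody p ?T K"
    then obtain y where x: "x = (\<lambda>i\<in>{1..p}. ?T i *\<^sub>R y i - ?T 0 *\<^sub>R y 0)" and y: "\<forall>l\<le>p. y l \<in> K"
      unfolding dbody_def by blast
    let ?w = "\<lambda>k. \<lambda>i\<in>{1..p}. s k *\<^sub>R emb p (lab k) (y (lab k)) i"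
    have "x = (\<lambda>i\<in>{1..p}. \<Sum>k\<in>I. ?w k i)"
      unfolding x by (intro restrict_ext) (simp add: coord scaleR_sum_left)
    moreover have "\<forall>k\<in>I. ?w k \<in> pscale p (s k) (emb p (lab k) ` K)"
      unfolding pscale_emb using y lab by blast
    ultimately show "x \<in> ?L" unfolding pminkowski_def by (intro CollectI exI[of _ ?w] conjI)
  qed
qed

lemma dbody_cong: "(\<And>l. l \<le> p \<Longrightarrow> t l = t' l) \<Longrightarrow> dbody p t K = dbody p t' K"
proof -
  assume eq: "\<And>l. l \<le> p \<Longrightarrow> t l = t' l"
  show ?thesis
    unfolding dbody_def
    by (intro Collect_cong ex_cong1 conj_cong refl arg_cong2[where f = "(=)"] restrict_ext) (simp add: eq)
qed

lemma diff_body_eq_dbody: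
  assumes "convex K" "K \<noteq> {}" "\<And>l. l \<le> p \<Longrightarrow> t l \<ge> 0"
  shows "diff_body p t K = dbody p t K"
proof -
  have "(if l = 0 then pscale p (- t 0) (diag_emb p ` K) else pscale p (t l) (factor_emb p l ` K))
    = pscale p (t l) (emb p l ` K)" for l
  proof (cases "l = 0")
    case True
    have "pscale p (- t 0) (diag_emb p ` K) = pscale p (t 0) (emb p 0 ` K)"
      unfolding emb_zero pscale_def image_image by (intro image_cong) auto
    with True show ?thesis by simp
  qed (simp add: emb_pos)
  then have "diff_body p t K = pminkowski p {..p} (\<lambda>l. pscale p (t l) (emb p l ` K))"
    unfolding diff_body_def by simp
  also have "\<dots> = dbody p (\<lambda>l. \<Sum>k | k \<in> {..p} \<and> k = l. t k) K"
    by (rule pminkowski_emb[where lab = "\<lambda>k. k"]) (use assms in auto)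
  also have "\<dots> = dbody p t K"
  proof (rule dbody_cong)
    fix l assume "l \<le> p"
    then have "{k. k \<in> {..p} \<and> k = l} = {l}" by auto
    then show "(\<Sum>k | k \<in> {..p} \<and> k = l. t k) = t l" by simp
  qed
  finally show ?thesis .
qed

text \<open>A continuous image of a product of copies of K, one for each natural number, which is
  compact by Tychonoff.\<close>

lemma compact_dbody:
  assumes "compact K"
  shows "compact (dbody p t K)"
proof -
  have dom: "compact (PiE UNIV (\<lambda>_::nat. K))"
    using assms compactin_PiE[of "\<lambda>_. euclidean" UNIV "\<lambda>_::nat. K"]
    by (simp add: euclidean_product_topology)
  have cont: "continuous_on UNIV (\<lambda>y. \<lambda>i\<in>{1..p}. t i *\<^sub>R y i - t 0 *\<^sub>R y 0 :: real ^ 'n)"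
    unfolding restrict_def
  proof (rule continuous_on_coordinatewise_then_product)
    fix i
    show "continuous_on UNIV (\<lambda>y. if i \<in> {1..p} then t i *\<^sub>R y i - t 0 *\<^sub>R y 0 else undefined :: real ^ 'n)"
      by (cases "i \<in> {1..p}") (auto intro!: continuous_intros)
  qed
  have eq: "dbody p t K = (\<lambda>y. \<lambda>i\<in>{1..p}. t i *\<^sub>R y i - t 0 *\<^sub>R y 0) ` PiE UNIV (\<lambda>_. K)"
  proof (intro set_eqI iffI)
    fix x assume "x \<in> dbody p t K"
    then obtain y where x: "x = (\<lambda>i\<in>{1..p}. t i *\<^sub>R y i - t 0 *\<^sub>R y 0)" and y: "\<forall>l\<le>p. y l \<in> K"
      unfolding dbody_def by blast
    \<comment> \<open>Only the points with index up to p are known to lie in K; all later ones are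
      replaced by \<open>y 0\<close>.\<close>
    have "x = (\<lambda>i\<in>{1..p}. t i *\<^sub>R (if i \<le> p then y i else y 0) - t 0 *\<^sub>R (if 0 \<le> p then y 0 else y 0))"
      unfolding x by (intro restrict_ext) auto
    then show "x \<in> (\<lambda>y. \<lambda>i\<in>{1..p}. t i *\<^sub>R y i - t 0 *\<^sub>R y 0) ` PiE UNIV (\<lambda>_. K)"
      using y by (intro image_eqI[where x = "\<lambda>i. if i \<le> p then y i else y 0"]) auto
  qed (auto simp: dbody_def)
  show ?thesis
    unfolding eq by (rule compact_continuous_image[OF continuous_on_subset[OF cont subset_UNIV] dom])
qed

text \<open>The inclusion of extensional functions into the space of all functions is measurable
  coordinate by coordinate: coordinates outside I are constantly \<open>undefined\<close>. Compact
  sets are Borel in the larger space.\<close>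

lemma sets_plborel_if_compact:
  fixes A :: "(nat \<Rightarrow> 'a::euclidean_space) set"
  assumes "compact A" "A \<subseteq> extensional I"
  shows "A \<in> sets (plborel I)"
proof -
  have "(\<lambda>x. x) \<in> borel_measurable (plborel I :: (nat \<Rightarrow> 'a) measure)"
  proof (rule measurable_coordinatewise_then_product)
    fix i
    show "(\<lambda>x. x i) \<in> borel_measurable (plborel I :: (nat \<Rightarrow> 'a) measure)"
    proof (cases "i \<in> I")
      case True
      then show ?thesis
        using measurable_component_singleton[of i I "\<lambda>_. lborel :: 'a measure"] by simp
    next
      case False
      then have "(\<lambda>x. x i) \<in> borel_measurable (plborel I :: (nat \<Rightarrow> 'a) measure)
        \<longleftrightarrow> (\<lambda>x. undefined :: 'a) \<in> borel_measurable (plborel I :: (nat \<Rightarrow> 'a) measure)"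
        by (intro measurable_cong) (auto simp: extensional_def)
      then show ?thesis by simp
    qed
  qed
  from measurable_sets[OF this, of A] assms show ?thesis
    by (simp add: borel_compact Int_absorb2)
qed

lemma dbody_extensional: "dbody p t K \<subseteq> extensional {1..p}"
  unfolding dbody_def by auto

lemma dbody_sets: "compact K \<Longrightarrow> dbody p t K \<in> sets (plborel {1..p})"
  by (intro sets_plborel_if_compact compact_dbody dbody_extensional)

lemma pvol_eq: "pvol p A = measure (plborel {1..p}) A"
  by (simp add: pvol_def)

lemma dbody_subset_PiE:
  "dbody p t K \<subseteq> PiE {1..p} (\<lambda>i. (\<lambda>(a, b). t i *\<^sub>R a - t 0 *\<^sub>R b) ` (K \<times> K))"
  unfolding dbody_def by force

lemma compact_scaled_difference:
  fixes K :: "'a::euclidean_space set"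
  shows "compact K \<Longrightarrow> compact ((\<lambda>(a, b). s *\<^sub>R a - r *\<^sub>R b) ` (K \<times> K))"
  by (intro compact_continuous_image compact_Times) (auto intro!: continuous_intros simp: split_beta)

text \<open>The enclosing product serves twice: for finiteness of the volume, and for its vanishing
  when a factor is null.\<close>

lemma emeasure_dbody_le:
  assumes "compact K"
  shows "emeasure (plborel {1..p}) (dbody p t K)
    \<le> (\<Prod>i\<in>{1..p}. emeasure lborel ((\<lambda>(a, b). t i *\<^sub>R a - t 0 *\<^sub>R b) ` (K \<times> K)))"
proof -
  have b: "(\<lambda>(a, b). t i *\<^sub>R a - t 0 *\<^sub>R b) ` (K \<times> K) \<in> sets lborel" for i
    using compact_scaled_difference[OF assms] by (simp add: borel_compact)
  have "emeasure (plborel {1..p}) (dbody p t K)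
    \<le> emeasure (plborel {1..p}) (PiE {1..p} (\<lambda>i. (\<lambda>(a, b). t i *\<^sub>R a - t 0 *\<^sub>R b) ` (K \<times> K)))"
    using b by (intro emeasure_mono dbody_subset_PiE sets_PiM_I_finite) auto
  also have "\<dots> = (\<Prod>i\<in>{1..p}. emeasure lborel ((\<lambda>(a, b). t i *\<^sub>R a - t 0 *\<^sub>R b) ` (K \<times> K)))"
    using b by (intro lborel_product.emeasure_PiM) auto
  finally show ?thesis .
qed

lemma emeasure_dbody:
  assumes "compact K"
  shows "emeasure (plborel {1..p}) (dbody p t K) = ennreal (pvol p (dbody p t K))"
proof -
  have "emeasure lborel ((\<lambda>(a, b). t i *\<^sub>R a - t 0 *\<^sub>R b) ` (K \<times> K))
      = ennreal (measure lborel ((\<lambda>(a, b). t i *\<^sub>R a - t 0 *\<^sub>R b) ` (K \<times> K)))" for i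
    using emeasure_compact_finite[OF compact_scaled_difference[OF assms, of "t i" "t 0"]]
    by (intro emeasure_eq_ennreal_measure) auto
  then have "(\<Prod>i\<in>{1..p}. emeasure lborel ((\<lambda>(a, b). t i *\<^sub>R a - t 0 *\<^sub>R b) ` (K \<times> K))) < \<infinity>"
    by (simp add: prod_ennreal)
  with emeasure_dbody_le[OF assms, of p t] have "emeasure (plborel {1..p}) (dbody p t K) \<noteq> \<infinity>"
    by auto
  then show ?thesis unfolding pvol_eq by (simp add: emeasure_eq_ennreal_measure)
qed

lemma dbody_scale:
  "dbody p (\<lambda>l. c * t l) K = (\<lambda>x. \<lambda>i\<in>{1..p}. c *\<^sub>R x i) ` dbody p t K"
proof -
  have "dbody p (\<lambda>l. c * t l) K = {(\<lambda>i\<in>{1..p}. c *\<^sub>R (\<lambda>i\<in>{1..p}. t i *\<^sub>R y i - t 0 *\<^sub>R y 0) i) | y. \<forall>l\<le>p. y l \<in> K}"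
    unfolding dbody_def
    by (intro Collect_cong ex_cong1 conj_cong refl arg_cong2[where f = "(=)"] restrict_ext) (simp add: scaleR_diff_right)
  then show ?thesis unfolding dbody_def setcompr_eq_image image_image .
qed

text \<open>It suffices to compare both measures on products, where each factor contributes the
  scaling constant of one copy of the Euclidean space.\<close>

lemma distr_plborel_scale:
  fixes c :: real
  assumes "c \<noteq> 0" "finite I"
  shows "scale_measure (ennreal ((\<bar>c\<bar> ^ DIM('a)) ^ card I))
    (distr (plborel I) (plborel I) (\<lambda>x. \<lambda>i\<in>I. c *\<^sub>R x i)) = (plborel I :: (nat \<Rightarrow> 'a::euclidean_space) measure)"
proof (rule lborel_product.PiM_eqI[OF assms(2)])
  fix A :: "nat \<Rightarrow> 'a set" assume A: "\<And>i. i \<in> I \<Longrightarrow> A i \<in> sets lborel"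
  have meas: "(\<lambda>x. \<lambda>i\<in>I. c *\<^sub>R x i) \<in> measurable (plborel I) (plborel I :: (nat \<Rightarrow> 'a) measure)"
    by measurable
  have pre: "(\<lambda>x. \<lambda>i\<in>I. c *\<^sub>R x i) -` Pi\<^sub>E I A \<inter> space (plborel I) = Pi\<^sub>E I (\<lambda>i. (\<lambda>x. 0 + c *\<^sub>R x) -` A i)"
    by (auto simp: PiE_def Pi_def extensional_def)
  have mf: "(\<lambda>x::'a. 0 + c *\<^sub>R x) \<in> measurable lborel lborel" by simp
  have vA: "(\<lambda>x. 0 + c *\<^sub>R x) -` A i \<in> sets lborel" if "i \<in> I" for i
    using measurable_sets[OF mf A[OF that]] by (simp only: space_lborel space_borel Int_UNIV_right)
  have "emeasure (distr (plborel I) (plborel I) (\<lambda>x. \<lambda>i\<in>I. c *\<^sub>R x i)) (Pi\<^sub>E I A)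
    = emeasure (plborel I) (Pi\<^sub>E I (\<lambda>i. (\<lambda>x. 0 + c *\<^sub>R x) -` A i))"
    using A assms(2) meas by (subst emeasure_distr) (auto simp: pre[simplified] intro!: sets_PiM_I_finite)
  also have "\<dots> = (\<Prod>i\<in>I. emeasure lborel ((\<lambda>x. 0 + c *\<^sub>R x) -` A i))"
    using vA assms(2) by (intro lborel_product.emeasure_PiM) auto
  finally have "emeasure (scale_measure (ennreal ((\<bar>c\<bar> ^ DIM('a)) ^ card I))
      (distr (plborel I) (plborel I) (\<lambda>x. \<lambda>i\<in>I. c *\<^sub>R x i))) (Pi\<^sub>E I A)
    = (\<Prod>i\<in>I. ennreal (\<bar>c\<bar> ^ DIM('a))) * (\<Prod>i\<in>I. emeasure lborel ((\<lambda>x. 0 + c *\<^sub>R x) -` A i))"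
    by (simp add: ennreal_power)
  also have "\<dots> = (\<Prod>i\<in>I. ennreal (\<bar>c\<bar> ^ DIM('a)) * emeasure lborel ((\<lambda>x. 0 + c *\<^sub>R x) -` A i))"
    by (simp only: prod.distrib)
  also have "\<dots> = (\<Prod>i\<in>I. emeasure lborel (A i))"
    using A by (intro prod.cong refl emeasure_lborel_affine_vimage[OF assms(1), symmetric]) simp
  finally show "emeasure (scale_measure (ennreal ((\<bar>c\<bar> ^ DIM('a)) ^ card I))
      (distr (plborel I) (plborel I) (\<lambda>x. \<lambda>i\<in>I. c *\<^sub>R x i))) (Pi\<^sub>E I A) = (\<Prod>i\<in>I. emeasure lborel (A i))" .
qed simp

lemma pvol_dbody_scale:
  fixes K :: "(real ^ 'n) set"
  assumes K: "compact K" and c: "c > 0"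
  shows "pvol p (dbody p (\<lambda>l. c * t l) K) = c ^ (CARD('n) * p) * pvol p (dbody p t K)"
proof -
  let ?f = "\<lambda>x. \<lambda>i\<in>{1..p}. c *\<^sub>R x i :: real ^ 'n"
  have meas: "?f \<in> measurable (plborel {1..p}) (plborel {1..p})" by measurable
  have pre: "?f -` dbody p (\<lambda>l. c * t l) K \<inter> space (plborel {1..p}) = dbody p t K"
  proof (intro set_eqI iffI)
    fix x assume "x \<in> ?f -` dbody p (\<lambda>l. c * t l) K \<inter> space (plborel {1..p})"
    then have fx: "?f x \<in> ?f ` dbody p t K" and x: "x \<in> extensional {1..p}"
      unfolding dbody_scale space_plborel by blast+
    from fx obtain z where z: "z \<in> dbody p t K" "?f x = ?f z"
      by (rule imageE)
    have "x i = z i" if "i \<in> {1..p}" for i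
      using fun_cong[OF z(2), of i] that c by simp
    moreover have "z \<in> extensional {1..p}" using dbody_extensional z(1) by blast
    ultimately have "x = z" using x by (intro extensionalityI)
    with z(1) show "x \<in> dbody p t K" by simp
  next
    fix x assume x: "x \<in> dbody p t K"
    then show "x \<in> ?f -` dbody p (\<lambda>l. c * t l) K \<inter> space (plborel {1..p})"
      unfolding dbody_scale space_plborel using subsetD[OF dbody_extensional x] by blast
  qed
  have "ennreal (pvol p (dbody p (\<lambda>l. c * t l) K))
    = emeasure (scale_measure (ennreal ((\<bar>c\<bar> ^ DIM(real ^ 'n)) ^ card {1..p})) (distr (plborel {1..p}) (plborel {1..p}) ?f)) (dbody p (\<lambda>l. c * t l) K)"
    using c by (simp only: distr_plborel_scale emeasure_dbody[OF K] less_imp_neq[OF c, symmetric] finite_atLeastAtMost not_False_eq_True)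
  also have "\<dots> = ennreal (c ^ (CARD('n) * p)) * ennreal (pvol p (dbody p t K))"
  proof -
    have "emeasure (distr (plborel {1..p}) (plborel {1..p}) ?f) (dbody p (\<lambda>l. c * t l) K) = ennreal (pvol p (dbody p t K))"
      unfolding emeasure_distr[OF meas dbody_sets[OF K]] pre emeasure_dbody[OF K] ..
    moreover have "(\<bar>c\<bar> ^ DIM(real ^ 'n)) ^ card {1..p} = c ^ (CARD('n) * p)"
      using c by (simp add: power_mult)
    ultimately show ?thesis
      by (simp only: emeasure_scale_measure)
  qed
  also have "\<dots> = ennreal (c ^ (CARD('n) * p) * pvol p (dbody p t K))"
    using c by (intro ennreal_mult[symmetric]) (auto simp: pvol_eq)
  finally show ?thesis
    using c by (subst (asm) ennreal_inj) (auto simp: pvol_eq)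
qed

section \<open>Symmetry of the volume in the parameters\<close>

lemma emeasure_lborel_translate:
  "A \<in> sets borel \<Longrightarrow> emeasure lborel ((\<lambda>x. x - y) -` A) = emeasure lborel (A :: 'a::euclidean_space set)"
  using emeasure_lborel_affine_vimage[of 1 A "- y"] by simp

lemma emeasure_lborel_reflect:
  "A \<in> sets borel \<Longrightarrow> emeasure lborel (uminus -` A) = emeasure lborel (A :: 'a::euclidean_space set)"
  using emeasure_lborel_affine_vimage[of "-1" A 0] by simp

text \<open>A linear involution on extensional functions. If x i is
  \<open>t i *\<^sub>R y i - t 0 *\<^sub>R y 0\<close>, subtracting x 1 replaces the term with index
  0 by the term with index 1, and - x 1 is the first coordinate with both roles exchanged.\<close>

definition shear :: "nat \<Rightarrow> (nat \<Rightarrow> 'a::real_vector) \<Rightarrow> (nat \<Rightarrow> 'a)" where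
  "shear p x = (\<lambda>i\<in>{1..p}. if i = 1 then - x 1 else x i - x 1)"

lemma measurable_shear: "shear p \<in> measurable (plborel {1..p}) (plborel {1..p} :: (nat \<Rightarrow> 'a::euclidean_space) measure)"
proof -
  have "(\<lambda>x. if i = 1 then - x 1 else x i - x 1) \<in> measurable (plborel {1..p} :: (nat \<Rightarrow> 'a) measure) lborel"
    if "i \<in> {1..p}" for i
  proof (cases "i = 1")
    case True
    have "(1::nat) \<in> {1..p}" using that by simp
    then show ?thesis unfolding True by simp
  next
    case False
    have "(1::nat) \<in> {1..p}" using that by simp
    then show ?thesis using False that by simp
  qed
  then show ?thesis unfolding shear_def[abs_def] by (rule measurable_restrict)
qed

text \<open>With the first coordinate y fixed, the preimage of a product is again a product: the
  other factors are translated by y, and the condition on y is a reflected factor. Integrate over y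
  last.\<close>

lemma distr_shear:
  assumes "p \<ge> 1"
  shows "distr (plborel {1..p}) (plborel {1..p}) (shear p) = (plborel {1..p} :: (nat \<Rightarrow> 'a::euclidean_space) measure)"
proof (rule lborel_product.PiM_eqI)
  fix A :: "nat \<Rightarrow> 'a set" assume A: "\<And>i. i \<in> {1..p} \<Longrightarrow> A i \<in> sets lborel"
  define J where "J = {2..p}"
  have I: "{1..p} = insert 1 J" and J: "finite J" "1 \<notin> J" "J \<subseteq> {1..p}"
    using assms by (auto simp: J_def)
  have A1: "A 1 \<in> sets borel" using A[of 1] assms by simp
  have AJ: "A i \<in> sets borel" if "i \<in> J" for i
    using A[OF subsetD[OF J(3) that]] by simp
  define S where "S = shear p -` Pi\<^sub>E {1..p} A \<inter> space (plborel {1..p})"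
  have PA: "Pi\<^sub>E {1..p} A \<in> sets (plborel {1..p})"
    by (intro sets_PiM_I_finite A finite_atLeastAtMost)
  have S: "S \<in> sets (plborel {1..p})"
    unfolding S_def by (rule measurable_sets[OF measurable_shear PA])
  have slice: "indicator S (x(1 := y)) = (indicator (uminus -` A 1) y * indicator (Pi\<^sub>E J (\<lambda>i. (\<lambda>z. z - y) -` A i)) x :: ennreal)"
    if x: "x \<in> extensional J" for x y
  proof -
    let ?z = "shear p (x(1 := y))"
    have ext: "x(1 := y) \<in> extensional {1..p}"
      unfolding I using x by (auto simp: extensional_def)
    have v1: "?z 1 = - y" using assms by (simp add: shear_def)
    have vi: "?z i = x i - y" if "i \<in> J" for i
      using that by (auto simp: shear_def J_def)
    have "?z \<in> extensional {1..p}" by (simp add: shear_def)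
    then have "?z \<in> Pi\<^sub>E {1..p} A \<longleftrightarrow> (\<forall>i\<in>insert 1 J. ?z i \<in> A i)"
      unfolding PiE_iff I by blast
    also have "\<dots> \<longleftrightarrow> - y \<in> A 1 \<and> (\<forall>i\<in>J. x i - y \<in> A i)"
      by (simp add: v1[simplified] vi[simplified])
    finally have "x(1 := y) \<in> S \<longleftrightarrow> - y \<in> A 1 \<and> (\<forall>i\<in>J. x i - y \<in> A i)"
      using ext unfolding S_def space_plborel by blast
    moreover have "x \<in> Pi\<^sub>E J (\<lambda>i. (\<lambda>z. z - y) -` A i) \<longleftrightarrow> (\<forall>i\<in>J. x i - y \<in> A i)"
      using x by (auto simp: PiE_iff)
    ultimately show ?thesis by (simp add: indicator_def)
  qed
  have "emeasure (distr (plborel {1..p}) (plborel {1..p}) (shear p)) (Pi\<^sub>E {1..p} A) = emeasure (plborel {1..p}) S"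
    unfolding S_def by (rule emeasure_distr[OF measurable_shear PA])
  also have "\<dots> = (\<integral>\<^sup>+x. indicator S x \<partial>plborel (insert 1 J))"
    using S unfolding I by simp
  also have "\<dots> = (\<integral>\<^sup>+y. (\<integral>\<^sup>+x. indicator S (x(1 := y)) \<partial>plborel J) \<partial>lborel)"
    using S unfolding I by (intro lborel_product.product_nn_integral_insert_rev J) auto
  also have "\<dots> = (\<integral>\<^sup>+y. indicator (uminus -` A 1) y * (\<Prod>i\<in>J. emeasure lborel (A i)) \<partial>lborel)"
  proof (rule nn_integral_cong)
    fix y :: 'a
    have meas: "(\<lambda>z. z - y) -` A i \<in> sets lborel" if "i \<in> J" for i
    proof -
      have "(\<lambda>z. z - y) \<in> measurable lborel borel" by simp
      from measurable_sets[OF this AJ[OF that]] show ?thesis by simp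
    qed
    have P: "Pi\<^sub>E J (\<lambda>i. (\<lambda>z. z - y) -` A i) \<in> sets (plborel J)"
      using meas J(1) by (intro sets_PiM_I_finite) auto
    have "(\<integral>\<^sup>+x. indicator S (x(1 := y)) \<partial>plborel J)
      = (\<integral>\<^sup>+x. indicator (uminus -` A 1) y * indicator (Pi\<^sub>E J (\<lambda>i. (\<lambda>z. z - y) -` A i)) x \<partial>plborel J)"
      by (intro nn_integral_cong slice) (simp add: space_plborel)
    also have "\<dots> = indicator (uminus -` A 1) y * emeasure (plborel J) (Pi\<^sub>E J (\<lambda>i. (\<lambda>z. z - y) -` A i))"
      using P by (simp add: nn_integral_cmult)
    also have "emeasure (plborel J) (Pi\<^sub>E J (\<lambda>i. (\<lambda>z. z - y) -` A i)) = (\<Prod>i\<in>J. emeasure lborel ((\<lambda>z. z - y) -` A i))"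
      using meas J(1) by (intro lborel_product.emeasure_PiM) auto
    also have "\<dots> = (\<Prod>i\<in>J. emeasure lborel (A i))"
      by (intro prod.cong refl emeasure_lborel_translate AJ)
    finally show "(\<integral>\<^sup>+x. indicator S (x(1 := y)) \<partial>plborel J)
      = indicator (uminus -` A 1) y * (\<Prod>i\<in>J. emeasure lborel (A i))" .
  qed
  also have "\<dots> = emeasure lborel (uminus -` A 1) * (\<Prod>i\<in>J. emeasure lborel (A i))"
  proof -
    have "(uminus :: 'a \<Rightarrow> 'a) \<in> measurable lborel borel" by simp
    from measurable_sets[OF this A1] have "uminus -` A 1 \<in> sets lborel" by simp
    then show ?thesis by (simp add: nn_integral_multc)
  qed
  also have "\<dots> = (\<Prod>i\<in>{1..p}. emeasure lborel (A i))"
    unfolding I by (simp only: prod.insert[OF J(1,2)] emeasure_lborel_reflect[OF A1])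
  finally show "emeasure (distr (plborel {1..p}) (plborel {1..p}) (shear p)) (Pi\<^sub>E {1..p} A)
    = (\<Prod>i\<in>{1..p}. emeasure lborel (A i))" .
qed simp_all

text \<open>The volume is symmetric in \<open>t\<^sub>0, \<dots>, t\<^sub>p\<close>, since a measure preserving shear exchanges the
  diagonal with the first factor.\<close>

lemma pvol_dbody_swap:
  fixes K :: "(real ^ 'n) set"
  assumes p: "p \<ge> 1" and K: "compact K"
  shows "pvol p (dbody p (\<lambda>l. if l = 0 then t 1 else if l = 1 then t 0 else t l) K) = pvol p (dbody p t K)"
    (is "pvol p (dbody p ?t K) = _")
proof -
  have sub: "shear p x \<in> dbody p (\<lambda>l. if l = 0 then s 1 else if l = 1 then s 0 else s l) K"
    if x: "x \<in> dbody p s K" for x s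
  proof -
    obtain y where x: "x = (\<lambda>i\<in>{1..p}. s i *\<^sub>R y i - s 0 *\<^sub>R y 0)" and y: "\<forall>l\<le>p. y l \<in> K"
      using x unfolding dbody_def by blast
    let ?y = "\<lambda>l. if l = 0 then y 1 else if l = 1 then y 0 else y l"
    have "shear p x = (\<lambda>i\<in>{1..p}. (if i = 0 then s 1 else if i = 1 then s 0 else s i) *\<^sub>R ?y i
        - (if (0::nat) = 0 then s 1 else if (0::nat) = 1 then s 0 else s 0) *\<^sub>R ?y 0)"
      unfolding shear_def x using p by (intro restrict_ext) auto
    moreover have "\<forall>l\<le>p. ?y l \<in> K" using y p by auto
    ultimately show ?thesis unfolding dbody_def by (intro CollectI exI[of _ ?y] conjI)
  qed
  have inv: "shear p (shear p x) = x" if "x \<in> extensional {1..p}" for x :: "nat \<Rightarrow> real ^ 'n"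
    using that p by (intro extensionalityI[of _ "{1..p}"]) (auto simp: shear_def)
  have pre: "shear p -` dbody p ?t K \<inter> space (plborel {1..p}) = dbody p t K"
  proof (intro set_eqI iffI)
    fix x assume "x \<in> shear p -` dbody p ?t K \<inter> space (plborel {1..p})"
    then have x: "shear p x \<in> dbody p ?t K" "x \<in> extensional {1..p}" by simp_all
    have "(\<lambda>l. if l = 0 then ?t 1 else if l = 1 then ?t 0 else ?t l) = t" by auto
    with sub[OF x(1)] show "x \<in> dbody p t K" by (simp only: inv[OF x(2)])
  next
    fix x assume x: "x \<in> dbody p t K"
    from sub[OF this] subsetD[OF dbody_extensional this]
    show "x \<in> shear p -` dbody p ?t K \<inter> space (plborel {1..p})" by simp
  qed
  have "pvol p (dbody p ?t K) = measure (distr (plborel {1..p}) (plborel {1..p}) (shear p)) (dbody p ?t K)"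
    unfolding distr_shear[OF p] pvol_eq ..
  also have "\<dots> = pvol p (dbody p t K)"
    unfolding measure_distr[OF measurable_shear dbody_sets[OF K]] pre pvol_eq ..
  finally show ?thesis .
qed

section \<open>Slices in the direction of one factor\<close>

lemma convex_affine_vimage:
  "convex S \<Longrightarrow> convex ((\<lambda>z. a + c *\<^sub>R z) -` (S :: 'a::real_vector set))"
proof (rule convexI)
  fix x y and u v :: real
  assume S: "convex S" and xy: "x \<in> (\<lambda>z. a + c *\<^sub>R z) -` S" "y \<in> (\<lambda>z. a + c *\<^sub>R z) -` S"
    and uv: "0 \<le> u" "0 \<le> v" "u + v = 1"
  have "u *\<^sub>R (a + c *\<^sub>R x) + v *\<^sub>R (a + c *\<^sub>R y) = (u + v) *\<^sub>R a + c *\<^sub>R (u *\<^sub>R x + v *\<^sub>R y)"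
    by (simp add: algebra_simps)
  then show "u *\<^sub>R x + v *\<^sub>R y \<in> (\<lambda>z. a + c *\<^sub>R z) -` S"
    using convexD[OF S, of "a + c *\<^sub>R x" "a + c *\<^sub>R y" u v] xy uv by simp
qed

text \<open>Once the coordinates other than l are fixed to y, this is the set of admissible values
  of - t 0 z for the shared point z. It does not contain t l, so the slices have the form A + t l
  K.\<close>

definition fibre :: "nat \<Rightarrow> nat \<Rightarrow> (nat \<Rightarrow> real) \<Rightarrow> (real ^ 'n) set \<Rightarrow> (nat \<Rightarrow> real ^ 'n) \<Rightarrow> (real ^ 'n) set" where
  "fibre p l t K y = (\<lambda>z. - (t 0 *\<^sub>R z)) `
     (K \<inter> (\<Inter>i\<in>{1..p} - {l}. (\<lambda>z. y i + t 0 *\<^sub>R z) -` ((*\<^sub>R) (t i) ` K)))"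

lemma compact_fibre: "compact K \<Longrightarrow> compact (fibre p l t K y)"
  unfolding fibre_def
  by (intro compact_continuous_image compact_Int_closed closed_INT ballI closed_vimage
      compact_imp_closed compact_scaling) (auto intro!: continuous_intros)

lemma convex_fibre:
  assumes "convex K"
  shows "convex (fibre p l t K y)"
proof -
  have "linear (\<lambda>z. - (t 0 *\<^sub>R z) :: real ^ 'n)"
    by (rule linearI) (simp_all add: scaleR_add_right)
  then show ?thesis
    unfolding fibre_def using assms
    by (intro convex_linear_image convex_Int convex_INT convex_affine_vimage convex_scaling) auto
qed

lemma dbody_slice:
  assumes l: "l \<in> {1..p}" and y: "y \<in> extensional ({1..p} - {l})"
  shows "{x. y(l := x) \<in> dbody p t K} = msum (fibre p l t K y) (t l) K"
proof (intro set_eqI iffI)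
  fix x assume "x \<in> {x. y(l := x) \<in> dbody p t K}"
  then obtain v where eq: "y(l := x) = (\<lambda>i\<in>{1..p}. t i *\<^sub>R v i - t 0 *\<^sub>R v 0)" and v: "\<forall>l\<le>p. v l \<in> K"
    unfolding dbody_def by blast
  have x: "x = - (t 0 *\<^sub>R v 0) + t l *\<^sub>R v l"
    using fun_cong[OF eq, of l] l by simp
  have "y i + t 0 *\<^sub>R v 0 = t i *\<^sub>R v i" if "i \<in> {1..p} - {l}" for i
    using fun_cong[OF eq, of i] that by simp
  with v have "- (t 0 *\<^sub>R v 0) \<in> fibre p l t K y"
    unfolding fibre_def by (intro imageI) auto
  moreover have "v l \<in> K" using v l by simp
  ultimately show "x \<in> msum (fibre p l t K y) (t l) K"
    unfolding msum_def x by blast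
next
  fix x assume "x \<in> msum (fibre p l t K y) (t l) K"
  then obtain a u where au: "x = a + t l *\<^sub>R u" "a \<in> fibre p l t K y" "u \<in> K"
    unfolding msum_def by blast
  then obtain z where az: "a = - (t 0 *\<^sub>R z)" "z \<in> K"
      "\<forall>i\<in>{1..p} - {l}. y i + t 0 *\<^sub>R z \<in> (*\<^sub>R) (t i) ` K"
    unfolding fibre_def by blast
  have x: "x = - (t 0 *\<^sub>R z) + t l *\<^sub>R u" and "z \<in> K" "u \<in> K"
    using au az by auto
  have z: "\<forall>i\<in>{1..p} - {l}. \<exists>w\<in>K. y i + t 0 *\<^sub>R z = t i *\<^sub>R w"
    using az(3) unfolding image_iff .
  from bchoice[OF z[unfolded Bex_def]]
  obtain w where w: "\<forall>i\<in>{1..p} - {l}. w i \<in> K \<and> y i + t 0 *\<^sub>R z = t i *\<^sub>R w i" by blast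
  let ?v = "\<lambda>i. if i = 0 then z else if i = l then u else w i"
  have "y(l := x) = (\<lambda>i\<in>{1..p}. t i *\<^sub>R ?v i - t 0 *\<^sub>R ?v 0)"
  proof
    fix i
    consider "i = l" | "i \<in> {1..p} - {l}" | "i \<notin> {1..p}" "i \<noteq> l" by blast
    then show "(y(l := x)) i = (\<lambda>i\<in>{1..p}. t i *\<^sub>R ?v i - t 0 *\<^sub>R ?v 0) i"
    proof cases
      case 1
      then show ?thesis using l x by simp
    next
      case 2
      then have "y i = t i *\<^sub>R w i - t 0 *\<^sub>R z" using w by (simp add: eq_diff_eq)
      then show ?thesis using 2 by simp
    next
      case 3
      then show ?thesis using y by (auto simp: extensional_def)
    qed
  qed
  moreover have "\<forall>i\<le>p. ?v i \<in> K" using w \<open>z \<in> K\<close> \<open>u \<in> K\<close> by auto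
  ultimately show "x \<in> {x. y(l := x) \<in> dbody p t K}"
    unfolding dbody_def by (intro CollectI exI[of _ ?v] conjI)
qed

lemma interpolates_integral:
  assumes int: "\<And>\<tau>. \<tau> \<ge> 0 \<Longrightarrow> integrable M (g \<tau>)"
    and interp: "\<And>y. y \<in> space M \<Longrightarrow> interpolates n (\<lambda>\<tau>. g \<tau> y)"
  shows "interpolates n (\<lambda>\<tau>. \<integral>y. g \<tau> y \<partial>M)"
  unfolding interpolates_def
proof (intro allI impI)
  fix t :: real assume t: "t \<ge> 0"
  have "(\<integral>y. g t y \<partial>M) = (\<integral>y. (\<Sum>a\<le>n. g (real a) y * poly (lagrange n a) t) \<partial>M)"
    by (intro Bochner_Integration.integral_cong refl interp[unfolded interpolates_def, rule_format, OF _ t])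
  also have "\<dots> = (\<Sum>a\<le>n. (\<integral>y. g (real a) y * poly (lagrange n a) t \<partial>M))"
    by (intro Bochner_Integration.integral_sum integrable_mult_left int) simp
  also have "\<dots> = (\<Sum>a\<le>n. (\<integral>y. g (real a) y \<partial>M) * poly (lagrange n a) t)"
    by simp
  finally show "(\<integral>y. g t y \<partial>M) = (\<Sum>a\<le>n. (\<integral>y. g (real a) y \<partial>M) * poly (lagrange n a) t)" .
qed

text \<open>Fubini: the volume is the integral of the slice volumes over the other coordinates, each
  slice being a sum of the fixed fibre and a multiple of K.\<close>

lemma interpolates_pvol_factor:
  fixes K :: "(real ^ 'n) set"
  assumes K: "compact K" "convex K" and l: "l \<in> {1..p}"
  shows "interpolates CARD('n) (\<lambda>\<tau>. pvol p (dbody p (t(l := \<tau>)) K))"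
proof -
  define J where "J = {1..p} - {l}"
  have I: "{1..p} = insert l J" and J: "finite J" "l \<notin> J"
    using l by (auto simp: J_def)
  define g where "g \<tau> y = measure lborel (msum (fibre p l t K y) \<tau> K)" for \<tau> y
  have comp: "compact (msum (fibre p l t K y) \<tau> K)" for y \<tau>
    by (intro compact_msum compact_fibre K)
  have slice: "(\<integral>\<^sup>+x. indicator (dbody p (t(l := \<tau>)) K) (y(l := x)) \<partial>lborel) = ennreal (g \<tau> y)"
    if "y \<in> extensional J" for y \<tau>
  proof -
    have fib: "fibre p l (t(l := \<tau>)) K y = fibre p l t K y"
      using l unfolding fibre_def by (auto intro!: image_cong INF_cong)
    have "(\<integral>\<^sup>+x. indicator (dbody p (t(l := \<tau>)) K) (y(l := x)) \<partial>lborel)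
      = (\<integral>\<^sup>+x. indicator (msum (fibre p l t K y) \<tau> K) x \<partial>lborel)"
      using dbody_slice[OF l, of y "t(l := \<tau>)" K] that fib
      by (intro nn_integral_cong) (auto simp: indicator_def J_def)
    also have "\<dots> = emeasure lborel (msum (fibre p l t K y) \<tau> K)"
      using borel_compact[OF comp] by simp
    also have "\<dots> = ennreal (g \<tau> y)"
      unfolding g_def using emeasure_compact_finite[OF comp, of y \<tau>]
      by (intro emeasure_eq_ennreal_measure) auto
    finally show ?thesis .
  qed
  have sets: "dbody p (t(l := \<tau>)) K \<in> sets (plborel (insert l J))" for \<tau>
    by (rule dbody_sets[OF K(1), of p "t(l := \<tau>)", unfolded I])
  have meas: "(\<lambda>y. ennreal (g \<tau> y)) \<in> borel_measurable (plborel J)" for \<tau>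
  proof -
    have "(\<lambda>z. indicator (dbody p (t(l := \<tau>)) K) ((fst z)(l := snd z)) :: ennreal) \<in> borel_measurable (plborel J \<Otimes>\<^sub>M lborel)"
    proof -
      have "(\<lambda>z. (fst z)(l := snd z)) \<in> measurable (plborel J \<Otimes>\<^sub>M lborel) (plborel (insert l J) :: (nat \<Rightarrow> real ^ 'n) measure)"
        using measurable_add_dim[of l J "\<lambda>_. lborel"] by (simp add: split_beta)
      then show ?thesis
        by (rule measurable_compose) (rule borel_measurable_indicator[OF sets])
    qed
    then have "(\<lambda>y. \<integral>\<^sup>+x. indicator (dbody p (t(l := \<tau>)) K) (y(l := x)) \<partial>lborel) \<in> borel_measurable (plborel J)"
      by (intro lborel.borel_measurable_nn_integral) (simp add: split_beta')
    then show ?thesis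
      by (rule measurable_cong[THEN iffD1, rotated]) (simp add: slice)
  qed
  have total: "(\<integral>\<^sup>+y. ennreal (g \<tau> y) \<partial>plborel J) = ennreal (pvol p (dbody p (t(l := \<tau>)) K))" for \<tau>
  proof -
    have "ennreal (pvol p (dbody p (t(l := \<tau>)) K)) = (\<integral>\<^sup>+x. indicator (dbody p (t(l := \<tau>)) K) x \<partial>plborel (insert l J))"
      unfolding emeasure_dbody[OF K(1), symmetric] using sets I by simp
    also have "\<dots> = (\<integral>\<^sup>+y. (\<integral>\<^sup>+x. indicator (dbody p (t(l := \<tau>)) K) (y(l := x)) \<partial>lborel) \<partial>plborel J)"
      by (intro lborel_product.product_nn_integral_insert J borel_measurable_indicator sets)
    also have "\<dots> = (\<integral>\<^sup>+y. ennreal (g \<tau> y) \<partial>plborel J)"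
      by (intro nn_integral_cong slice) simp
    finally show ?thesis by simp
  qed
  have gnn: "g \<tau> y \<ge> 0" for \<tau> y by (simp add: g_def)
  have gmeas: "g \<tau> \<in> borel_measurable (plborel J)" for \<tau>
    using borel_measurable_enn2real[OF meas[of \<tau>]] gnn by simp
  have int: "integrable (plborel J) (g \<tau>)" for \<tau>
    by (rule integrableI_nonneg[OF gmeas]) (auto simp: gnn total)
  have "(\<integral>y. g \<tau> y \<partial>plborel J) = pvol p (dbody p (t(l := \<tau>)) K)" for \<tau>
    using nn_integral_eq_integral[OF int[of \<tau>]] total[of \<tau>] gnn
    by (simp add: pvol_eq)
  moreover have "interpolates CARD('n) (\<lambda>\<tau>. \<integral>y. g \<tau> y \<partial>plborel J)"
    unfolding g_def
    by (intro interpolates_integral int[unfolded g_def] interpolates_measure_msum compact_fibre convex_fibre K)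
  ultimately show ?thesis by simp
qed

text \<open>No coordinate isolates t 0, so this case is reduced to the parameter of the first factor
  by \<open>pvol_dbody_swap\<close>.\<close>

lemma interpolates_pvol:
  fixes K :: "(real ^ 'n) set"
  assumes K: "compact K" "convex K" and p: "p \<ge> 1" and l: "l \<le> p"
  shows "interpolates CARD('n) (\<lambda>\<tau>. pvol p (dbody p (t(l := \<tau>)) K))"
proof (cases "l = 0")
  case True
  let ?s = "\<lambda>l. if l = 0 then t 1 else if l = 1 then t 0 else t l"
  have "pvol p (dbody p (t(0 := \<tau>)) K) = pvol p (dbody p (?s(1 := \<tau>)) K)" for \<tau>
  proof -
    have "(\<lambda>l. if l = 0 then (t(0 := \<tau>)) 1 else if l = 1 then (t(0 := \<tau>)) 0 else (t(0 := \<tau>)) l) = ?s(1 := \<tau>)"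
      by (auto simp: fun_eq_iff)
    then show ?thesis using pvol_dbody_swap[OF p K(1), of "t(0 := \<tau>)"] by (simp only:)
  qed
  moreover have "interpolates CARD('n) (\<lambda>\<tau>. pvol p (dbody p (?s(1 := \<tau>)) K))"
    by (rule interpolates_pvol_factor[OF K]) (use p in simp)
  ultimately show ?thesis unfolding True by (simp only:)
qed (use interpolates_pvol_factor[OF K] l in auto)

section \<open>Polynomials in several variables and their one-sided derivatives\<close>

text \<open>Tensor product interpolation: one variable after another is replaced by its
  nodes.\<close>

lemma interpolates_iterate:
  fixes F :: "('i \<Rightarrow> real) \<Rightarrow> real"
  assumes interp: "\<And>l t. l \<in> I \<Longrightarrow> interpolates n (\<lambda>\<tau>. F (t(l := \<tau>)))"
    and fin: "finite I" and t: "\<And>l. l \<in> I \<Longrightarrow> t l \<ge> (0::real)"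
  shows "F t = (\<Sum>a\<in>Pi\<^sub>E I (\<lambda>_. {..n}). F (\<lambda>l. if l \<in> I then real (a l) else t l) *
    (\<Prod>l\<in>I. poly (lagrange n (a l)) (t l)))"
  using fin interp t
proof (induction I arbitrary: t rule: finite_induct)
  case empty
  then show ?case by simp
next
  case (insert m I)
  let ?P = "Pi\<^sub>E I (\<lambda>_. {..n})"
  have "F t = F (t(m := t m))" by simp
  also have "\<dots> = (\<Sum>b\<le>n. F (t(m := real b)) * poly (lagrange n b) (t m))"
    using insert.prems(1)[of m t] insert.prems(2)[of m] unfolding interpolates_def by blast
  also have "\<dots> = (\<Sum>b\<le>n. \<Sum>a\<in>?P. F (\<lambda>l. if l \<in> insert m I then real ((a(m := b)) l) else t l) *
      (\<Prod>l\<in>insert m I. poly (lagrange n ((a(m := b)) l)) (t l)))"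
  proof (rule sum.cong[OF refl])
    fix b assume "b \<in> {..n}"
    have "F (t(m := real b)) = (\<Sum>a\<in>?P. F (\<lambda>l. if l \<in> I then real (a l) else (t(m := real b)) l) *
        (\<Prod>l\<in>I. poly (lagrange n (a l)) ((t(m := real b)) l)))"
      using insert.prems insert.hyps by (intro insert.IH) auto
    also have "\<dots> = (\<Sum>a\<in>?P. F (\<lambda>l. if l \<in> insert m I then real ((a(m := b)) l) else t l) *
        (\<Prod>l\<in>I. poly (lagrange n ((a(m := b)) l)) (t l)))"
      using insert.hyps
      by (intro sum.cong refl arg_cong2[where f = "(*)"] arg_cong[where f = F] ext prod.cong) auto
    finally have "F (t(m := real b)) = \<dots>" .
    then show "F (t(m := real b)) * poly (lagrange n b) (t m) =
      (\<Sum>a\<in>?P. F (\<lambda>l. if l \<in> insert m I then real ((a(m := b)) l) else t l) *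
      (\<Prod>l\<in>insert m I. poly (lagrange n ((a(m := b)) l)) (t l)))"
      using insert.hyps by (simp add: sum_distrib_left mult_ac)
  qed
  also have "\<dots> = (\<Sum>(b, a)\<in>{..n} \<times> ?P. F (\<lambda>l. if l \<in> insert m I then real ((a(m := b)) l) else t l) *
      (\<Prod>l\<in>insert m I. poly (lagrange n ((a(m := b)) l)) (t l)))"
    by (rule sum.cartesian_product)
  also have "\<dots> = (\<Sum>a\<in>Pi\<^sub>E (insert m I) (\<lambda>_. {..n}). F (\<lambda>l. if l \<in> insert m I then real (a l) else t l) *
      (\<Prod>l\<in>insert m I. poly (lagrange n (a l)) (t l)))"
    unfolding PiE_insert_eq
    by (subst sum.reindex[OF inj_combinator[OF insert.hyps(2)]]) (auto intro!: sum.cong)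
  finally show ?case .
qed

lemma poly_eq_sum_coeff:
  fixes q :: "real poly"
  assumes "degree q \<le> n"
  shows "poly q x = (\<Sum>i\<le>n. coeff q i * x ^ i)"
  unfolding poly_altdef using assms
  by (intro sum.mono_neutral_left) (auto simp: coeff_eq_0)

text \<open>Expanding the Lagrange polynomials in the interpolation formula gives the coefficients.
  The assumption \<open>local\<close> removes the influence of arguments beyond p.\<close>

lemma separate_interpolates_imp_polynomial:
  fixes F :: "(nat \<Rightarrow> real) \<Rightarrow> real"
  assumes interp: "\<And>l t. l \<le> p \<Longrightarrow> interpolates n (\<lambda>\<tau>. F (t(l := \<tau>)))"
    and local: "\<And>t t'. (\<And>l. l \<le> p \<Longrightarrow> t l = t' l) \<Longrightarrow> F t = F t'"
  obtains c where "\<And>t. (\<And>l. l \<le> p \<Longrightarrow> t l \<ge> (0::real)) \<Longrightarrow>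
    F t = (\<Sum>i\<in>Pi\<^sub>E {..p} (\<lambda>_. {..n}). c i * (\<Prod>l\<le>p. t l ^ i l))"
proof
  let ?P = "Pi\<^sub>E {..p} (\<lambda>_. {..n})"
  define G where "G a = F (\<lambda>l. real (a l))" for a
  fix t :: "nat \<Rightarrow> real" assume t: "\<And>l. l \<le> p \<Longrightarrow> t l \<ge> 0"
  have "F t = (\<Sum>a\<in>?P. F (\<lambda>l. if l \<in> {..p} then real (a l) else t l) * (\<Prod>l\<le>p. poly (lagrange n (a l)) (t l)))"
  proof (rule interpolates_iterate)
    show "interpolates n (\<lambda>\<tau>. F (s(l := \<tau>)))" if "l \<in> {..p}" for l s
      by (rule interp) (use that in simp)
  qed (use t in auto)
  also have "\<dots> = (\<Sum>a\<in>?P. \<Sum>i\<in>?P. G a * (\<Prod>l\<le>p. coeff (lagrange n (a l)) (i l)) * (\<Prod>l\<le>p. t l ^ i l))"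
  proof (rule sum.cong[OF refl])
    fix a assume a: "a \<in> ?P"
    have "F (\<lambda>l. if l \<in> {..p} then real (a l) else t l) = G a"
      unfolding G_def by (rule local) simp
    moreover have "(\<Prod>l\<le>p. poly (lagrange n (a l)) (t l)) = (\<Prod>l\<le>p. \<Sum>i\<le>n. coeff (lagrange n (a l)) i * t l ^ i)"
      using a by (intro prod.cong refl poly_eq_sum_coeff degree_lagrange) auto
    ultimately show "F (\<lambda>l. if l \<in> {..p} then real (a l) else t l) * (\<Prod>l\<le>p. poly (lagrange n (a l)) (t l)) =
        (\<Sum>i\<in>?P. G a * (\<Prod>l\<le>p. coeff (lagrange n (a l)) (i l)) * (\<Prod>l\<le>p. t l ^ i l))"
      by (simp add: prod_sum_PiE prod.distrib sum_distrib_left mult_ac)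
  qed
  also have "\<dots> = (\<Sum>i\<in>?P. (\<Sum>a\<in>?P. G a * (\<Prod>l\<le>p. coeff (lagrange n (a l)) (i l))) * (\<Prod>l\<le>p. t l ^ i l))"
    by (subst sum.swap) (simp add: sum_distrib_right)
  finally show "F t = (\<Sum>i\<in>?P. (\<Sum>a\<in>?P. F (\<lambda>l. real (a l)) * (\<Prod>l\<le>p. coeff (lagrange n (a l)) (i l))) * (\<Prod>l\<le>p. t l ^ i l))"
    by (simp only: G_def)
qed

text \<open>Both sides are polynomials in x that agree at infinitely many points; compare the
  coefficients of x^N.\<close>

lemma homogeneous_part:
  fixes d :: "'i \<Rightarrow> real"
  assumes fin: "finite E" and eq: "\<And>x. x > 0 \<Longrightarrow> (\<Sum>i\<in>E. d i * x ^ deg i) = x ^ N * v"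
  shows "v = (\<Sum>i | i \<in> E \<and> deg i = N. d i)"
proof -
  define P where "P = (\<Sum>i\<in>E. monom (d i) (deg i)) - monom v N"
  have "{0::real<..} \<subseteq> {x. poly P x = 0}"
    using eq by (auto simp: P_def poly_sum poly_monom mult.commute)
  moreover have "infinite {0::real<..}" by (rule infinite_Ioi)
  ultimately have "P = 0"
    using poly_roots_finite finite_subset by blast
  then have "coeff P N = 0" by simp
  then have "v = (\<Sum>i\<in>E. if deg i = N then d i else 0)"
    by (simp add: P_def coeff_sum)
  then show ?thesis using fin by (simp add: sum.inter_filter)
qed

lemma multi_indices_le: "j \<in> multi_indices n p \<Longrightarrow> l \<le> p \<Longrightarrow> j l \<le> n"
proof -
  assume j: "j \<in> multi_indices n p" and l: "l \<le> p"
  have "j l \<le> (\<Sum>l\<le>p. j l)" using l by (intro member_le_sum) auto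
  with j show ?thesis by (simp add: multi_indices_def)
qed

lemma sum_multi_indices_complement:
  assumes "j \<in> multi_indices n p"
  shows "(\<Sum>l\<le>p. n - j l) = n * p"
proof -
  have "(\<Sum>l\<le>p. n - j l) = (\<Sum>l\<le>p. n) - (\<Sum>l\<le>p. j l)"
    using multi_indices_le[OF assms] by (intro sum_subtractf_nat) auto
  then show ?thesis using assms by (simp add: multi_indices_def algebra_simps)
qed

text \<open>Homogeneity keeps the exponents i with sum n * p. There are p + 1 exponents, each at
  most n, so the deficits n - i l sum to n; taking deficits is the involution \<open>?co\<close>
  between both index sets.\<close>

theorem homogeneous_interpolates_imp_polynomial:
  fixes F :: "(nat \<Rightarrow> real) \<Rightarrow> real"
  assumes interp: "\<And>l t. l \<le> p \<Longrightarrow> interpolates n (\<lambda>\<tau>. F (t(l := \<tau>)))"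
    and local: "\<And>t t'. (\<And>l. l \<le> p \<Longrightarrow> t l = t' l) \<Longrightarrow> F t = F t'"
    and homog: "\<And>t c. c > 0 \<Longrightarrow> F (\<lambda>l. c * t l) = c ^ (n * p) * F t"
  obtains c where "\<And>t. (\<And>l. l \<le> p \<Longrightarrow> t l \<ge> (0::real)) \<Longrightarrow>
    F t = (\<Sum>j\<in>multi_indices n p. c j * (\<Prod>l\<le>p. t l ^ (n - j l)))"
proof -
  obtain c where c: "\<And>t. (\<And>l. l \<le> p \<Longrightarrow> t l \<ge> (0::real)) \<Longrightarrow>
    F t = (\<Sum>i\<in>Pi\<^sub>E {..p} (\<lambda>_. {..n}). c i * (\<Prod>l\<le>p. t l ^ i l))"
    using separate_interpolates_imp_polynomial[OF interp local] by blast
  let ?E = "Pi\<^sub>E {..p} (\<lambda>_. {..n})"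
  let ?co = "\<lambda>j. \<lambda>l\<in>{..p}. n - j l"
  have key: "F t = (\<Sum>j\<in>multi_indices n p. c (?co j) * (\<Prod>l\<le>p. t l ^ (n - j l)))"
    if t: "\<And>l. l \<le> p \<Longrightarrow> t l \<ge> 0" for t
  proof -
    have "(\<Sum>i\<in>?E. (c i * (\<Prod>l\<le>p. t l ^ i l)) * x ^ (\<Sum>l\<le>p. i l)) = x ^ (n * p) * F t" if x: "x > 0" for x
    proof -
      have "x ^ (n * p) * F t = F (\<lambda>l. x * t l)" using homog[OF x] by simp
      also have "\<dots> = (\<Sum>i\<in>?E. c i * (\<Prod>l\<le>p. (x * t l) ^ i l))"
        using t x by (intro c) simp
      also have "\<dots> = (\<Sum>i\<in>?E. (c i * (\<Prod>l\<le>p. t l ^ i l)) * x ^ (\<Sum>l\<le>p. i l))"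
        by (intro sum.cong refl) (simp add: power_mult_distrib prod.distrib power_sum)
      finally show ?thesis by simp
    qed
    then have "F t = (\<Sum>i | i \<in> ?E \<and> (\<Sum>l\<le>p. i l) = n * p. c i * (\<Prod>l\<le>p. t l ^ i l))"
      by (intro homogeneous_part finite_PiE) auto
    also have "\<dots> = (\<Sum>j\<in>multi_indices n p. c (?co j) * (\<Prod>l\<le>p. t l ^ (n - j l)))"
    proof (rule sum.reindex_bij_witness[where i = ?co and j = ?co])
      fix i assume i: "i \<in> {i. i \<in> ?E \<and> (\<Sum>l\<le>p. i l) = n * p}"
      then have ile: "i l \<le> n" if "l \<le> p" for l using that by auto
      show ii: "?co (?co i) = i"
        using i ile by (intro extensionalityI[of _ "{..p}"]) (auto simp: PiE_def)
      have "(\<Sum>l\<le>p. n - i l) = (\<Sum>l\<le>p. n) - (\<Sum>l\<le>p. i l)"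
        using ile by (intro sum_subtractf_nat) auto
      then show "?co i \<in> multi_indices n p"
        using i by (simp add: multi_indices_def algebra_simps)
      show "c (?co (?co i)) * (\<Prod>l\<le>p. t l ^ (n - ?co i l)) = c i * (\<Prod>l\<le>p. t l ^ i l)"
        unfolding ii using ile by (intro arg_cong2[where f = "(*)"] refl prod.cong) auto
    next
      fix j assume j: "j \<in> multi_indices n p"
      then show "?co (?co j) = j"
        using multi_indices_le[OF j] by (intro extensionalityI[of _ "{..p}"]) (auto simp: multi_indices_def PiE_def)
      show "?co j \<in> {i. i \<in> ?E \<and> (\<Sum>l\<le>p. i l) = n * p}"
        using sum_multi_indices_complement[OF j] by auto
    qed
    finally show ?thesis .
  qed
  show ?thesis by (rule that[of "\<lambda>j. c (?co j)"]) (rule key)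
qed

section \<open>Iterated one-sided derivatives at the origin\<close>

definition falling :: "nat \<Rightarrow> nat \<Rightarrow> real" where
  "falling m k = (\<Prod>r<k. real m - real r)"

lemma falling_Suc: "falling m (Suc k) = falling m k * (real m - real k)"
  by (simp add: falling_def)

lemma falling_0 [simp]: "falling m 0 = 1"
  by (simp add: falling_def)

lemma falling_eq_0: "m < k \<Longrightarrow> falling m k = 0"
  unfolding falling_def by (intro prod_zero) auto

lemma falling_self: "falling m m = fact m"
proof -
  have "falling m k * fact (m - k) = fact m" if "k \<le> m" for k
    using that
  proof (induction k)
    case (Suc k)
    have "fact (m - k) = (real m - real k) * fact (m - Suc k)"
      using Suc.prems fact_reduce[of "m - k", where 'a = real] by (simp add: of_nat_diff)
    then show ?case using Suc by (simp add: falling_Suc mult.assoc)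
  qed simp
  from this[of m] show ?thesis by simp
qed

text \<open>Truncated subtraction is harmless here: once k exceeds m, the falling factorial is
  0.\<close>

lemma falling_Suc_mult: "falling m k * real (m - k) = falling m (Suc k)"
  by (cases "m < k") (auto simp: falling_Suc falling_eq_0 of_nat_diff)

text \<open>The function f need only agree with the differentiable h for nonnegative values of the
  coordinate. The one-sided derivative is well defined because s i is a limit point of the
  half-line.\<close>

lemma orthant_partial_eq:
  assumes "(h has_real_derivative d) (at (s i))" and "s i \<ge> 0" and "\<And>u. u \<ge> 0 \<Longrightarrow> f (s(i := u)) = h u"
  shows "orthant_partial i f s = d"
  unfolding orthant_partial_def
proof (rule vector_derivative_within)
  have "s i islimpt {0..}"
    unfolding islimpt_approachable
  proof (intro allI impI)
    fix e :: real assume "e > 0"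
    then show "\<exists>x'\<in>{0..}. x' \<noteq> s i \<and> dist x' (s i) < e"
      using assms(2) by (intro bexI[of _ "s i + e / 2"]) (auto simp: dist_real_def)
  qed
  then show "at (s i) within {0..} \<noteq> bot"
    by (simp add: trivial_limit_within)
  have "(h has_vector_derivative d) (at (s i) within {0..})"
    using assms(1) by (simp add: has_real_derivative_iff_has_vector_derivative has_vector_derivative_at_within)
  then show "((\<lambda>u. f (s(i := u))) has_vector_derivative d) (at (s i) within {0..})"
    by (rule has_vector_derivative_transform[rotated 2]) (use assms in auto)
qed

context
  fixes N p :: nat and lab :: "nat \<Rightarrow> nat" and J :: "'j set" and c :: "'j \<Rightarrow> real" and e :: "'j \<Rightarrow> nat \<Rightarrow> nat"
    and f :: "(nat \<Rightarrow> real) \<Rightarrow> real"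
  assumes lab: "\<And>k. k < N \<Longrightarrow> lab k \<le> p"
    and f: "\<And>s. (\<And>k. k < N \<Longrightarrow> s k \<ge> 0) \<Longrightarrow>
      f s = (\<Sum>j\<in>J. c j * (\<Prod>l\<le>p. (\<Sum>k | k \<in> {..<N} \<and> lab k = l. s k) ^ e j l))"
begin

text \<open>The variable s k enters only through the sum of its label, with coefficient 1, so
  differentiating by it lowers that exponent by one. \<open>foldr\<close> treats the largest index
  first, hence the induction downwards in m.\<close>

lemma foldr_orthant_partial:
  assumes "m \<le> N" "\<And>k. k < N \<Longrightarrow> s k \<ge> 0"
  shows "foldr orthant_partial [m..<N] f s = (\<Sum>j\<in>J. c j * (\<Prod>l\<le>p.
    falling (e j l) (card {k. m \<le> k \<and> k < N \<and> lab k = l}) *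
    (\<Sum>k | k \<in> {..<N} \<and> lab k = l. s k) ^ (e j l - card {k. m \<le> k \<and> k < N \<and> lab k = l})))"
  using assms
proof (induction m arbitrary: s rule: inc_induct)
  case base
  have empty: "{k. N \<le> k \<and> k < N \<and> lab k = l} = {}" for l by auto
  show ?case using f[OF base] by (simp add: empty)
next
  case (step m)
  define cnt where "cnt r l = card {k. r \<le> k \<and> k < N \<and> lab k = l}" for r l
  define T where "T s l = (\<Sum>k | k \<in> {..<N} \<and> lab k = l. s k)" for s :: "nat \<Rightarrow> real" and l
  define L where "L = lab m"
  define A where "A j = (\<Prod>l\<in>{..p} - {L}. falling (e j l) (cnt (Suc m) l) * T s l ^ (e j l - cnt (Suc m) l))" for j
  have Lp: "L \<in> {..p}" using lab step.hyps by (simp add: L_def)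
  have cnt_L: "cnt m L = Suc (cnt (Suc m) L)"
  proof -
    have "{k. m \<le> k \<and> k < N \<and> lab k = L} = insert m {k. Suc m \<le> k \<and> k < N \<and> lab k = L}"
      using step.hyps by (auto simp: L_def)
    then show ?thesis by (simp add: cnt_def)
  qed
  have cnt_other: "cnt m l = cnt (Suc m) l" if "l \<noteq> L" for l
  proof -
    have "{k. m \<le> k \<and> k < N \<and> lab k = l} = {k. Suc m \<le> k \<and> k < N \<and> lab k = l}"
      using that by (auto simp: L_def le_less Suc_le_eq)
    then show ?thesis by (simp add: cnt_def)
  qed
  have T_L: "T (s(m := u)) L = T s L + (u - s m)" for u
  proof -
    have "{k. k \<in> {..<N} \<and> lab k = L} = insert m ({k. k \<in> {..<N} \<and> lab k = L} - {m})"
      using step.hyps by (auto simp: L_def)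
    then have split: "T s' L = s' m + (\<Sum>k\<in>{k. k \<in> {..<N} \<and> lab k = L} - {m}. s' k)" for s'
      unfolding T_def by (subst sum.remove[of _ m]) (use step.hyps in \<open>auto simp: L_def\<close>)
    show ?thesis unfolding split by simp
  qed
  have T_other: "T (s(m := u)) l = T s l" if "l \<noteq> L" for u l
    unfolding T_def by (rule sum.cong) (use that in \<open>auto simp: L_def\<close>)
  \<comment> \<open>The same polynomial on the whole line; it agrees with the partially
    differentiated function for u >= 0 only.\<close>
  define h where "h u = (\<Sum>j\<in>J. c j * (falling (e j L) (cnt (Suc m) L) *
      (T s L + (u - s m)) ^ (e j L - cnt (Suc m) L) * A j))" for u
  have "foldr orthant_partial [m..<N] f s = orthant_partial m (foldr orthant_partial [Suc m..<N] f) s"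
    using step.hyps by (simp add: upt_conv_Cons)
  also have "\<dots> = (\<Sum>j\<in>J. c j * (falling (e j L) (cnt (Suc m) L) *
      (real (e j L - cnt (Suc m) L) * T s L ^ (e j L - cnt (Suc m) L - 1)) * A j))"
  proof (rule orthant_partial_eq)
    show "s m \<ge> 0" using step by simp
    show "(h has_real_derivative (\<Sum>j\<in>J. c j * (falling (e j L) (cnt (Suc m) L) *
      (real (e j L - cnt (Suc m) L) * T s L ^ (e j L - cnt (Suc m) L - 1)) * A j))) (at (s m))"
      unfolding h_def
      by (rule DERIV_cong, (rule DERIV_sum DERIV_cmult DERIV_cmult_right DERIV_power DERIV_add DERIV_diff DERIV_const DERIV_ident)+)
        simp
    fix u :: real assume "u \<ge> 0"
    then have "foldr orthant_partial [Suc m..<N] f (s(m := u)) = (\<Sum>j\<in>J. c j * (\<Prod>l\<le>p.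
        falling (e j l) (cnt (Suc m) l) * T (s(m := u)) l ^ (e j l - cnt (Suc m) l)))"
      unfolding cnt_def T_def using step.prems by (intro step.IH) auto
    also have "\<dots> = h u"
      unfolding h_def A_def
      by (intro sum.cong refl arg_cong2[where f = "(*)"], subst prod.remove[OF finite_atMost Lp])
        (simp add: T_L T_other)
    finally show "foldr orthant_partial [Suc m..<N] f (s(m := u)) = h u" .
  qed
  also have "\<dots> = (\<Sum>j\<in>J. c j * (\<Prod>l\<le>p. falling (e j l) (cnt m l) * T s l ^ (e j l - cnt m l)))"
  proof (intro sum.cong refl arg_cong2[where f = "(*)"])
    fix j
    have "A j = (\<Prod>l\<in>{..p} - {L}. falling (e j l) (cnt m l) * T s l ^ (e j l - cnt m l))"
      unfolding A_def by (intro prod.cong refl) (simp add: cnt_other)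
    moreover have "falling (e j L) (cnt (Suc m) L) * (real (e j L - cnt (Suc m) L) * T s L ^ (e j L - cnt (Suc m) L - 1))
      = falling (e j L) (cnt m L) * T s L ^ (e j L - cnt m L)"
      unfolding cnt_L by (simp add: falling_Suc_mult[symmetric])
    ultimately show "falling (e j L) (cnt (Suc m) L) * (real (e j L - cnt (Suc m) L) * T s L ^ (e j L - cnt (Suc m) L - 1)) * A j
      = (\<Prod>l\<le>p. falling (e j l) (cnt m l) * T s l ^ (e j l - cnt m l))"
      by (subst prod.remove[OF finite_atMost Lp]) simp
  qed
  finally show ?case unfolding cnt_def T_def .
qed

text \<open>Exponents and label counts both sum to N. If they differ, some exponent is smaller than
  its count, and its falling factorial is 0; if they agree, 0^0 = 1 leaves the factorials.\<close>

lemma foldr_orthant_partial_zero: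
  assumes deg: "\<And>j. j \<in> J \<Longrightarrow> (\<Sum>l\<le>p. e j l) = N"
  shows "foldr orthant_partial [0..<N] f (\<lambda>_. 0) =
    (\<Sum>j\<in>J. if \<forall>l\<le>p. e j l = card {k. k < N \<and> lab k = l} then c j * (\<Prod>l\<le>p. fact (e j l)) else 0)"
proof -
  let ?cnt = "\<lambda>l. card {k. k < N \<and> lab k = l}"
  have total: "(\<Sum>l\<le>p. ?cnt l) = N"
  proof -
    have "(\<Sum>l\<le>p. card {k \<in> {..<N}. lab k = l}) = card {..<N}"
      unfolding card_eq_sum using lab by (intro sum.group) auto
    then show ?thesis by simp
  qed
  have "foldr orthant_partial [0..<N] f (\<lambda>_. 0) =
      (\<Sum>j\<in>J. c j * (\<Prod>l\<le>p. falling (e j l) (?cnt l) * 0 ^ (e j l - ?cnt l)))"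
    using foldr_orthant_partial[of 0 "\<lambda>_. 0"] by simp
  also have "\<dots> = (\<Sum>j\<in>J. if \<forall>l\<le>p. e j l = ?cnt l then c j * (\<Prod>l\<le>p. fact (e j l)) else 0)"
  proof (rule sum.cong[OF refl])
    fix j assume j: "j \<in> J"
    show "c j * (\<Prod>l\<le>p. falling (e j l) (?cnt l) * 0 ^ (e j l - ?cnt l))
      = (if \<forall>l\<le>p. e j l = ?cnt l then c j * (\<Prod>l\<le>p. fact (e j l)) else 0)"
    proof (cases "\<forall>l\<le>p. e j l = ?cnt l")
      case True
      have "(\<Prod>l\<le>p. falling (e j l) (?cnt l) * 0 ^ (e j l - ?cnt l)) = (\<Prod>l\<le>p. fact (e j l))"
      proof (rule prod.cong[OF refl])
        fix l assume "l \<in> {..p}"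
        then have "?cnt l = e j l" using True by simp
        then show "falling (e j l) (?cnt l) * 0 ^ (e j l - ?cnt l) = fact (e j l)"
          by (simp only: falling_self) simp
      qed
      then show ?thesis by (simp only: if_P[OF True])
    next
      case False
      have "\<exists>l\<le>p. e j l < ?cnt l"
      proof (rule ccontr)
        assume "\<not> ?thesis"
        then have ge: "\<And>l. l \<in> {..p} \<Longrightarrow> ?cnt l \<le> e j l" by force
        obtain l where l: "l \<in> {..p}" "e j l \<noteq> ?cnt l"
          using False by blast
        have lt: "?cnt l < e j l" using ge[OF l(1)] l(2) by linarith
        have "(\<Sum>l\<le>p. ?cnt l) < (\<Sum>l\<le>p. e j l)"
          by (rule sum_strict_mono_ex1) (use ge l(1) lt in blast)+
        with total deg[OF j] show False by simp
      qed
      then obtain l where l: "l \<in> {..p}" "e j l < ?cnt l" by auto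
      then have "falling (e j l) (?cnt l) * 0 ^ (e j l - ?cnt l) = 0"
        by (simp add: falling_eq_0)
      with l(1) have "(\<Prod>l\<le>p. falling (e j l) (?cnt l) * 0 ^ (e j l - ?cnt l)) = 0"
        by (intro prod_zero) auto
      then show ?thesis by (simp only: if_not_P[OF False] mult_zero_right)
    qed
  qed
  finally show ?thesis .
qed

end

section \<open>Mixed volumes as coefficients\<close>

lemma pminkowski_cong:
  assumes "\<And>k. k \<in> I \<Longrightarrow> A k = B k"
  shows "pminkowski p I A = pminkowski p I B"
  unfolding pminkowski_def using assms by (intro Collect_cong ex_cong1 conj_cong refl ball_cong) simp

lemma length_filter_labels:
  "l \<le> p \<Longrightarrow> length (filter (\<lambda>x. x = l) (concat (map (\<lambda>l. replicate (m l) l) [0..<Suc p]))) = m l"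
proof -
  assume l: "l \<le> p"
  have "length (filter (\<lambda>x. x = l) (concat (map (\<lambda>l. replicate (m l) l) [0..<Suc p])))
    = sum_list (map (\<lambda>l'. if l' = l then m l' else 0) [0..<Suc p])"
    by (simp add: filter_concat length_concat o_def filter_replicate if_distrib cong: if_cong)
  also have "\<dots> = (\<Sum>l'\<in>{0..<Suc p}. if l' = l then m l' else 0)"
    by (simp add: sum_list_distinct_conv_sum_set del: upt_Suc)
  finally show ?thesis using l by (simp add: atLeastLessThanSuc_atLeastAtMost)
qed

text \<open>The labels record which embedding each list entry of \<open>W_mixed\<close> uses, so
  differentiating at 0 selects the coefficient of j0, times factorials over N!. The factor
  \<open>multinom\<close> cancels exactly these.\<close>

lemma multinom_W_mixed:
  fixes K :: "(real ^ 'n) set"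
  assumes K: "convex K" "K \<noteq> {}"
    and c: "\<And>t. (\<And>l. l \<le> p \<Longrightarrow> t l \<ge> (0::real)) \<Longrightarrow>
      pvol p (dbody p t K) = (\<Sum>j\<in>multi_indices CARD('n) p. c j * (\<Prod>l\<le>p. t l ^ (CARD('n) - j l)))"
    and j0: "j0 \<in> multi_indices CARD('n) p"
  shows "multinom CARD('n) p j0 * W_mixed p K j0 = c j0"
proof -
  let ?n = "CARD('n)" and ?M = "multi_indices CARD('n) p"
  define N where "N = p * ?n"
  define labs where "labs = concat (map (\<lambda>l. replicate (?n - j0 l) l) [0..<Suc p])"
  define Ks where "Ks = replicate (?n - j0 0) (pscale p (-1) (diag_emb p ` K)) @
      concat (map (\<lambda>l. replicate (?n - j0 l) (factor_emb p l ` K)) [1..<Suc p])"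
  define f where "f = (\<lambda>s. pvol p (pminkowski p {..<N} (\<lambda>k. pscale p (s k) (Ks ! k))))"
  have len: "length labs = N"
  proof -
    have "length labs = (\<Sum>l\<in>{0..<Suc p}. ?n - j0 l)"
      unfolding labs_def by (simp add: length_concat o_def interv_sum_list_conv_sum_set_nat del: upt_Suc)
    also have "\<dots> = N"
      using sum_multi_indices_complement[OF j0] by (simp add: N_def atLeast0LessThan lessThan_Suc_atMost mult.commute)
    finally show ?thesis .
  qed
  have "[0..<Suc p] = 0 # [1..<Suc p]" by (simp add: upt_conv_Cons del: upt_Suc)
  then have "map (\<lambda>l. emb p l ` K) labs = replicate (?n - j0 0) (emb p 0 ` K) @
      concat (map (\<lambda>l. replicate (?n - j0 l) (emb p l ` K)) [1..<Suc p])"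
    unfolding labs_def by (simp add: map_concat o_def del: upt_Suc)
  also have "\<dots> = Ks"
    unfolding Ks_def emb_zero by (intro arg_cong2[where f = "(@)"] refl arg_cong[where f = concat] map_cong) (simp add: emb_pos del: upt_Suc)
  finally have Ks: "Ks = map (\<lambda>l. emb p l ` K) labs" by simp
  have lab_le: "labs ! k \<le> p" if "k < N" for k
  proof -
    have "labs ! k \<in> set labs" using that len by simp
    then show ?thesis by (auto simp: labs_def simp del: upt_Suc)
  qed
  have f: "f s = (\<Sum>j\<in>?M. c j * (\<Prod>l\<le>p. (\<Sum>k | k \<in> {..<N} \<and> labs ! k = l. s k) ^ (?n - j l)))"
    if s: "\<And>k. k < N \<Longrightarrow> s k \<ge> 0" for s
  proof -
    have "pminkowski p {..<N} (\<lambda>k. pscale p (s k) (Ks ! k)) = pminkowski p {..<N} (\<lambda>k. pscale p (s k) (emb p (labs ! k) ` K))"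
      by (rule pminkowski_cong) (simp add: Ks len)
    also have "\<dots> = dbody p (\<lambda>l. \<Sum>k | k \<in> {..<N} \<and> labs ! k = l. s k) K"
      using K s lab_le by (intro pminkowski_emb) auto
    finally show ?thesis
      unfolding f_def using s by (simp only:) (intro c sum_nonneg, auto)
  qed
  have card: "card {k. k < N \<and> labs ! k = l} = ?n - j0 l" if "l \<le> p" for l
    using length_filter_labels[OF that, of "\<lambda>l. ?n - j0 l"]
    unfolding labs_def[symmetric] length_filter_conv_card len .
  have "foldr orthant_partial [0..<N] f (\<lambda>_. 0) =
      (\<Sum>j\<in>?M. if \<forall>l\<le>p. ?n - j l = card {k. k < N \<and> labs ! k = l} then c j * (\<Prod>l\<le>p. fact (?n - j l)) else 0)"
    by (rule foldr_orthant_partial_zero[OF lab_le f])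
      (simp_all add: sum_multi_indices_complement N_def mult.commute)
  also have "\<dots> = (\<Sum>j\<in>?M. if j = j0 then c j * (\<Prod>l\<le>p. fact (?n - j l)) else 0)"
  proof (rule sum.cong[OF refl], rule if_cong[OF _ refl refl])
    fix j assume j: "j \<in> ?M"
    \<comment> \<open>Equal differences n - j l and n - j0 l give equal indices because neither
      index exceeds n.\<close>
    have "j = j0" if eq: "\<forall>l\<le>p. ?n - j l = card {k. k < N \<and> labs ! k = l}"
    proof (rule extensionalityI[of _ "{..p}"])
      fix l assume l: "l \<in> {..p}"
      then show "j l = j0 l"
        using eq card[of l] multi_indices_le[OF j, of l] multi_indices_le[OF j0, of l] by fastforce
    qed (use j j0 in \<open>auto simp: multi_indices_def PiE_def\<close>)
    then show "(\<forall>l\<le>p. ?n - j l = card {k. k < N \<and> labs ! k = l}) \<longleftrightarrow> j = j0"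
      using card by auto
  qed
  also have "\<dots> = c j0 * (\<Prod>l\<le>p. fact (?n - j0 l))"
    using finite_multi_indices j0 by simp
  finally have "W_mixed p K j0 = c j0 * (\<Prod>l\<le>p. fact (?n - j0 l)) / fact (?n * p)"
    unfolding W_mixed_def Ks_def[symmetric] mixed_volume_def Let_def N_def[symmetric] f_def[symmetric]
    by (simp add: N_def mult.commute)
  moreover have "(\<Prod>l\<le>p. fact (?n - j0 l)) \<noteq> (0::real)" by simp
  ultimately show ?thesis
    unfolding multinom_def by simp
qed

text \<open>Parameters with arbitrary sum are needed, since the integrand of \<open>q_coef\<close>
  is evaluated at shifted parameters, whose sum is in general below 1.\<close>

theorem pvol_dbody_eq_sum:
  fixes K :: "(real ^ 'n) set"
  assumes K: "convex_body K" and p: "p \<ge> 1" and t: "\<And>l. l \<le> p \<Longrightarrow> t l \<ge> 0"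
  shows "pvol p (dbody p t K) =
    (\<Sum>j\<in>multi_indices CARD('n) p. multinom CARD('n) p j * W_mixed p K j * (\<Prod>l\<le>p. t l ^ (CARD('n) - j l)))"
proof -
  have K': "compact K" "convex K" "K \<noteq> {}" using K by (auto simp: convex_body_def)
  obtain c where c: "\<And>t. (\<And>l. l \<le> p \<Longrightarrow> t l \<ge> (0::real)) \<Longrightarrow>
      pvol p (dbody p t K) = (\<Sum>j\<in>multi_indices CARD('n) p. c j * (\<Prod>l\<le>p. t l ^ (CARD('n) - j l)))"
  proof (rule homogeneous_interpolates_imp_polynomial[of p "CARD('n)" "\<lambda>t. pvol p (dbody p t K)"])
    show "interpolates CARD('n) (\<lambda>\<tau>. pvol p (dbody p (t(l := \<tau>)) K))" if "l \<le> p" for l t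
      by (rule interpolates_pvol[OF K'(1,2) p that])
    show "pvol p (dbody p t K) = pvol p (dbody p t' K)" if "\<And>l. l \<le> p \<Longrightarrow> t l = t' l" for t t'
      using dbody_cong[of p t t' K] that by simp
    show "pvol p (dbody p (\<lambda>l. c * t l) K) = c ^ (CARD('n) * p) * pvol p (dbody p t K)" if "c > 0" for c t
      by (rule pvol_dbody_scale[OF K'(1) that])
  qed blast
  have "multinom CARD('n) p j * W_mixed p K j = c j" if "j \<in> multi_indices CARD('n) p" for j
    by (rule multinom_W_mixed[OF K'(2,3) _ that]) (rule c)
  moreover have "pvol p (dbody p t K) = (\<Sum>j\<in>multi_indices CARD('n) p. c j * (\<Prod>l\<le>p. t l ^ (CARD('n) - j l)))"
    by (rule c) (rule t)
  ultimately show ?thesis by simp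
qed

section \<open>Difference bodies of a simplex\<close>

text \<open>For u = 0 the image has at most one point, and the right-hand side is 0 because the
  dimension is positive.\<close>

lemma emeasure_homothet:
  fixes S :: "'a::euclidean_space set"
  assumes "compact S" "u \<ge> 0"
  shows "emeasure lborel ((\<lambda>z. c + u *\<^sub>R z) ` S) = ennreal (u ^ DIM('a)) * emeasure lborel S"
proof (cases "u = 0")
  case True
  have "(\<lambda>z. c + u *\<^sub>R z) ` S \<subseteq> {c}" using True by auto
  then have "emeasure lborel ((\<lambda>z. c + u *\<^sub>R z) ` S) \<le> emeasure lborel {c}"
    by (intro emeasure_mono) auto
  then show ?thesis using True by simp
next
  case False
  have "compact ((\<lambda>z. c + u *\<^sub>R z) ` S)"
    using assms(1) by (intro compact_continuous_image continuous_intros)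
  then have "emeasure lborel ((\<lambda>z. c + u *\<^sub>R z) ` S)
    = ennreal (\<bar>u\<bar> ^ DIM('a)) * emeasure lborel ((\<lambda>z. c + u *\<^sub>R z) -` (\<lambda>z. c + u *\<^sub>R z) ` S)"
    by (intro emeasure_lborel_affine_vimage False borel_compact)
  also have "(\<lambda>z. c + u *\<^sub>R z) -` (\<lambda>z. c + u *\<^sub>R z) ` S = S"
    using False by (intro inj_vimage_image_eq) (auto simp: inj_def)
  finally show ?thesis using assms(2) by simp
qed

text \<open>Barycentric coordinates \<open>y \<mapsto> b v y + a v\<close> of a simplex, split into their linear parts
  and their values at the origin.\<close>

definition barycentric :: "'a::euclidean_space set \<Rightarrow> ('a \<Rightarrow> 'a \<Rightarrow> real) \<Rightarrow> ('a \<Rightarrow> real) \<Rightarrow> 'a set \<Rightarrow> bool" where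
  "barycentric C b a S \<longleftrightarrow> finite C \<and> (\<forall>v\<in>C. linear (b v)) \<and> (\<forall>y. (\<Sum>v\<in>C. b v y) = 0) \<and> (\<Sum>v\<in>C. a v) = 1 \<and>
     (\<forall>y. y \<in> S \<longleftrightarrow> (\<forall>v\<in>C. b v y + a v \<ge> 0)) \<and>
     (\<forall>c. (\<Sum>v\<in>C. c v) = 0 \<longrightarrow> (\<exists>y. \<forall>v\<in>C. b v y = c v)) \<and>
     (\<forall>y. (\<forall>v\<in>C. b v y = 0) \<longrightarrow> y = 0)"

text \<open>Differences of the vertices with one vertex v0 form a basis; its dual basis gives the
  coordinates of the other vertices.\<close>

lemma simplex_barycentric:
  fixes S :: "'a::euclidean_space set"
  assumes "int DIM('a) simplex S"
  obtains C b a where "barycentric C b a S"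
proof -
  obtain C where C: "\<not> affine_dependent C" "int (card C) = int DIM('a) + 1" "S = convex hull C"
    using assms unfolding simplex_def by blast
  have card: "card C = Suc DIM('a)" using C(2) by linarith
  then have finC: "finite C" by (intro card_ge_0_finite) simp
  obtain v0 where v0: "v0 \<in> C" using card by (metis card.empty ex_in_conv nat.distinct(1))
  define C' where "C' = C - {v0}"
  have CC': "C = insert v0 C'" "v0 \<notin> C'" "finite C'" "card C' = DIM('a)"
    using v0 finC card by (auto simp: C'_def)
  define B where "B = (\<lambda>v. v - v0) ` C'"
  have indB: "independent B"
    using C(1) affine_dependent_iff_dependent[OF CC'(2)] unfolding CC'(1) B_def by (simp add: setcompr_eq_image)
  have "card B = DIM('a)" unfolding B_def using CC'(4) by (subst card_image) (auto simp: inj_on_def)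
  then have spanB: "span B = UNIV"
    using indB by (metis card_ge_dim_independent dim_UNIV order_refl subset_UNIV top.extremum_uniqueI)
  have "\<exists>g. linear g \<and> (\<forall>w\<in>C'. g (w - v0) = (if w = v then 1 else 0::real))" for v
  proof -
    obtain g where g: "linear g" "\<forall>x\<in>B. g x = (if x = v - v0 then 1 else 0::real)"
      using linear_independent_extend[OF indB, of "\<lambda>x. if x = v - v0 then 1 else 0"] by blast
    then have "\<forall>w\<in>C'. g (w - v0) = (if w = v then 1 else 0::real)" by (simp add: B_def)
    with g(1) show ?thesis by blast
  qed
  then have "\<forall>v. \<exists>g. linear g \<and> (\<forall>w\<in>C'. g (w - v0) = (if w = v then 1 else 0::real))" ..
  from choice[OF this] obtain g where g: "\<And>v. linear (g v)"
      "\<And>v w. w \<in> C' \<Longrightarrow> g v (w - v0) = (if w = v then 1 else 0::real)"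
    by blast
  \<comment> \<open>The coordinate of v0 is 1 minus the others, so the linear parts sum to 0 and the
    constants to 1.\<close>
  define b where "b v y = (if v = v0 then - (\<Sum>w\<in>C'. g w y) else g v y)" for v y
  define a where "a v = (if v = v0 then 1 + (\<Sum>w\<in>C'. g w v0) else - g v v0)" for v
  have lin: "linear (b v)" for v
    unfolding b_def using g(1)
    by (cases "v = v0") (auto intro!: linear_compose_neg linear_compose_sum simp: linear_compose_neg[unfolded o_def])
  have sum_b: "(\<Sum>v\<in>C. b v y) = 0" for y
  proof -
    have "(\<Sum>v\<in>C'. b v y) = (\<Sum>w\<in>C'. g w y)"
      using CC'(2) by (intro sum.cong) (auto simp: b_def)
    then show ?thesis unfolding CC'(1) using CC'(2,3) by (simp add: b_def)
  qed
  have sum_a: "(\<Sum>v\<in>C. a v) = 1"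
  proof -
    have "(\<Sum>v\<in>C'. a v) = (\<Sum>w\<in>C'. - g w v0)"
      using CC'(2) by (intro sum.cong) (auto simp: a_def)
    then show ?thesis unfolding CC'(1) using CC'(2,3) by (simp add: a_def sum_negf)
  qed
  have delta: "b v w + a v = (if w = v then 1 else 0)" if v: "v \<in> C" and w: "w \<in> C" for v w
  proof -
    have gdiff: "g u w - g u v0 = (if w = u \<and> w \<noteq> v0 then 1 else 0)" if "u \<in> C'" for u
    proof (cases "w = v0")
      case False
      then have "w \<in> C'" using w CC'(1) by blast
      with False show ?thesis using g(2)[of w u] linear_diff[OF g(1)[of u], of w v0] by simp
    qed simp
    show ?thesis
    proof (cases "v = v0")
      case True
      have "b v w + a v = 1 - (\<Sum>u\<in>C'. g u w - g u v0)"
        using True by (simp add: a_def b_def sum_subtractf)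
      also have "(\<Sum>u\<in>C'. g u w - g u v0) = (\<Sum>u\<in>C'. if u = w then (if w \<noteq> v0 then 1 else 0) else 0)"
        by (intro sum.cong refl) (auto simp: gdiff)
      also have "\<dots> = (if w \<noteq> v0 then 1 else 0)"
        using w CC' by (auto simp: sum.delta)
      finally show ?thesis using True by auto
    next
      case False
      then have "v \<in> C'" using v CC'(1) by blast
      from gdiff[OF this] False show ?thesis by (auto simp: a_def b_def)
    qed
  qed
  have repr: "y = (\<Sum>v\<in>C. b v y *\<^sub>R v)" for y
  proof -
    have "y = (\<Sum>w\<in>C'. g w y *\<^sub>R (w - v0))"
    proof (rule linear_eq_on[of "\<lambda>y. y" "\<lambda>y. \<Sum>w\<in>C'. g w y *\<^sub>R (w - v0)" y B])
      show "linear (\<lambda>y. \<Sum>w\<in>C'. g w y *\<^sub>R (w - v0))"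
        by (rule linearI)
          (simp_all add: linear_add[OF g(1)] linear_scale[OF g(1)] scaleR_add_left sum.distrib scaleR_sum_right)
      fix x assume "x \<in> B"
      then obtain w where w: "w \<in> C'" "x = w - v0" by (auto simp: B_def)
      have "(\<Sum>u\<in>C'. g u x *\<^sub>R (u - v0)) = (\<Sum>u\<in>C'. if u = w then u - v0 else 0)"
        using w by (intro sum.cong refl) (auto simp: g(2))
      then show "x = (\<Sum>u\<in>C'. g u x *\<^sub>R (u - v0))" using w CC'(3) by simp
    qed (auto simp: spanB linear_ident)
    also have "\<dots> = (\<Sum>w\<in>C'. g w y *\<^sub>R w) + b v0 y *\<^sub>R v0"
      by (simp add: b_def scaleR_diff_right sum_subtractf scaleR_sum_left[symmetric])
    also have "(\<Sum>w\<in>C'. g w y *\<^sub>R w) = (\<Sum>w\<in>C'. b w y *\<^sub>R w)"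
      using CC'(2) by (intro sum.cong) (auto simp: b_def)
    finally show ?thesis unfolding CC'(1) using CC'(2,3) by (simp add: add.commute)
  qed
  \<comment> \<open>For coefficients with sum 1 this recovers the barycentric coordinates; for sum 0
    it shows that the linear parts attain all values with sum 0.\<close>
  have coord: "b v (\<Sum>w\<in>C. c w *\<^sub>R w) + a v * sum c C = c v" if v: "v \<in> C" for v c
  proof -
    have "b v (\<Sum>w\<in>C. c w *\<^sub>R w) + a v * sum c C = (\<Sum>w\<in>C. c w * (b v w + a v))"
      by (simp add: linear_sum[OF lin] linear_scale[OF lin] sum_distrib_left sum.distrib[symmetric] algebra_simps)
    also have "\<dots> = (\<Sum>w\<in>C. if w = v then c w else 0)"
      using v by (intro sum.cong refl) (simp add: delta)
    finally show ?thesis using v finC by simp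
  qed
  have sum_av: "(\<Sum>v\<in>C. a v *\<^sub>R v) = 0"
  proof -
    have "v0 = (\<Sum>v\<in>C. (b v v0 + a v) *\<^sub>R v)"
      using v0 finC by (simp add: delta if_distrib[of "\<lambda>c. c *\<^sub>R _"] cong: if_cong sum.cong)
    also have "\<dots> = v0 + (\<Sum>v\<in>C. a v *\<^sub>R v)"
      unfolding scaleR_add_left sum.distrib repr[of v0, symmetric] ..
    finally show ?thesis by simp
  qed
  have mem: "y \<in> S \<longleftrightarrow> (\<forall>v\<in>C. b v y + a v \<ge> 0)" for y
  proof
    assume "y \<in> S"
    then obtain c where c: "\<forall>v\<in>C. 0 \<le> c v" "sum c C = 1" "(\<Sum>v\<in>C. c v *\<^sub>R v) = y"
      unfolding C(3) convex_hull_finite[OF finC] by blast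
    show "\<forall>v\<in>C. b v y + a v \<ge> 0" using coord[of _ c] c by simp
  next
    assume nn: "\<forall>v\<in>C. b v y + a v \<ge> 0"
    have one: "(\<Sum>v\<in>C. b v y + a v) = 1" by (simp add: sum.distrib sum_a sum_b)
    have "(\<Sum>v\<in>C. (b v y + a v) *\<^sub>R v) = y"
      unfolding scaleR_add_left sum.distrib sum_av repr[of y, symmetric] by simp
    with nn one show "y \<in> S"
      unfolding C(3) convex_hull_finite[OF finC]
      by (intro CollectI exI[of _ "\<lambda>v. b v y + a v"] conjI)
  qed
  have surj: "\<exists>y. \<forall>v\<in>C. b v y = c v" if "sum c C = 0" for c
  proof (intro exI ballI)
    fix v assume "v \<in> C"
    from coord[OF this, of c] show "b v (\<Sum>w\<in>C. c w *\<^sub>R w) = c v"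
      unfolding that by simp
  qed
  have inj: "y = 0" if "\<forall>v\<in>C. b v y = 0" for y
    by (subst repr[of y]) (simp add: that)
  have bary: "barycentric C b a S"
    unfolding barycentric_def using finC lin sum_b sum_a mem surj inj by blast
  show ?thesis by (rule that[OF bary])
qed

text \<open>Setting x 0 = 0 puts t 0 K on the same footing as the translates t l K - x l.\<close>

definition with_origin :: "(nat \<Rightarrow> 'a::zero) \<Rightarrow> nat \<Rightarrow> 'a" where
  "with_origin x l = (if l = 0 then 0 else x l)"

text \<open>The common point y of the translates is \<open>t 0 *\<^sub>R y 0\<close>, the
  contribution shared by all coordinates.\<close>

lemma mem_dbody_iff:
  fixes K :: "(real ^ 'n) set"
  shows "x \<in> dbody p t K \<longleftrightarrow>
    x \<in> extensional {1..p} \<and> (\<exists>y. \<forall>l\<le>p. y + with_origin x l \<in> (*\<^sub>R) (t l) ` K)"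
proof
  assume "x \<in> dbody p t K"
  then obtain y where x: "x = (\<lambda>i\<in>{1..p}. t i *\<^sub>R y i - t 0 *\<^sub>R y 0)" and y: "\<forall>l\<le>p. y l \<in> K"
    unfolding dbody_def by blast
  have "t 0 *\<^sub>R y 0 + with_origin x l = t l *\<^sub>R y l" if "l \<le> p" for l
    using that by (simp add: with_origin_def x)
  with y have "\<forall>l\<le>p. t 0 *\<^sub>R y 0 + with_origin x l \<in> (*\<^sub>R) (t l) ` K" by auto
  moreover have "x \<in> extensional {1..p}" using x by simp
  ultimately show "x \<in> extensional {1..p} \<and> (\<exists>y. \<forall>l\<le>p. y + with_origin x l \<in> (*\<^sub>R) (t l) ` K)" by blast
next
  assume "x \<in> extensional {1..p} \<and> (\<exists>y. \<forall>l\<le>p. y + with_origin x l \<in> (*\<^sub>R) (t l) ` K)"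
  then obtain y where x: "x \<in> extensional {1..p}" and "\<forall>l\<in>{..p}. \<exists>z. z \<in> K \<and> y + with_origin x l = t l *\<^sub>R z"
    by (auto simp: image_iff Bex_def)
  from bchoice[OF this(2)] obtain z where z: "\<forall>l\<in>{..p}. z l \<in> K \<and> y + with_origin x l = t l *\<^sub>R z l" by blast
  have y: "y = t 0 *\<^sub>R z 0" using bspec[OF z, of 0] by (simp add: with_origin_def)
  have "x = (\<lambda>i\<in>{1..p}. t i *\<^sub>R z i - t 0 *\<^sub>R z 0)"
  proof (rule extensionalityI[OF x])
    fix i assume i: "i \<in> {1..p}"
    then have "y + x i = t i *\<^sub>R z i" using bspec[OF z, of i] i by (simp add: with_origin_def)
    then show "x i = (\<lambda>i\<in>{1..p}. t i *\<^sub>R z i - t 0 *\<^sub>R z 0) i"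
      using i y by (simp add: algebra_simps eq_diff_eq)
  qed simp
  then show "x \<in> dbody p t K" unfolding dbody_def using z by blast
qed

context
  fixes C :: "(real ^ 'n) set" and b a and S :: "(real ^ 'n) set"
  assumes bary: "barycentric C b a S" and compS: "compact S" and S_ne: "S \<noteq> {}"
begin

lemma bary_facts:
  shows bary_finite: "finite C" and bary_linear: "v \<in> C \<Longrightarrow> linear (b v)" and bary_sum_linear: "(\<Sum>v\<in>C. b v y) = 0"
    and bary_sum_const: "(\<Sum>v\<in>C. a v) = 1" and bary_mem: "y \<in> S \<longleftrightarrow> (\<forall>v\<in>C. b v y + a v \<ge> 0)"
    and bary_surj: "(\<Sum>v\<in>C. c v) = 0 \<Longrightarrow> \<exists>y. \<forall>v\<in>C. b v y = c v"
    and bary_inj: "(\<forall>v\<in>C. b v y = 0) \<Longrightarrow> y = 0"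
  using bary unfolding barycentric_def by blast+

text \<open>For t = 0 the linear parts are nonnegative with sum 0, hence all 0, and the scaled
  simplex is the origin.\<close>

lemma mem_scaled:
  assumes "t \<ge> 0"
  shows "y \<in> (*\<^sub>R) t ` S \<longleftrightarrow> (\<forall>v\<in>C. b v y + t * a v \<ge> 0)"
proof (cases "t = 0")
  case True
  have "(*\<^sub>R) t ` S = {0}" using True S_ne by auto
  moreover have "y = 0 \<longleftrightarrow> (\<forall>v\<in>C. b v y \<ge> 0)"
  proof
    assume "\<forall>v\<in>C. b v y \<ge> 0"
    then have "\<forall>v\<in>C. b v y = 0" using bary_sum_linear[of y] bary_finite by (simp add: sum_nonneg_eq_0_iff)
    then show "y = 0" by (rule bary_inj)
  qed (simp add: linear_0[OF bary_linear])
  ultimately show ?thesis using True by simp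
next
  case False
  with assms have t: "t > 0" by simp
  have "y \<in> (*\<^sub>R) t ` S \<longleftrightarrow> y /\<^sub>R t \<in> S"
  proof
    assume "y /\<^sub>R t \<in> S"
    then show "y \<in> (*\<^sub>R) t ` S" using t by (intro image_eqI[of _ _ "y /\<^sub>R t"]) auto
  qed (use t in auto)
  also have "\<dots> \<longleftrightarrow> (\<forall>v\<in>C. (b v y + t * a v) / t \<ge> 0)"
  proof -
    have "b v (y /\<^sub>R t) + a v = (b v y + t * a v) / t" if "v \<in> C" for v
      using t by (simp add: linear_scale[OF bary_linear[OF that]] field_simps)
    then show ?thesis unfolding bary_mem by (intro ball_cong refl) simp
  qed
  also have "\<dots> \<longleftrightarrow> (\<forall>v\<in>C. b v y + t * a v \<ge> 0)"
    using t by (simp add: zero_le_divide_iff)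
  finally show ?thesis .
qed

text \<open>Moving the facets of a simplex in parallel gives a homothet. With ratio u = - sum m, the
  numbers m v + u a v sum to 0 and so are the linear coordinates of a centre c. For positive sum the
  conditions contradict that the b v y sum to 0.\<close>

lemma halfspaces_eq_homothet:
  obtains c where "{y. \<forall>v\<in>C. b v y \<ge> m v} =
    (if sum m C \<le> 0 then (\<lambda>z. c + (- sum m C) *\<^sub>R z) ` S else {})"
proof -
  let ?u = "- sum m C"
  have "(\<Sum>v\<in>C. m v + ?u * a v) = 0" by (simp add: sum_subtractf sum_distrib_left[symmetric] bary_sum_const)
  from bary_surj[OF this] obtain c where c: "\<forall>v\<in>C. b v c = m v + ?u * a v" by blast
  have shift: "b v (y - c) + ?u * a v = b v y - m v" if "v \<in> C" for v y
    using c that by (simp add: linear_diff[OF bary_linear[OF that]])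
  have "{y. \<forall>v\<in>C. b v y \<ge> m v} = (if sum m C \<le> 0 then (\<lambda>z. c + ?u *\<^sub>R z) ` S else {})"
  proof (cases "sum m C \<le> 0")
    case True
    have "y \<in> (\<lambda>z. c + ?u *\<^sub>R z) ` S \<longleftrightarrow> (\<forall>v\<in>C. b v y \<ge> m v)" for y
    proof -
      have "y \<in> (\<lambda>z. c + ?u *\<^sub>R z) ` S \<longleftrightarrow> y - c \<in> (*\<^sub>R) ?u ` S"
        by (auto simp: image_iff algebra_simps)
      also have "\<dots> \<longleftrightarrow> (\<forall>v\<in>C. b v (y - c) + ?u * a v \<ge> 0)"
        using True by (intro mem_scaled) simp
      also have "\<dots> \<longleftrightarrow> (\<forall>v\<in>C. b v y \<ge> m v)"
        by (intro ball_cong refl) (simp only: shift diff_ge_0_iff_ge)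
      finally show ?thesis .
    qed
    then show ?thesis unfolding if_P[OF True] by blast
  next
    case False
    have "sum m C \<le> 0" if "\<forall>v\<in>C. b v y \<ge> m v" for y
      using sum_mono[of C m "\<lambda>v. b v y"] that bary_sum_linear[of y] by simp
    with False show ?thesis by auto
  qed
  then show ?thesis using that by blast
qed

text \<open>The intersection of \<open>t\<^sub>0 S\<close> with the bodies \<open>t\<^sub>i S - x\<^sub>i\<close> is given by \<open>b v y \<ge> level p t x v\<close>; when
  nonempty it is a homothet of \<open>S\<close> with ratio \<open>depth p t x\<close>.\<close>

definition level :: "nat \<Rightarrow> (nat \<Rightarrow> real) \<Rightarrow> (nat \<Rightarrow> real ^ 'n) \<Rightarrow> real ^ 'n \<Rightarrow> real" where
  "level p t x v = Max ((\<lambda>l. - b v (with_origin x l) - t l * a v) ` {..p})"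

definition depth :: "nat \<Rightarrow> (nat \<Rightarrow> real) \<Rightarrow> (nat \<Rightarrow> real ^ 'n) \<Rightarrow> real" where
  "depth p t x = - (\<Sum>v\<in>C. level p t x v)"

text \<open>Lowering every t l by w moves every constraint by w a v, independently of l, so the
  shift comes out of the maximum. As the a v sum to 1, the ratio drops by exactly w.\<close>

lemma all_scaled_iff_level:
  assumes "\<And>l. l \<le> p \<Longrightarrow> t l - w \<ge> 0"
  shows "(\<forall>l\<le>p. y + with_origin x l \<in> (*\<^sub>R) (t l - w) ` S) \<longleftrightarrow> (\<forall>v\<in>C. b v y \<ge> level p t x v + w * a v)"
proof -
  have "(\<forall>l\<le>p. y + with_origin x l \<in> (*\<^sub>R) (t l - w) ` S)
    \<longleftrightarrow> (\<forall>l\<le>p. \<forall>v\<in>C. b v (y + with_origin x l) + (t l - w) * a v \<ge> 0)"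
    using assms by (auto simp: mem_scaled)
  also have "\<dots> \<longleftrightarrow> (\<forall>v\<in>C. \<forall>l\<in>{..p}. - b v (with_origin x l) - t l * a v \<le> b v y - w * a v)"
    by (force simp: linear_add[OF bary_linear] algebra_simps)
  also have "\<dots> \<longleftrightarrow> (\<forall>v\<in>C. level p t x v \<le> b v y - w * a v)"
    unfolding level_def by (subst Max_le_iff) auto
  finally show ?thesis by (simp add: le_diff_eq)
qed

text \<open>The intersection belonging to t - w has homothety ratio depth - w, and it is nonempty
  exactly if this is nonnegative.\<close>

lemma mem_dbody_simplex:
  assumes "\<And>l. l \<le> p \<Longrightarrow> t l - w \<ge> 0"
  shows "x \<in> dbody p (\<lambda>l. t l - w) S \<longleftrightarrow> x \<in> extensional {1..p} \<and> w \<le> depth p t x"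
proof -
  let ?m = "\<lambda>v. level p t x v + w * a v"
  have total: "sum ?m C = w - depth p t x"
    by (simp add: sum.distrib sum_distrib_left[symmetric] bary_sum_const depth_def)
  obtain c where c: "{y. \<forall>v\<in>C. b v y \<ge> ?m v} = (if sum ?m C \<le> 0 then (\<lambda>z. c + (- sum ?m C) *\<^sub>R z) ` S else {})"
    by (rule halfspaces_eq_homothet)
  have "(\<exists>y. \<forall>v\<in>C. b v y \<ge> ?m v) \<longleftrightarrow> {y. \<forall>v\<in>C. b v y \<ge> ?m v} \<noteq> {}"
    by blast
  also have "\<dots> \<longleftrightarrow> sum ?m C \<le> 0"
    unfolding c by (simp add: S_ne)
  also have "\<dots> \<longleftrightarrow> w \<le> depth p t x"
    unfolding total by simp
  finally have "(\<exists>y. \<forall>v\<in>C. b v y \<ge> ?m v) \<longleftrightarrow> w \<le> depth p t x" .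
  moreover have "(\<forall>l\<le>p. y + with_origin x l \<in> (*\<^sub>R) (t l - w) ` S) \<longleftrightarrow> (\<forall>v\<in>C. b v y \<ge> ?m v)" for y
    by (rule all_scaled_iff_level) (rule assms)
  ultimately show ?thesis
    unfolding mem_dbody_iff by simp
qed

lemma emeasure_intersection_simplex:
  assumes t: "\<And>l. l \<le> p \<Longrightarrow> t l \<ge> 0"
  shows "emeasure lborel {y. \<forall>l\<le>p. y + with_origin x l \<in> (*\<^sub>R) (t l) ` S}
    = (if depth p t x \<ge> 0 then ennreal (depth p t x ^ CARD('n)) * emeasure lborel S else 0)"
proof -
  have eq: "{y. \<forall>l\<le>p. y + with_origin x l \<in> (*\<^sub>R) (t l) ` S} = {y. \<forall>v\<in>C. b v y \<ge> level p t x v}"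
    using all_scaled_iff_level[of p t 0 _ x] t by simp
  obtain c where c: "{y. \<forall>v\<in>C. b v y \<ge> level p t x v}
    = (if sum (level p t x) C \<le> 0 then (\<lambda>z. c + (- sum (level p t x) C) *\<^sub>R z) ` S else {})"
    by (rule halfspaces_eq_homothet)
  show ?thesis
    unfolding eq c using emeasure_homothet[OF compS, of "depth p t x" c]
    by (simp add: depth_def)
qed

text \<open>Keep only the term of index l in each maximum; the linear parts sum to 0 and the
  constants to 1.\<close>

lemma depth_le:
  assumes "l \<le> p"
  shows "depth p t x \<le> t l"
proof -
  have "- b v (with_origin x l) - t l * a v \<le> level p t x v" for v
    unfolding level_def using assms by (intro Max_ge) auto
  then have "(\<Sum>v\<in>C. - b v (with_origin x l) - t l * a v) \<le> (\<Sum>v\<in>C. level p t x v)"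
    by (intro sum_mono)
  moreover have "(\<Sum>v\<in>C. - b v (with_origin x l) - t l * a v) = - t l"
    by (simp add: sum_subtractf sum_negf bary_sum_linear sum_distrib_left[symmetric] bary_sum_const)
  ultimately show ?thesis by (simp add: depth_def)
qed

lemma measurable_depth: "depth p t \<in> borel_measurable (plborel {1..p})"
proof -
  have "(\<lambda>x. with_origin x l) \<in> borel_measurable (plborel {1..p} :: (nat \<Rightarrow> real ^ 'n) measure)" if "l \<le> p" for l
  proof (cases "l = 0")
    case False
    then have "l \<in> {1..p}" using that by simp
    then show ?thesis
      using False measurable_component_singleton[of l "{1..p}" "\<lambda>_. lborel :: (real ^ 'n) measure"]
      by (simp add: with_origin_def)
  qed (simp add: with_origin_def)
  note wo = this
  have bm: "b v \<in> borel_measurable borel" if "v \<in> C" for v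
    by (rule borel_measurable_continuous_onI[OF linear_continuous_on])
      (simp add: linear_conv_bounded_linear[symmetric] bary_linear[OF that])
  have "(\<lambda>x. level p t x v) \<in> borel_measurable (plborel {1..p})" if v: "v \<in> C" for v
    unfolding level_def
  proof (rule borel_measurable_Max)
    fix l assume "l \<in> {..p}"
    then have "(\<lambda>x. b v (with_origin x l)) \<in> borel_measurable (plborel {1..p})"
      by (intro measurable_compose[OF wo bm[OF v]]) simp
    then show "(\<lambda>x. - b v (with_origin x l) - t l * a v) \<in> borel_measurable (plborel {1..p})"
      by (intro borel_measurable_diff borel_measurable_uminus borel_measurable_const)
  qed simp
  then show ?thesis
    unfolding depth_def[abs_def] by (intro borel_measurable_uminus borel_measurable_sum)
qed

text \<open>By Fubini, for fixed y each x i ranges over a translate of t i S, independently of the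
  others; then y ranges over t 0 S.\<close>

lemma nn_integral_intersection:
  assumes t: "\<And>l. l \<le> p \<Longrightarrow> t l \<ge> 0"
  shows "(\<integral>\<^sup>+x. emeasure lborel {y. \<forall>l\<le>p. y + with_origin x l \<in> (*\<^sub>R) (t l) ` S} \<partial>plborel {1..p})
    = (\<Prod>l\<le>p. ennreal (t l ^ CARD('n)) * emeasure lborel S)"
proof -
  define E where "E l = (*\<^sub>R) (t l) ` S" for l
  have comp: "compact (E l)" for l unfolding E_def by (rule compact_scaling[OF compS])
  then have Eb: "E l \<in> sets borel" for l by (rule borel_compact)
  have E_meas: "emeasure lborel (E l) = ennreal (t l ^ CARD('n)) * emeasure lborel S" if "l \<le> p" for l
    using emeasure_homothet[OF compS t[OF that], of 0] by (simp add: E_def)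
  define f where "f = (\<lambda>(x :: nat \<Rightarrow> real ^ 'n) y. indicator (E 0) y * (\<Prod>i\<in>{1..p}. indicator (E i) (y + x i)) :: ennreal)"
  have f_ind: "indicator {y. \<forall>l\<le>p. y + with_origin x l \<in> E l} y = f x y" for x y
  proof -
    have "(\<forall>l\<le>p. y + with_origin x l \<in> E l) \<longleftrightarrow> y \<in> E 0 \<and> (\<forall>i\<in>{1..p}. y + x i \<in> E i)"
      by (force simp: with_origin_def)
    then show ?thesis
      by (cases "\<forall>i\<in>{1..p}. y + x i \<in> E i") (auto simp: f_def indicator_def intro: prod_zero)
  qed
  have fmeas: "case_prod f \<in> borel_measurable (plborel {1..p} \<Otimes>\<^sub>M lborel)"
  proof -
    have coord: "(\<lambda>z. snd z + fst z i) \<in> borel_measurable (plborel {1..p} \<Otimes>\<^sub>M (lborel :: (real ^ 'n) measure))"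
      if i: "i \<in> {1..p}" for i
    proof -
      have "(\<lambda>z. fst z i :: real ^ 'n) \<in> borel_measurable (plborel {1..p} \<Otimes>\<^sub>M (lborel :: (real ^ 'n) measure))"
        by (rule measurable_compose[OF measurable_fst])
          (use measurable_component_singleton[OF i, of "\<lambda>_. lborel :: (real ^ 'n) measure"] in simp)
      moreover have "snd \<in> borel_measurable (plborel {1..p} \<Otimes>\<^sub>M (lborel :: (real ^ 'n) measure))"
        using measurable_snd[of "plborel {1..p}" "lborel :: (real ^ 'n) measure"] by simp
      ultimately show ?thesis by (intro borel_measurable_add)
    qed
    have ind: "indicator (E l) \<in> borel_measurable borel" for l
      using Eb by (rule borel_measurable_indicator)
    have snd: "(\<lambda>z. snd z) \<in> measurable (plborel {1..p} \<Otimes>\<^sub>M (lborel :: (real ^ 'n) measure)) borel"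
      using measurable_snd[of "plborel {1..p}" "lborel :: (real ^ 'n) measure"] by simp
    show ?thesis
      unfolding f_def split_beta'
      by (intro borel_measurable_times_ennreal borel_measurable_prod_ennreal measurable_compose[OF coord ind]
          measurable_compose[OF snd ind])
  qed
  interpret pair_sigma_finite "plborel {1..p} :: (nat \<Rightarrow> real ^ 'n) measure" "lborel :: (real ^ 'n) measure"
    by (intro pair_sigma_finite.intro lborel_product.sigma_finite lborel.sigma_finite_measure_axioms) simp
  have "(\<integral>\<^sup>+x. emeasure lborel {y. \<forall>l\<le>p. y + with_origin x l \<in> E l} \<partial>plborel {1..p})
    = (\<integral>\<^sup>+x. (\<integral>\<^sup>+y. f x y \<partial>lborel) \<partial>plborel {1..p})"
  proof (rule nn_integral_cong)
    fix x :: "nat \<Rightarrow> real ^ 'n"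
    have "{y. \<forall>l\<le>p. y + with_origin x l \<in> E l} = (\<Inter>l\<in>{..p}. (\<lambda>y. y + with_origin x l) -` E l)" by auto
    moreover have "closed (\<Inter>l\<in>{..p}. (\<lambda>y. y + with_origin x l) -` E l)"
      by (intro closed_INT ballI closed_vimage compact_imp_closed comp continuous_intros)
    ultimately have meas: "{y. \<forall>l\<le>p. y + with_origin x l \<in> E l} \<in> sets lborel"
      by (simp add: borel_closed)
    have "f x = indicator {y. \<forall>l\<le>p. y + with_origin x l \<in> E l}"
      by (rule ext) (rule f_ind[symmetric])
    then show "emeasure lborel {y. \<forall>l\<le>p. y + with_origin x l \<in> E l} = (\<integral>\<^sup>+y. f x y \<partial>lborel)"
      using nn_integral_indicator[OF meas] by (simp only:)
  qed
  also have "\<dots> = (\<integral>\<^sup>+y. (\<integral>\<^sup>+x. f x y \<partial>plborel {1..p}) \<partial>lborel)"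
    by (rule Fubini'[OF fmeas, symmetric])
  also have "\<dots> = (\<integral>\<^sup>+y. indicator (E 0) y * (\<Prod>i\<in>{1..p}. emeasure lborel (E i)) \<partial>lborel)"
  proof (rule nn_integral_cong)
    fix y :: "real ^ 'n"
    have ind: "(\<lambda>z. indicator (E i) (y + z) :: ennreal) \<in> borel_measurable lborel" for i
      by (rule measurable_compose[OF _ borel_measurable_indicator[OF Eb]]) simp
    have "(\<lambda>x. \<Prod>i\<in>{1..p}. indicator (E i) (y + x i) :: ennreal) \<in> borel_measurable (plborel {1..p})"
      by (rule borel_measurable_prod_ennreal, rule measurable_compose[OF _ ind], rule measurable_component_singleton)
    then have "(\<integral>\<^sup>+x. f x y \<partial>plborel {1..p})
      = indicator (E 0) y * (\<integral>\<^sup>+x. (\<Prod>i\<in>{1..p}. indicator (E i) (y + x i)) \<partial>plborel {1..p})"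
      unfolding f_def by (rule nn_integral_cmult)
    also have "(\<integral>\<^sup>+x. (\<Prod>i\<in>{1..p}. indicator (E i) (y + x i)) \<partial>plborel {1..p})
      = (\<Prod>i\<in>{1..p}. \<integral>\<^sup>+z. indicator (E i) (y + z) \<partial>lborel)"
      by (rule lborel_product.product_nn_integral_prod[OF finite_atLeastAtMost ind])
    also have "\<dots> = (\<Prod>i\<in>{1..p}. emeasure lborel (E i))"
    proof (intro prod.cong refl)
      fix i
      have "(\<lambda>z. z - (- y)) -` E i \<in> sets lborel"
        using closed_vimage[OF compact_imp_closed[OF comp[of i]], of "\<lambda>z. z - (- y)"]
        by (simp add: borel_closed continuous_intros)
      then have "(\<integral>\<^sup>+z. indicator ((\<lambda>z. z - (- y)) -` E i) z \<partial>lborel) = emeasure lborel (E i)"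
        using emeasure_lborel_translate[OF Eb[of i], of "- y"] by (simp only: nn_integral_indicator)
      moreover have "indicator ((\<lambda>z. z - (- y)) -` E i) z = (indicator (E i) (y + z) :: ennreal)" for z
        by (simp add: indicator_def add.commute)
      ultimately show "(\<integral>\<^sup>+z. indicator (E i) (y + z) \<partial>lborel) = emeasure lborel (E i)" by simp
    qed
    finally show "(\<integral>\<^sup>+x. f x y \<partial>plborel {1..p}) = indicator (E 0) y * (\<Prod>i\<in>{1..p}. emeasure lborel (E i))" .
  qed
  also have "\<dots> = emeasure lborel (E 0) * (\<Prod>i\<in>{1..p}. emeasure lborel (E i))"
    using Eb by (simp add: nn_integral_multc)
  also have "\<dots> = (\<Prod>l\<in>{0..p}. emeasure lborel (E l))"
    by (subst prod.atLeast_Suc_atMost[of 0 p]) simp_all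
  also have "\<dots> = (\<Prod>l\<le>p. ennreal (t l ^ CARD('n)) * emeasure lborel S)"
    by (intro prod.cong) (auto simp: E_meas atLeast0AtMost)
  finally show ?thesis unfolding E_def .
qed

text \<open>Layer formula for the power u^n in the variable v = (1 - s) m: this is the source of the
  weight in \<open>q_coef\<close>.\<close>

lemma nn_integral_beta_tail:
  assumes "m > 0" "0 \<le> u" "u \<le> m" "n > 0"
  shows "(\<integral>\<^sup>+s. ennreal (real n * (1 - s) ^ (n - 1)) * indicator {1 - u / m..1} s \<partial>lborel) = ennreal ((u / m) ^ n)"
proof -
  have "(\<integral>\<^sup>+s. ennreal (real n * (1 - s) ^ (n - 1)) * indicator {1 - u / m..1} s \<partial>lborel)
    = ennreal (- ((1 - 1) ^ n) - (- ((1 - (1 - u / m)) ^ n)))"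
  proof (rule nn_integral_FTC_Icc)
    fix s assume s: "s \<in> {1 - u / m..1}"
    show "((\<lambda>s. - ((1 - s) ^ n)) has_real_derivative real n * (1 - s) ^ (n - 1)) (at s)"
      by (auto intro!: derivative_eq_intros)
    show "0 \<le> real n * (1 - s) ^ (n - 1)" using s by simp
  qed (use assms in auto)
  then show ?thesis using assms by simp
qed

text \<open>The volume of the intersection, depth^n times that of S, is spread over layers, and the
  order of integration over x and s is exchanged. That m is one of the t l bounds the depth by m, so
  layers up to m exhaust it.\<close>

theorem simplex_volume_identity:
  assumes m: "m > 0" "\<And>l. l \<le> p \<Longrightarrow> m \<le> t l" and l0: "l0 \<le> p" "t l0 = m"
  shows "ennreal (m ^ CARD('n)) * emeasure lborel S *
      (\<integral>\<^sup>+s. ennreal (real CARD('n) * (1 - s) ^ (CARD('n) - 1) * pvol p (dbody p (\<lambda>l. t l - (1 - s) * m) S)) * indicator {0..1} s \<partial>lborel)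
    = (\<Prod>l\<le>p. ennreal (t l ^ CARD('n)) * emeasure lborel S)"
proof -
  let ?n = "CARD('n)" and ?P = "plborel {1..p} :: (nat \<Rightarrow> real ^ 'n) measure"
  let ?D = "\<lambda>s. dbody p (\<lambda>l. t l - (1 - s) * m) S"
  have t: "t l \<ge> 0" if "l \<le> p" for l using m(1) m(2)[OF that] by simp
  have tD: "t l - (1 - s) * m \<ge> 0" if "l \<le> p" "s \<in> {0..1}" for l s
  proof -
    have "(1 - s) * m \<le> 1 * m" using that m(1) by (intro mult_right_mono) auto
    with m(2)[OF that(1)] show ?thesis by simp
  qed
  define \<phi> where "\<phi> s = ennreal (real ?n * (1 - s) ^ (?n - 1)) * indicator {0..1} s" for s :: real
  \<comment> \<open>Weight of the layer s, restricted to the points x whose homothety ratio reaches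
    (1 - s) m.\<close>
  define \<psi> where "\<psi> x s = \<phi> s * (if (1 - s) * m \<le> depth p t x then 1 else 0)" for x s
  have \<phi>_meas: "\<phi> \<in> borel_measurable borel"
    unfolding \<phi>_def[abs_def] by measurable
  have \<psi>_meas: "case_prod \<psi> \<in> borel_measurable (?P \<Otimes>\<^sub>M lborel)"
  proof -
    have d: "(\<lambda>z. depth p t (fst z)) \<in> borel_measurable (?P \<Otimes>\<^sub>M (lborel :: real measure))"
      by (rule measurable_compose[OF measurable_fst measurable_depth])
    have s: "snd \<in> borel_measurable (?P \<Otimes>\<^sub>M (lborel :: real measure))"
      using measurable_snd[of ?P "lborel :: real measure"] by simp
    have set: "{z \<in> space (?P \<Otimes>\<^sub>M lborel). (1 - snd z) * m \<le> depth p t (fst z)} \<in> sets (?P \<Otimes>\<^sub>M (lborel :: real measure))"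
      using s d by (intro borel_measurable_le borel_measurable_times borel_measurable_diff borel_measurable_const)
    show ?thesis
      unfolding \<psi>_def split_beta'
      by (intro borel_measurable_times_ennreal measurable_compose[OF s \<phi>_meas] measurable_If borel_measurable_const set)
  qed
  have layer: "emeasure lborel {y. \<forall>l\<le>p. y + with_origin x l \<in> (*\<^sub>R) (t l) ` S}
    = ennreal (m ^ ?n) * emeasure lborel S * (\<integral>\<^sup>+s. \<psi> x s \<partial>lborel)" for x
  proof (cases "depth p t x \<ge> 0")
    case True
    let ?d = "depth p t x"
    have dm: "?d \<le> m" using depth_le[OF l0(1), of t x] l0(2) by simp
    have "(1 - s) * m \<le> ?d \<longleftrightarrow> 1 - ?d / m \<le> s" for s
      using m(1) by (simp add: field_simps)
    moreover have "1 - ?d / m \<ge> 0" using dm m(1) by simp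
    ultimately have "\<psi> x s = ennreal (real ?n * (1 - s) ^ (?n - 1)) * indicator {1 - ?d / m..1} s" for s
      unfolding \<psi>_def \<phi>_def by (auto simp: indicator_def)
    then have "(\<integral>\<^sup>+s. \<psi> x s \<partial>lborel) = ennreal ((?d / m) ^ ?n)"
      using nn_integral_beta_tail[OF m(1) True dm, of ?n] by simp
    moreover have "ennreal (m ^ ?n) * ennreal ((?d / m) ^ ?n) = ennreal (?d ^ ?n)"
      using m(1) True by (simp add: ennreal_mult[symmetric] power_divide)
    ultimately show ?thesis
      using True emeasure_intersection_simplex[of p t x] t by (simp add: mult_ac)
  next
    case False
    have "\<psi> x s = 0" for s
    proof (cases "s \<in> {0..1}")
      case True
      then have "(1 - s) * m \<ge> 0" using m(1) by simp
      then show ?thesis using False by (simp add: \<psi>_def)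
    qed (simp add: \<psi>_def \<phi>_def)
    then show ?thesis
      using False emeasure_intersection_simplex[of p t x] t by simp
  qed
  have slice: "(\<integral>\<^sup>+x. \<psi> x s \<partial>?P) = ennreal (real ?n * (1 - s) ^ (?n - 1) * pvol p (?D s)) * indicator {0..1} s" for s
  proof (cases "s \<in> {0..1}")
    case True
    have "(\<integral>\<^sup>+x. \<psi> x s \<partial>?P) = (\<integral>\<^sup>+x. \<phi> s * indicator (?D s) x \<partial>?P)"
    proof (rule nn_integral_cong)
      fix x assume "x \<in> space ?P"
      then have "x \<in> ?D s \<longleftrightarrow> (1 - s) * m \<le> depth p t x"
        using mem_dbody_simplex[of p t "(1 - s) * m" x] tD[OF _ True] by simp
      then show "\<psi> x s = \<phi> s * indicator (?D s) x" by (simp add: \<psi>_def indicator_def)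
    qed
    also have "\<dots> = \<phi> s * ennreal (pvol p (?D s))"
      using dbody_sets[OF compS] by (simp add: nn_integral_cmult emeasure_dbody[OF compS, symmetric])
    finally show ?thesis using True by (simp add: \<phi>_def ennreal_mult pvol_eq)
  qed (simp add: \<psi>_def \<phi>_def)
  interpret pair_sigma_finite ?P "lborel :: real measure"
    by (intro pair_sigma_finite.intro lborel_product.sigma_finite lborel.sigma_finite_measure_axioms) simp
  have inner_meas: "(\<lambda>x. \<integral>\<^sup>+s. \<psi> x s \<partial>lborel) \<in> borel_measurable ?P"
    by (rule lborel.borel_measurable_nn_integral[OF \<psi>_meas])
  have "(\<Prod>l\<le>p. ennreal (t l ^ ?n) * emeasure lborel S)
    = (\<integral>\<^sup>+x. ennreal (m ^ ?n) * emeasure lborel S * (\<integral>\<^sup>+s. \<psi> x s \<partial>lborel) \<partial>?P)"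
    unfolding layer[symmetric] by (rule nn_integral_intersection[symmetric]) (rule t)
  also have "\<dots> = ennreal (m ^ ?n) * emeasure lborel S * (\<integral>\<^sup>+x. (\<integral>\<^sup>+s. \<psi> x s \<partial>lborel) \<partial>?P)"
    by (rule nn_integral_cmult[OF inner_meas])
  also have "(\<integral>\<^sup>+x. (\<integral>\<^sup>+s. \<psi> x s \<partial>lborel) \<partial>?P) = (\<integral>\<^sup>+s. (\<integral>\<^sup>+x. \<psi> x s \<partial>?P) \<partial>lborel)"
    by (rule Fubini'[OF \<psi>_meas, symmetric])
  finally show ?thesis unfolding slice by simp
qed

end

section \<open>The inequality\<close>

lemma measure_pos_if_full_dim:
  fixes K :: "'a::euclidean_space set"
  assumes K: "convex_body K" and dim: "aff_dim K = int DIM('a)"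
  shows "measure lborel K > 0"
proof -
  have K': "compact K" "convex K" "K \<noteq> {}" using K by (auto simp: convex_body_def)
  have "interior K \<noteq> {}"
    using rel_interior_eq_empty[OF K'(2)] K'(3) interior_rel_interior[OF dim] by simp
  then have "\<not> negligible K" using negligible_convex_interior[OF K'(2)] by simp
  then have "measure lebesgue K \<noteq> 0"
    using negligible_iff_measure lmeasurable_compact[OF K'(1)] by blast
  then show ?thesis
    using borel_compact[OF K'(1)] by (simp add: measure_completion zero_less_measure_iff)
qed

text \<open>If K lies in a hyperplane, then s K - r K lies in a parallel one.\<close>

lemma measure_low_dim:
  fixes K :: "'a::euclidean_space set"
  assumes K: "compact K" and dim: "aff_dim K < int DIM('a)"
  shows "emeasure lborel ((\<lambda>(x, y). s *\<^sub>R x - r *\<^sub>R y) ` (K \<times> K)) = 0"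
proof -
  obtain a b where a: "a \<noteq> 0" and sub: "K \<subseteq> {x. a \<bullet> x = b}"
    by (rule aff_lowdim_subset_hyperplane[OF dim])
  have "(\<lambda>(x, y). s *\<^sub>R x - r *\<^sub>R y) ` (K \<times> K) \<subseteq> {x. a \<bullet> x = s * b - r * b}"
    using subsetD[OF sub] by (auto simp: inner_diff_right)
  then have "negligible ((\<lambda>(x, y). s *\<^sub>R x - r *\<^sub>R y) ` (K \<times> K))"
    using negligible_hyperplane[of a "s * b - r * b"] a by (blast intro: negligible_subset)
  then show ?thesis
    using borel_compact[OF compact_scaled_difference[OF K, of s r]]
    by (simp add: negligible_iff_null_sets null_sets_completion_iff null_setsD1)
qed

lemma pvol_dbody_eq_0:
  fixes K :: "(real ^ 'n) set"
  assumes K: "compact K" and p: "p \<ge> 1"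
    and zero: "emeasure lborel ((\<lambda>(x, y). t 1 *\<^sub>R x - t 0 *\<^sub>R y) ` (K \<times> K)) = 0"
  shows "pvol p (dbody p t K) = 0"
proof -
  have "(\<Prod>i\<in>{1..p}. emeasure lborel ((\<lambda>(x, y). t i *\<^sub>R x - t 0 *\<^sub>R y) ` (K \<times> K))) = 0"
    using p zero by (intro prod_zero bexI[of _ 1]) auto
  then have "emeasure (plborel {1..p}) (dbody p t K) \<le> 0"
    using emeasure_dbody_le[OF K, of p t] by (simp only:)
  then have "emeasure (plborel {1..p}) (dbody p t K) = 0" by (simp only: le_zero_eq)
  then show ?thesis unfolding pvol_eq by (simp add: measure_def)
qed

section \<open>Integrals of the volumes at shifted parameters\<close>

definition gap :: "nat \<Rightarrow> (nat \<Rightarrow> real) \<Rightarrow> real \<Rightarrow> nat \<Rightarrow> real" where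
  "gap p t s l = t l - (1 - s) * t_min p t"

text \<open>Summing the integrands of \<open>q_coef\<close> against the mixed volumes gives this
  single integrand, up to the constant n t_min^n.\<close>

definition weighted_volume :: "nat \<Rightarrow> (nat \<Rightarrow> real) \<Rightarrow> (real ^ 'n) set \<Rightarrow> real \<Rightarrow> real" where
  "weighted_volume p t K s = (1 - s) ^ (CARD('n) - 1) * pvol p (dbody p (gap p t s) K)"

lemma t_min_le: "l \<le> p \<Longrightarrow> t_min p t \<le> t l"
  unfolding t_min_def by (intro Min_le) auto

lemma t_min_attained: "\<exists>l\<le>p. t l = t_min p t"
proof -
  have "t_min p t \<in> t ` {..p}" unfolding t_min_def by (rule Min_in) auto
  then show ?thesis by (auto simp: image_iff)
qed

lemma gap_nonneg: "(\<And>l. l \<le> p \<Longrightarrow> t l \<ge> 0) \<Longrightarrow> s \<in> {0..1} \<Longrightarrow> l \<le> p \<Longrightarrow> gap p t s l \<ge> 0"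
proof -
  assume t: "\<And>l. l \<le> p \<Longrightarrow> t l \<ge> 0" and s: "s \<in> {0..1}" and l: "l \<le> p"
  have "t_min p t \<ge> 0" using t_min_attained[of p t] t by metis
  then have "(1 - s) * t_min p t \<le> 1 * t_min p t" using s by (intro mult_right_mono) auto
  with t_min_le[OF l, of t] show ?thesis by (simp add: gap_def)
qed

context
  fixes K :: "(real ^ 'n) set" and p :: nat and t :: "nat \<Rightarrow> real"
  assumes K: "convex_body K" and p: "p \<ge> 1" and t: "\<And>l. l \<le> p \<Longrightarrow> t l \<ge> 0"
begin

lemma weighted_volume_eq_sum:
  assumes "s \<in> {0..1}"
  shows "weighted_volume p t K s = (\<Sum>j\<in>multi_indices CARD('n) p. multinom CARD('n) p j * W_mixed p K j *
    ((1 - s) ^ (CARD('n) - 1) * (\<Prod>l\<le>p. (t l - (1 - s) * t_min p t) ^ (CARD('n) - j l))))"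
proof -
  have "pvol p (dbody p (gap p t s) K) = (\<Sum>j\<in>multi_indices CARD('n) p. multinom CARD('n) p j * W_mixed p K j *
      (\<Prod>l\<le>p. gap p t s l ^ (CARD('n) - j l)))"
    by (rule pvol_dbody_eq_sum[OF K p]) (rule gap_nonneg[OF t assms])
  then show ?thesis
    unfolding weighted_volume_def gap_def by (simp add: sum_distrib_left mult_ac)
qed

text \<open>Read off from the expansion in mixed volumes, which is polynomial in s. Continuity gives
  integrability and is also what the equality case rests on.\<close>

lemma continuous_on_weighted_volume: "continuous_on {0..1} (weighted_volume p t K)"
proof -
  have "continuous_on {0..1} (\<lambda>s. \<Sum>j\<in>multi_indices CARD('n) p. multinom CARD('n) p j * W_mixed p K j *
    ((1 - s) ^ (CARD('n) - 1) * (\<Prod>l\<le>p. (t l - (1 - s) * t_min p t) ^ (CARD('n) - j l))))"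
    by (intro continuous_intros)
  then show ?thesis
    by (rule continuous_on_eq) (rule weighted_volume_eq_sum[symmetric])
qed

lemma sum_q_coef_W_mixed:
  "(\<Sum>j\<in>multi_indices CARD('n) p. q_coef CARD('n) p j t * W_mixed p K j)
    = real CARD('n) * t_min p t ^ CARD('n) * integral {0..1} (weighted_volume p t K)"
proof -
  let ?h = "\<lambda>j s. (1 - s) ^ (CARD('n) - 1) * (\<Prod>l\<le>p. (t l - (1 - s) * t_min p t) ^ (CARD('n) - j l))"
  have int: "?h j integrable_on {0..1}" for j
    by (intro integrable_continuous_interval continuous_intros)
  have "integral {0..1} (weighted_volume p t K)
    = integral {0..1} (\<lambda>s. \<Sum>j\<in>multi_indices CARD('n) p. multinom CARD('n) p j * W_mixed p K j * ?h j s)"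
    by (rule integral_cong) (rule weighted_volume_eq_sum)
  also have "\<dots> = (\<Sum>j\<in>multi_indices CARD('n) p. integral {0..1} (\<lambda>s. multinom CARD('n) p j * W_mixed p K j * ?h j s))"
    by (intro integral_sum finite_multi_indices integrable_on_mult_right int)
  also have "\<dots> = (\<Sum>j\<in>multi_indices CARD('n) p. multinom CARD('n) p j * W_mixed p K j * integral {0..1} (?h j))"
    by simp
  finally show ?thesis
    by (simp add: q_coef_def sum_distrib_left mult_ac)
qed

lemma weighted_volume_nonneg: "s \<in> {0..1} \<Longrightarrow> weighted_volume p t K s \<ge> 0"
  unfolding weighted_volume_def pvol_eq by simp

end

text \<open>The product over p + 1 indices yields the power p + 1 of the volume of S; one factor
  cancels against the volume on the left of \<open>simplex_volume_identity\<close>.\<close>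

lemma simplex_sum_q_coef:
  fixes S :: "(real ^ 'n) set"
  assumes S: "int CARD('n) simplex S" and p: "p \<ge> 1" and t: "\<And>l. l \<le> p \<Longrightarrow> t l \<ge> 0" and m: "t_min p t > 0"
  shows "real CARD('n) * t_min p t ^ CARD('n) * integral {0..1} (weighted_volume p t S)
    = (\<Prod>l\<le>p. t l ^ CARD('n)) * measure lborel S ^ p"
proof -
  let ?n = "CARD('n)" and ?m = "t_min p t" and ?V = "measure lborel S"
  have S': "compact S" "convex S" "S \<noteq> {}"
    using polytope_imp_compact[OF simplex_imp_polytope[OF S]] polytope_imp_convex[OF simplex_imp_polytope[OF S]] aff_dim_simplex[OF S] by auto
  then have body: "convex_body S" by (simp add: convex_body_def)
  have V: "?V > 0" using measure_pos_if_full_dim[OF body] aff_dim_simplex[OF S] by simp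
  have eV: "emeasure lborel S = ennreal ?V"
    using emeasure_compact_finite[OF S'(1)] by (intro emeasure_eq_ennreal_measure) auto
  obtain C b a where bary: "barycentric C b a S"
    using simplex_barycentric[of S] S by auto
  obtain l0 where l0: "l0 \<le> p" "t l0 = ?m" using t_min_attained by blast
  let ?W = "weighted_volume p t S"
  have cont: "continuous_on {0..1} (\<lambda>s. real ?n * ?W s)"
    by (intro continuous_intros continuous_on_weighted_volume body p t)
  note si = borel_integrable_atLeastAtMost'[OF cont]
  have "(\<integral>\<^sup>+s. ennreal (real ?n * (1 - s) ^ (?n - 1) * pvol p (dbody p (\<lambda>l. t l - (1 - s) * ?m) S)) * indicator {0..1} s \<partial>lborel)
    = (\<integral>\<^sup>+s. ennreal (indicator {0..1} s *\<^sub>R (real ?n * ?W s)) \<partial>lborel)"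
    by (intro nn_integral_cong) (auto simp: indicator_def weighted_volume_def gap_def[abs_def] mult_ac)
  also have "\<dots> = ennreal (LINT s:{0..1}|lborel. real ?n * ?W s)"
    unfolding set_lebesgue_integral_def
    by (rule nn_integral_eq_integral) (use si in \<open>auto simp: set_integrable_def indicator_def weighted_volume_def pvol_eq\<close>)
  also have "(LINT s:{0..1}|lborel. real ?n * ?W s) = real ?n * integral {0..1} ?W"
    using set_borel_integral_eq_integral(2)[OF si] by simp
  finally have "ennreal (?m ^ ?n) * ennreal ?V * ennreal (real ?n * integral {0..1} ?W)
      = (\<Prod>l\<le>p. ennreal (t l ^ ?n) * ennreal ?V)"
    using simplex_volume_identity[OF bary S'(1,3) m, of p t l0] t_min_le l0 by (simp only: eV)
  moreover have "integral {0..1} ?W \<ge> 0"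
    by (intro integral_nonneg integrable_continuous_interval continuous_on_weighted_volume body p t weighted_volume_nonneg)
  moreover have "(\<Prod>l\<le>p. ennreal (t l ^ ?n) * ennreal ?V) = ennreal (\<Prod>l\<le>p. t l ^ ?n * ?V)"
  proof -
    have "(\<Prod>l\<le>p. ennreal (t l ^ ?n) * ennreal ?V) = (\<Prod>l\<le>p. ennreal (t l ^ ?n * ?V))"
      using t by (intro prod.cong refl ennreal_mult[symmetric]) auto
    also have "\<dots> = ennreal (\<Prod>l\<le>p. t l ^ ?n * ?V)"
      using t by (intro prod_ennreal) auto
    finally show ?thesis .
  qed
  ultimately have "ennreal (?m ^ ?n * ?V * (real ?n * integral {0..1} ?W)) = ennreal (\<Prod>l\<le>p. t l ^ ?n * ?V)"
    using m V by (simp add: ennreal_mult[symmetric])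
  then have "?m ^ ?n * ?V * (real ?n * integral {0..1} ?W) = (\<Prod>l\<le>p. t l ^ ?n * ?V)"
    using m V t \<open>integral {0..1} ?W \<ge> 0\<close> by (subst (asm) ennreal_inj) (auto intro!: prod_nonneg)
  also have "\<dots> = (\<Prod>l\<le>p. t l ^ ?n) * ?V ^ p * ?V"
    by (simp add: prod.distrib)
  finally show ?thesis using V by (simp add: mult_ac)
qed

theorem proposition7p9:
  fixes S :: "(real ^ 'n) set"
  assumes n: "CARD('n) \<ge> 2"
    and S: "int CARD('n) simplex S"
    and hyp: "\<forall>p\<ge>1. \<forall>K :: (real ^ 'n) set. convex_body K \<and> aff_dim K = int CARD('n) \<longrightarrow>
      (\<forall>t \<in> Theta p.
        pvol p (diff_body p t K) / measure lborel K ^ p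
          \<le> pvol p (diff_body p t S) / measure lborel S ^ p) \<and>
      ((\<exists>t \<in> relint_Theta p.
          pvol p (diff_body p t K) / measure lborel K ^ p
            = pvol p (diff_body p t S) / measure lborel S ^ p) \<longrightarrow> is_simplex K)"
  shows "\<forall>p\<ge>1. \<forall>K :: (real ^ 'n) set. convex_body K \<longrightarrow>
      (\<forall>t \<in> Theta p.
        (\<Sum>j \<in> multi_indices CARD('n) p. q_coef CARD('n) p j t * W_mixed p K j)
          \<le> (\<Prod>l\<le>p. t l ^ CARD('n)) * measure lborel K ^ p) \<and>
      (aff_dim K = int CARD('n) \<and>
        (\<exists>t \<in> relint_Theta p.
          (\<Sum>j \<in> multi_indices CARD('n) p. q_coef CARD('n) p j t * W_mixed p K j)
            = (\<Prod>l\<le>p. t l ^ CARD('n)) * measure lborel K ^ p) \<longrightarrow> is_simplex K)"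
proof (intro allI impI)
  fix p :: nat and K :: "(real ^ 'n) set"
  assume p: "p \<ge> 1" and K: "convex_body K"
  let ?n = "CARD('n)" and ?VK = "measure lborel K" and ?VS = "measure lborel S"
  have K': "compact K" "convex K" "K \<noteq> {}" using K by (auto simp: convex_body_def)
  have S': "compact S" "convex S" "S \<noteq> {}"
    using polytope_imp_compact[OF simplex_imp_polytope[OF S]] polytope_imp_convex[OF simplex_imp_polytope[OF S]] aff_dim_simplex[OF S] by auto
  then have bodyS: "convex_body S" by (simp add: convex_body_def)
  have VS: "?VS > 0" using measure_pos_if_full_dim[OF bodyS] aff_dim_simplex[OF S] by simp
  have Theta_nonneg: "t l \<ge> 0" if "t \<in> Theta p" "l \<le> p" for t l
    using that by (auto simp: Theta_def)

  \<comment> \<open>The hypothesis speaks only of parameters with sum 1; dividing by the sum brings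
    the shifted ones into this form.\<close>
  have normalise: "\<exists>\<theta>\<in>Theta p. \<exists>T>0. (\<forall>l\<le>p. \<tau> l = T * \<theta> l) \<and> ((\<forall>l\<le>p. \<tau> l > 0) \<longrightarrow> \<theta> \<in> relint_Theta p)"
    if \<tau>: "\<And>l. l \<le> p \<Longrightarrow> \<tau> l \<ge> 0" and pos: "(\<Sum>l\<le>p. \<tau> l) > 0" for \<tau>
  proof -
    let ?T = "\<Sum>l\<le>p. \<tau> l"
    let ?\<theta> = "\<lambda>l\<in>{..p}. \<tau> l / ?T"
    have "?\<theta> \<in> Theta p"
      using \<tau> pos by (auto simp: Theta_def sum_divide_distrib[symmetric])
    moreover have "(\<forall>l\<le>p. \<tau> l > 0) \<longrightarrow> ?\<theta> \<in> relint_Theta p"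
      using \<open>?\<theta> \<in> Theta p\<close> pos by (auto simp: relint_Theta_def)
    ultimately show ?thesis using pos by (intro bexI[of _ ?\<theta>] exI[of _ ?T]) auto
  qed
  have scale: "pvol p (dbody p \<tau> L) = T ^ (?n * p) * pvol p (diff_body p \<theta> L)"
    if "convex_body L" "\<theta> \<in> Theta p" "T > 0" "\<forall>l\<le>p. \<tau> l = T * \<theta> l" for \<tau> \<theta> :: "nat \<Rightarrow> real" and T and L :: "(real ^ 'n) set"
  proof -
    have L: "compact L" "convex L" "L \<noteq> {}" using that(1) by (auto simp: convex_body_def)
    have "dbody p \<tau> L = dbody p (\<lambda>l. T * \<theta> l) L" using that(4) by (intro dbody_cong) auto
    moreover have "diff_body p \<theta> L = dbody p \<theta> L"
      using L Theta_nonneg[OF that(2)] by (intro diff_body_eq_dbody) auto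
    ultimately show ?thesis using pvol_dbody_scale[OF L(1) that(3), of p \<theta>] by simp
  qed

  \<comment> \<open>The hypothesis with denominators cleared and for all nonnegative parameters:
    both sides scale with the power n * p. If all parameters vanish, the body of K is null and the
    equality case is vacuous.\<close>
  have full: "pvol p (dbody p \<tau> K) * ?VS ^ p \<le> pvol p (dbody p \<tau> S) * ?VK ^ p"
      "(\<forall>l\<le>p. \<tau> l > 0) \<Longrightarrow> pvol p (dbody p \<tau> K) * ?VS ^ p = pvol p (dbody p \<tau> S) * ?VK ^ p \<Longrightarrow> is_simplex K"
    if dim: "aff_dim K = int ?n" and \<tau>: "\<And>l. l \<le> p \<Longrightarrow> \<tau> l \<ge> 0" for \<tau>
  proof -
    have VK: "?VK > 0" using measure_pos_if_full_dim[OF K] dim by simp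
    have cases: "pvol p (dbody p \<tau> K) * ?VS ^ p \<le> pvol p (dbody p \<tau> S) * ?VK ^ p \<and>
      ((\<forall>l\<le>p. \<tau> l > 0) \<longrightarrow> pvol p (dbody p \<tau> K) * ?VS ^ p = pvol p (dbody p \<tau> S) * ?VK ^ p \<longrightarrow> is_simplex K)"
    proof (cases "(\<Sum>l\<le>p. \<tau> l) > 0")
      case True
      obtain \<theta> T where \<theta>: "\<theta> \<in> Theta p" and T: "T > 0" "\<forall>l\<le>p. \<tau> l = T * \<theta> l"
          and relint: "(\<forall>l\<le>p. \<tau> l > 0) \<longrightarrow> \<theta> \<in> relint_Theta p"
        using normalise[OF \<tau> True] by blast
      note sK = scale[OF K \<theta> T] and sS = scale[OF bodyS \<theta> T]
      have h: "pvol p (diff_body p \<theta> K) / ?VK ^ p \<le> pvol p (diff_body p \<theta> S) / ?VS ^ p"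
          "\<theta> \<in> relint_Theta p \<Longrightarrow> pvol p (diff_body p \<theta> K) / ?VK ^ p = pvol p (diff_body p \<theta> S) / ?VS ^ p \<Longrightarrow> is_simplex K"
        using hyp p K dim \<theta> by blast+
      have "pvol p (diff_body p \<theta> K) * ?VS ^ p \<le> pvol p (diff_body p \<theta> S) * ?VK ^ p"
        using h(1) VK VS by (simp add: field_simps)
      then have "pvol p (dbody p \<tau> K) * ?VS ^ p \<le> pvol p (dbody p \<tau> S) * ?VK ^ p"
        unfolding sK sS mult.assoc using T(1) by (intro mult_left_mono) auto
      moreover have "is_simplex K" if "\<forall>l\<le>p. \<tau> l > 0"
        and eq: "pvol p (dbody p \<tau> K) * ?VS ^ p = pvol p (dbody p \<tau> S) * ?VK ^ p"
      proof (rule h(2))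
        show "\<theta> \<in> relint_Theta p" using relint that(1) by blast
        have "pvol p (diff_body p \<theta> K) * ?VS ^ p = pvol p (diff_body p \<theta> S) * ?VK ^ p"
          using eq T(1) unfolding sK sS mult.assoc by simp
        then show "pvol p (diff_body p \<theta> K) / ?VK ^ p = pvol p (diff_body p \<theta> S) / ?VS ^ p"
          using VK VS by (simp add: frac_eq_eq)
      qed
      ultimately show ?thesis by blast
    next
      case False
      have "(\<Sum>l\<le>p. \<tau> l) \<ge> 0" using \<tau> by (intro sum_nonneg) simp
      with False have "(\<Sum>l\<le>p. \<tau> l) = 0" by simp
      then have zero: "\<tau> l = 0" if "l \<le> p" for l
        using \<tau> that by (intro sum_nonneg_0[of "{..p}" \<tau> l]) auto
      have "(\<lambda>(x, y). \<tau> 1 *\<^sub>R x - \<tau> 0 *\<^sub>R y) ` (K \<times> K) = {0}" 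
        using zero[of 0] zero[of 1] p K'(3) by auto
      then have "pvol p (dbody p \<tau> K) = 0" by (intro pvol_dbody_eq_0[OF K'(1) p]) simp
      then show ?thesis using zero[of 0] by (auto simp: pvol_eq)
    qed
    show "pvol p (dbody p \<tau> K) * ?VS ^ p \<le> pvol p (dbody p \<tau> S) * ?VK ^ p"
      using cases by blast
    show "is_simplex K" if "\<forall>l\<le>p. \<tau> l > 0" "pvol p (dbody p \<tau> K) * ?VS ^ p = pvol p (dbody p \<tau> S) * ?VK ^ p"
      using cases that by blast
  qed

  have ineq: "(\<Sum>j \<in> multi_indices ?n p. q_coef ?n p j t * W_mixed p K j) \<le> (\<Prod>l\<le>p. t l ^ ?n) * ?VK ^ p"
    if t: "t \<in> Theta p" for t
  proof -
    note t0 = Theta_nonneg[OF t]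
    have sum_K: "(\<Sum>j \<in> multi_indices ?n p. q_coef ?n p j t * W_mixed p K j)
        = ?n * t_min p t ^ ?n * integral {0..1} (weighted_volume p t K)"
      by (rule sum_q_coef_W_mixed[OF K p]) (rule t0)
    have sum_S: "?n * t_min p t ^ ?n * integral {0..1} (weighted_volume p t S) = (\<Prod>l\<le>p. t l ^ ?n) * ?VS ^ p"
      if "t_min p t > 0"
      by (rule simplex_sum_q_coef[OF S p _ that]) (rule t0)
    have rhs: "(\<Prod>l\<le>p. t l ^ ?n) * ?VK ^ p \<ge> 0" using t0 by (intro mult_nonneg_nonneg prod_nonneg) auto
    have m0: "t_min p t \<ge> 0" using t_min_attained[of p t] t0 by metis
    have contK: "continuous_on {0..1} (\<lambda>s. weighted_volume p t K s * ?VS ^ p)"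
      by (intro continuous_on_mult_right continuous_on_weighted_volume[OF K p]) (rule t0)
    have contS: "continuous_on {0..1} (\<lambda>s. weighted_volume p t S s * ?VK ^ p)"
      by (intro continuous_on_mult_right continuous_on_weighted_volume[OF bodyS p]) (rule t0)
    \<comment> \<open>For t_min = 0 the left-hand side has the factor 0, and for lower-dimensional K
      all difference bodies are null. The remaining case is the one covered by the hypothesis and
      the identity for S.\<close>
    consider "t_min p t = 0" | "t_min p t > 0" "aff_dim K = int ?n" | "aff_dim K < int ?n"
      using m0 aff_dim_le_DIM[of K] by fastforce
    then show ?thesis
    proof cases
      case 1
      then show ?thesis using rhs by (simp add: sum_K zero_power)
    next
      case 2
      have "integral {0..1} (\<lambda>s. weighted_volume p t K s * ?VS ^ p) \<le> integral {0..1} (\<lambda>s. weighted_volume p t S s * ?VK ^ p)"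
      proof (rule integral_le)
        fix s :: real assume s: "s \<in> {0..1}"
        show "weighted_volume p t K s * ?VS ^ p \<le> weighted_volume p t S s * ?VK ^ p"
          unfolding weighted_volume_def mult.assoc
          using s by (intro mult_left_mono full(1)[OF 2(2)] gap_nonneg t0) auto
      qed (rule integrable_continuous_interval[OF contK] integrable_continuous_interval[OF contS])+
      then have "integral {0..1} (weighted_volume p t K) * ?VS ^ p \<le> integral {0..1} (weighted_volume p t S) * ?VK ^ p"
        by simp
      then have "?n * t_min p t ^ ?n * (integral {0..1} (weighted_volume p t K) * ?VS ^ p)
        \<le> ?n * t_min p t ^ ?n * (integral {0..1} (weighted_volume p t S) * ?VK ^ p)"
        using m0 by (intro mult_left_mono) auto
      also have "\<dots> = ((\<Prod>l\<le>p. t l ^ ?n) * ?VS ^ p) * ?VK ^ p"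
        by (simp only: mult.assoc[symmetric] sum_S[OF 2(1)])
      finally have "(?n * t_min p t ^ ?n * integral {0..1} (weighted_volume p t K)) * ?VS ^ p
        \<le> ((\<Prod>l\<le>p. t l ^ ?n) * ?VK ^ p) * ?VS ^ p"
        by (simp only: mult_ac)
      then have "?n * t_min p t ^ ?n * integral {0..1} (weighted_volume p t K) \<le> (\<Prod>l\<le>p. t l ^ ?n) * ?VK ^ p"
        using VS by (simp add: mult_le_cancel_right)
      then show ?thesis by (simp only: sum_K)
    next
      case 3
      then have low: "aff_dim K < int DIM(real ^ 'n)" by simp
      have "weighted_volume p t K = (\<lambda>s. 0)"
        unfolding weighted_volume_def[abs_def]
        using pvol_dbody_eq_0[OF K'(1) p measure_low_dim[OF K'(1) low]] by simp
      then have "integral {0..1} (weighted_volume p t K) = 0" by simp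
      then show ?thesis using rhs by (simp add: sum_K zero_power)
    qed
  qed

  have equality: "is_simplex K"
    if dim: "aff_dim K = int ?n" and t: "t \<in> relint_Theta p"
      and eq: "(\<Sum>j \<in> multi_indices ?n p. q_coef ?n p j t * W_mixed p K j) = (\<Prod>l\<le>p. t l ^ ?n) * ?VK ^ p" for t
  proof -
    have tT: "t \<in> Theta p" and tpos: "\<And>l. l \<le> p \<Longrightarrow> t l > 0"
      using t by (auto simp: relint_Theta_def)
    note t0 = Theta_nonneg[OF tT]
    have sum_K: "(\<Sum>j \<in> multi_indices ?n p. q_coef ?n p j t * W_mixed p K j)
        = ?n * t_min p t ^ ?n * integral {0..1} (weighted_volume p t K)"
      by (rule sum_q_coef_W_mixed[OF K p]) (rule t0)
    have sum_S: "?n * t_min p t ^ ?n * integral {0..1} (weighted_volume p t S) = (\<Prod>l\<le>p. t l ^ ?n) * ?VS ^ p"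
      if "t_min p t > 0"
      by (rule simplex_sum_q_coef[OF S p _ that]) (rule t0)
    have m: "t_min p t > 0" using t_min_attained[of p t] tpos by metis
    let ?f = "\<lambda>s. weighted_volume p t S s * ?VK ^ p - weighted_volume p t K s * ?VS ^ p"
    have contK: "continuous_on {0..1} (\<lambda>s. weighted_volume p t K s * ?VS ^ p)"
      by (intro continuous_on_mult_right continuous_on_weighted_volume[OF K p]) (rule t0)
    have contS: "continuous_on {0..1} (\<lambda>s. weighted_volume p t S s * ?VK ^ p)"
      by (intro continuous_on_mult_right continuous_on_weighted_volume[OF bodyS p]) (rule t0)
    have nonneg: "?f s \<ge> 0" if s: "s \<in> {0..1}" for s
    proof -
      have "weighted_volume p t K s * ?VS ^ p \<le> weighted_volume p t S s * ?VK ^ p"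
        unfolding weighted_volume_def mult.assoc
        using s by (intro mult_left_mono full(1)[OF dim] gap_nonneg t0) auto
      then show ?thesis by simp
    qed
    have "?n * t_min p t ^ ?n * (integral {0..1} (weighted_volume p t S) * ?VK ^ p)
      = ((\<Prod>l\<le>p. t l ^ ?n) * ?VS ^ p) * ?VK ^ p"
      by (simp only: mult.assoc[symmetric] sum_S[OF m])
    also have "\<dots> = ((\<Prod>l\<le>p. t l ^ ?n) * ?VK ^ p) * ?VS ^ p" by (simp only: mult_ac)
    also have "\<dots> = ?n * t_min p t ^ ?n * (integral {0..1} (weighted_volume p t K) * ?VS ^ p)"
      unfolding eq[symmetric] sum_K by (simp only: mult.assoc)
    finally have "integral {0..1} (weighted_volume p t S) * ?VK ^ p = integral {0..1} (weighted_volume p t K) * ?VS ^ p"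
      using m by simp
    then have "integral {0..1} ?f = 0"
      using integrable_continuous_interval[OF contK] integrable_continuous_interval[OF contS]
      by (subst integral_diff) auto
    then have "\<forall>s\<in>{0..1}. ?f s = 0"
      using integral_eq_0_iff[of 0 1 ?f] continuous_on_diff[OF contS contK] nonneg by simp
    \<comment> \<open>An interior point is needed: at s = 0 the smallest gap is 0, and at s = 1 the
      weight vanishes because n >= 2.\<close>
    then have "?f (1 / 2) = 0" by simp
    then have "(1 / 2) ^ (?n - 1) * (pvol p (dbody p (gap p t (1 / 2)) K) * ?VS ^ p)
      = (1 / 2) ^ (?n - 1) * (pvol p (dbody p (gap p t (1 / 2)) S) * ?VK ^ p)"
      by (simp add: weighted_volume_def mult.assoc)
    then have half: "pvol p (dbody p (gap p t (1 / 2)) K) * ?VS ^ p = pvol p (dbody p (gap p t (1 / 2)) S) * ?VK ^ p"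
      by simp
    have pos: "gap p t (1 / 2) l > 0" if "l \<le> p" for l
      using t_min_le[OF that, of t] m by (simp add: gap_def)
    show ?thesis
      using full(2)[OF dim, of "gap p t (1 / 2)"] pos half less_imp_le[OF pos] by blast
  qed

  show "(\<forall>t \<in> Theta p. (\<Sum>j \<in> multi_indices ?n p. q_coef ?n p j t * W_mixed p K j) \<le> (\<Prod>l\<le>p. t l ^ ?n) * ?VK ^ p) \<and>
      (aff_dim K = int ?n \<and> (\<exists>t \<in> relint_Theta p.
          (\<Sum>j \<in> multi_indices ?n p. q_coef ?n p j t * W_mixed p K j) = (\<Prod>l\<le>p. t l ^ ?n) * ?VK ^ p) \<longrightarrow> is_simplex K)"
    using ineq equality by blast
qed

end
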